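(* Let $p$ be a prime, let $\mathcal O$ be a valuation ring and $K$ its field of fractions. Then for all integers $h\ge1$ the base change functor $\mathrm{FLG}^h(\mathcal O)\to\mathrm{FLG}^h(K)$ between groupoids of formal Lie groups of height $h$ (relative to $p$) and their isomorphisms is fully faithful.
   Context: Formal Lie groups. A formal Lie variety over a scheme $S$ is an fppf sheaf on $S$-schemes with a section over $S$ which, Zariski locally on $S$, is isomorphic as a pointed sheaf to $\operatorname{Spf}\mathcal O_S[[T]]$ with its $0$-section. A formal Lie group over $S$ is an fppf sheaf of commutative groups whose underlying sheaf, pointed by the identity section, is a formal Lie variety. $\mathrm{FLG}$ is the stack over schemes of formal Lie groups and isomorphisms; $\mathrm{FLG}(A)$ denotes the fiber over $\operatorname{Spec}A$. Buds. For a pointed sheaf $(X,\sigma)$ over $S$, $X^{(n)}\subset X$ is the fppf sheafification of the subpresheaf of those $T\to X$ for which some closed subscheme $T'\subset T$ defined by a quasi-coherent ideal with $(n+1)$st power zero maps to $X$ through $\sigma$. $X$ is $n$-infinitesimal if $X^{(n)}=X$. An $n$-germ is a pointed, representable, $n$-infinitesimal sheaf $(X,\sigma)$ such that, for $\mathcal I$ the ideal of $\sigma$, each $\sigma^*(\mathcal I^i/\mathcal I^{i+1})$, $1\le i\le n$, is locally free of rank $1$. An $n$-bud is an $n$-germ with $F\colon(X\times_SX)^{(n)}\to X$ which is unital with respect to $\sigma$, commutative, and associative on $(X\times_SX\times_SX)^{(n)}$. If $X$ is a formal Lie group, then $X^{(n)}$ is an $n$-bud by restriction of the multiplication. Height.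 For an $n$-bud $X$ put $[p]_X:=p\cdot\mathrm{id}_X$ in the abelian group $\operatorname{End}(X)$ (addition $f+g=F\circ(f,g)$), and $\mathcal I_X:=\ker[\sigma^{-1}\mathcal O_X\to\mathcal O_S]$. For $n\ge p^h$, $X$ has height $\ge h$ if the endomorphism of $\mathcal I_X$ induced by $[p]_X$ has image in $\mathcal I_X^{p^h}$; this defines a closed substack $\mathcal B_n^{\ge h}$ of the stack $\mathcal B_n$ of $n$-buds and isomorphisms. For $n\ge p^{h+1}$, the stack of $n$-buds of (exact) height $h$ is the open complement of $\mathcal B_n^{\ge h+1}$ in $\mathcal B_n^{\ge h}$. A formal Lie group $X$ has height $h$ if the $p^{h+1}$-bud $X^{(p^{h+1})}$ has height $h$; $\mathrm{FLG}^h\subset\mathrm{FLG}$ is the substack of formal Lie groups of height $h$. For $h\ge1$ it lies over $\mathbb F_p$-schemes (so its fiber over other schemes is empty). *)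

theory Defs
  imports "HOL-Algebra.Algebra" "HOL-Library.FuncSet"
begin

section \<open>Algebras over a base ring\<close>

text \<open>
  All rings live on subsets of one fixed type \<open>'u\<close>, which plays the role of the universe.  If it is
  infinite it contains, up to isomorphism, every algebra of finite type, every quotient, every
  localization and every finite tensor product of the rings it contains.

  An algebra over \<open>A\<close> is a pair of a ring and a structure map from \<open>A\<close>; a sheaf on schemes over
  \<open>Spec A\<close> for the fppf topology is determined by its values on affine schemes, i.e. it is a
  covariant functor on such algebras.  Structure maps and homomorphisms are extensional functions,
  so that equality of functions is equality of morphisms.
\<close>

type_synonym 'u alg = "'u ring \<times> ('u \<Rightarrow> 'u)"

abbreviation alg_carrier :: "'u alg \<Rightarrow> 'u set" where
  "alg_carrier R \<equiv> carrier (fst R)"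

definition algs :: "'u ring \<Rightarrow> 'u alg set" where
  "algs A = {R. cring (fst R) \<and> snd R \<in> ring_hom A (fst R) \<inter> extensional (carrier A)}"

definition alg_hom :: "'u ring \<Rightarrow> 'u alg \<Rightarrow> 'u alg \<Rightarrow> ('u \<Rightarrow> 'u) set" where
  "alg_hom A R T = {f \<in> ring_hom (fst R) (fst T) \<inter> extensional (alg_carrier R).
     \<forall>a \<in> carrier A. f (snd R a) = snd T a}"

definition self_alg :: "'u ring \<Rightarrow> 'u alg" where
  "self_alg A = (A, \<lambda>a\<in>carrier A. a)"

definition restrict_scalars :: "'u ring \<Rightarrow> ('u \<Rightarrow> 'u) \<Rightarrow> 'u alg \<Rightarrow> 'u alg" where
  "restrict_scalars A f R = (fst R, compose (carrier A) (snd R) f)"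


section \<open>The fppf topology\<close>

definition linear_map ::
  "'u ring \<Rightarrow> ('u, 'u) module \<Rightarrow> ('u, 'u) module \<Rightarrow> ('u \<Rightarrow> 'u) \<Rightarrow> bool" where
  "linear_map R M N f \<longleftrightarrow>
     f \<in> carrier M \<rightarrow> carrier N \<and>
     (\<forall>x\<in>carrier M. \<forall>y\<in>carrier M. f (x \<oplus>\<^bsub>M\<^esub> y) = f x \<oplus>\<^bsub>N\<^esub> f y) \<and>
     (\<forall>r\<in>carrier R. \<forall>x\<in>carrier M. f (r \<odot>\<^bsub>M\<^esub> x) = r \<odot>\<^bsub>N\<^esub> f x)"

definition bilinear_map ::
  "'u ring \<Rightarrow> ('u, 'u) module \<Rightarrow> ('u, 'u) module \<Rightarrow> ('u, 'u) module \<Rightarrow> ('u \<Rightarrow> 'u \<Rightarrow> 'u) \<Rightarrow> bool" where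
  "bilinear_map R M N P b \<longleftrightarrow>
     (\<forall>x\<in>carrier M. linear_map R N P (b x)) \<and>
     (\<forall>y\<in>carrier N. linear_map R M P (\<lambda>x. b x y))"

text \<open>The tensor \<open>x 0 \<otimes> y 0 + \<dots> + x (k - 1) \<otimes> y (k - 1)\<close> vanishes in \<open>M \<otimes>\<^sub>R N\<close>, expressed
  through the universal property of the tensor product.\<close>

definition tensor_zero ::
  "'u ring \<Rightarrow> ('u, 'u) module \<Rightarrow> ('u, 'u) module \<Rightarrow> nat \<Rightarrow> (nat \<Rightarrow> 'u) \<Rightarrow> (nat \<Rightarrow> 'u) \<Rightarrow> bool" where
  "tensor_zero R M N k x y \<longleftrightarrow>
     (\<forall>P b. module R P \<and> bilinear_map R M N P b \<longrightarrow> (\<Oplus>\<^bsub>P\<^esub>i\<in>{..<k}. b (x i) (y i)) = \<zero>\<^bsub>P\<^esub>)"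

definition flat_module :: "'u ring \<Rightarrow> ('u, 'u) module \<Rightarrow> bool" where
  "flat_module R M \<longleftrightarrow>
     (\<forall>N N' f. module R N \<and> module R N' \<and> linear_map R N N' f \<and> inj_on f (carrier N) \<longrightarrow>
        (\<forall>k x y. x \<in> {..<k} \<rightarrow> carrier N \<and> y \<in> {..<k} \<rightarrow> carrier M \<and>
           tensor_zero R N' M k (f \<circ> x) y \<longrightarrow> tensor_zero R N M k x y))"

definition alg_module :: "'u alg \<Rightarrow> ('u, 'u) module" where
  "alg_module S = \<lparr>carrier = alg_carrier S, monoid.mult = monoid.mult (fst S), monoid.one = monoid.one (fst S),
     ring.zero = ring.zero (fst S), ring.add = ring.add (fst S), smult = (\<lambda>r x. snd S r \<otimes>\<^bsub>fst S\<^esub> x)\<rparr>"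

text \<open>Polynomials are those of \<^theory>\<open>HOL-Algebra.Indexed_Polynomials\<close>: finitely supported
  coefficient functions on monomials, a monomial being a multiset of variables.\<close>

definition polys :: "'u ring \<Rightarrow> nat \<Rightarrow> (nat multiset \<Rightarrow> 'u) set" where
  "polys R n = ring.indexed_pset R {..<n} (carrier R)"

definition poly_eval :: "'u ring \<Rightarrow> 'u alg \<Rightarrow> (nat multiset \<Rightarrow> 'u) \<Rightarrow> (nat \<Rightarrow> 'u) \<Rightarrow> 'u" where
  "poly_eval R S P b = (\<Oplus>\<^bsub>fst S\<^esub>m\<in>{m. P m \<noteq> \<zero>\<^bsub>R\<^esub>}.
     snd S (P m) \<otimes>\<^bsub>fst S\<^esub> (\<Otimes>\<^bsub>fst S\<^esub>i\<in>set_mset m. b i [^]\<^bsub>fst S\<^esub> count m i))"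

text \<open>\<open>t\<close> is a solution in \<open>S\<close> of the system of equations \<open>E\<close> in \<open>n\<close> unknowns over \<open>R\<close>.\<close>

definition solution ::
  "'u ring \<Rightarrow> nat \<Rightarrow> (nat multiset \<Rightarrow> 'u) set \<Rightarrow> 'u alg \<Rightarrow> (nat \<Rightarrow> 'u) \<Rightarrow> bool" where
  "solution R n E S t \<longleftrightarrow>
     t \<in> {..<n} \<rightarrow> alg_carrier S \<and> (\<forall>P\<in>E. poly_eval R S P t = \<zero>\<^bsub>fst S\<^esub>)"

text \<open>\<open>S \<cong> R[x\<^sub>0, \<dots>, x\<^bsub>n-1\<^esub>]/(E)\<close> for a finite set \<open>E\<close>, the quotient being given by its universal
  property.\<close>

definition finitely_presented :: "'u ring \<Rightarrow> 'u alg \<Rightarrow> bool" where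
  "finitely_presented R S \<longleftrightarrow>
     (\<exists>n E b. finite E \<and> E \<subseteq> polys R n \<and> solution R n E S b \<and>
        (\<forall>T\<in>algs R. \<forall>t. solution R n E T t \<longrightarrow>
           (\<exists>!f. f \<in> alg_hom R S T \<and> (\<forall>i<n. f (b i) = t i))))"

text \<open>Finite families suffice since affine schemes are quasi-compact.  The last conjunct says that
  the maps on spectra are jointly surjective.  The empty family covers the zero ring.\<close>

definition fppf_cover ::
  "'u ring \<Rightarrow> 'u alg \<Rightarrow> nat \<Rightarrow> (nat \<Rightarrow> 'u alg) \<Rightarrow> (nat \<Rightarrow> 'u \<Rightarrow> 'u) \<Rightarrow> bool" where
  "fppf_cover A R n C c \<longleftrightarrow>
     (\<forall>i<n. C i \<in> algs A \<and> c i \<in> alg_hom A R (C i) \<and>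
        flat_module (fst R) (alg_module (fst (C i), c i)) \<and>
        finitely_presented (fst R) (fst (C i), c i)) \<and>
     (\<forall>P. primeideal P (fst R) \<longrightarrow>
        (\<exists>i<n. \<exists>Q. primeideal Q (fst (C i)) \<and> P = {r \<in> alg_carrier R. c i r \<in> Q}))"


section \<open>Sheaves of groups and formal Lie groups\<close>

text \<open>The values are recorded as \<open>monoid\<close> records, which carry a set, a product and a point.  The same
  record is used for buds, whose product is only meaningful on part of the carrier.\<close>

record ('u, 'x) grp_functor =
  sections :: "'u alg \<Rightarrow> 'x monoid"
  transition :: "'u alg \<Rightarrow> 'u alg \<Rightarrow> ('u \<Rightarrow> 'u) \<Rightarrow> 'x \<Rightarrow> 'x"

definition comm_group_presheaf :: "'u ring \<Rightarrow> ('u, 'x) grp_functor \<Rightarrow> bool" where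
  "comm_group_presheaf A G \<longleftrightarrow>
     (\<forall>R\<in>algs A. comm_group (sections G R)) \<and>
     (\<forall>R\<in>algs A. \<forall>T\<in>algs A. \<forall>f\<in>alg_hom A R T.
        transition G R T f \<in> hom (sections G R) (sections G T)) \<and>
     (\<forall>R\<in>algs A. \<forall>x\<in>carrier (sections G R). transition G R R (\<lambda>r\<in>alg_carrier R. r) x = x) \<and>
     (\<forall>R\<in>algs A. \<forall>T\<in>algs A. \<forall>U\<in>algs A. \<forall>f\<in>alg_hom A R T. \<forall>g\<in>alg_hom A T U.
        \<forall>x\<in>carrier (sections G R).
          transition G R U (compose (alg_carrier R) g f) x
            = transition G T U g (transition G R T f x))"

text \<open>Compatibility of a family of sections is tested on all common algebras over two members of the
  cover, equivalently on their tensor product.\<close>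

definition fppf_sheaf :: "'u ring \<Rightarrow> ('u, 'x) grp_functor \<Rightarrow> bool" where
  "fppf_sheaf A G \<longleftrightarrow>
     (\<forall>R\<in>algs A. \<forall>n C c x. fppf_cover A R n C c \<and>
        (\<forall>i<n. x i \<in> carrier (sections G (C i))) \<and>
        (\<forall>i<n. \<forall>j<n. \<forall>T\<in>algs A. \<forall>f\<in>alg_hom A (C i) T. \<forall>g\<in>alg_hom A (C j) T.
           (\<forall>r\<in>alg_carrier R. f (c i r) = g (c j r)) \<longrightarrow>
           transition G (C i) T f (x i) = transition G (C j) T g (x j)) \<longrightarrow>
        (\<exists>!y. y \<in> carrier (sections G R) \<and> (\<forall>i<n. transition G R (C i) (c i) y = x i)))"

text \<open>The points of \<open>Spf A[[T]]\<close>, i.e. of the union of the schemes \<open>Spec A[T]/(T\<^sup>n)\<close>, with values in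
  \<open>R\<close>.\<close>

definition Spf_power_series :: "'u alg \<Rightarrow> 'u set" where
  "Spf_power_series R = (\<Union>n::nat. {t \<in> alg_carrier R. t [^]\<^bsub>fst R\<^esub> n = \<zero>\<^bsub>fst R\<^esub>})"

text \<open>Schemes over the principal open \<open>D(f)\<close> of \<open>Spec A\<close> are the schemes over \<open>Spec A\<close> on which \<open>f\<close> is
  invertible.\<close>

definition algs_over_D :: "'u ring \<Rightarrow> 'u \<Rightarrow> 'u alg set" where
  "algs_over_D A f = {R \<in> algs A. snd R f \<in> Units (fst R)}"

definition formal_Lie_variety :: "'u ring \<Rightarrow> ('u, 'x) grp_functor \<Rightarrow> bool" where
  "formal_Lie_variety A G \<longleftrightarrow>
     fppf_sheaf A G \<and>
     (\<exists>F. finite F \<and> F \<subseteq> carrier A \<and> genideal A F = carrier A \<and>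
        (\<forall>f\<in>F. \<exists>\<eta>.
           (\<forall>R\<in>algs_over_D A f.
              bij_betw (\<eta> R) (carrier (sections G R)) (Spf_power_series R) \<and>
              \<eta> R \<one>\<^bsub>sections G R\<^esub> = \<zero>\<^bsub>fst R\<^esub>) \<and>
           (\<forall>R\<in>algs_over_D A f. \<forall>T\<in>algs_over_D A f. \<forall>g\<in>alg_hom A R T.
              \<forall>x\<in>carrier (sections G R). \<eta> T (transition G R T g x) = g (\<eta> R x))))"

definition formal_Lie_group :: "'u ring \<Rightarrow> ('u, 'x) grp_functor \<Rightarrow> bool" where
  "formal_Lie_group A G \<longleftrightarrow> comm_group_presheaf A G \<and> formal_Lie_variety A G"

definition base_change ::
  "'u ring \<Rightarrow> ('u \<Rightarrow> 'u) \<Rightarrow> ('u, 'x) grp_functor \<Rightarrow> ('u, 'x) grp_functor" where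
  "base_change A f G =
     \<lparr>sections = (\<lambda>R. sections G (restrict_scalars A f R)),
      transition = (\<lambda>R T. transition G (restrict_scalars A f R) (restrict_scalars A f T))\<rparr>"


section \<open>Buds and height\<close>

primrec ideal_power :: "('a, 'b) ring_scheme \<Rightarrow> 'a set \<Rightarrow> nat \<Rightarrow> 'a set" where
  "ideal_power R I 0 = carrier R"
| "ideal_power R I (Suc n) = ideal_prod R (ideal_power R I n) I"

text \<open>The sections \<open>x\<close> over \<open>R\<close> that become the identity section in some quotient of \<open>R\<close> by an ideal
  with vanishing power \<open>n + 1\<close>.\<close>

definition pre_infinitesimal ::
  "'u ring \<Rightarrow> nat \<Rightarrow> ('u, 'x) grp_functor \<Rightarrow> 'u alg \<Rightarrow> 'x set" where
  "pre_infinitesimal A n G R = {x \<in> carrier (sections G R).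
     \<exists>R'\<in>algs A. \<exists>q\<in>alg_hom A R R'. q ` alg_carrier R = alg_carrier R' \<and>
       ideal_power (fst R) (a_kernel (fst R) (fst R') q) (n + 1) = {\<zero>\<^bsub>fst R\<^esub>} \<and>
       transition G R R' q x = \<one>\<^bsub>sections G R'\<^esub>}"

text \<open>The fppf sheafification, formed inside the sheaf \<open>G\<close>.\<close>

definition infinitesimal ::
  "'u ring \<Rightarrow> nat \<Rightarrow> ('u, 'x) grp_functor \<Rightarrow> 'u alg \<Rightarrow> 'x set" where
  "infinitesimal A n G R = {x \<in> carrier (sections G R).
     \<exists>m C c. fppf_cover A R m C c \<and>
       (\<forall>i<m. transition G R (C i) (c i) x \<in> pre_infinitesimal A n G (C i))}"

definition bud :: "'u ring \<Rightarrow> nat \<Rightarrow> ('u, 'x) grp_functor \<Rightarrow> ('u, 'x) grp_functor" where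
  "bud A n G = G\<lparr>sections := (\<lambda>R. (sections G R)\<lparr>carrier := infinitesimal A n G R\<rparr>)\<rparr>"

text \<open>The ring of global functions on \<open>B\<close>, i.e. of natural transformations from \<open>B\<close> to the affine line.
  For a bud, \<open>B\<close> is an affine scheme, hence quasi-coherent ideals of \<open>\<O>\<^sub>B\<close> and their powers may be
  computed in this ring.\<close>

definition fun_ring ::
  "'u ring \<Rightarrow> ('u, 'x) grp_functor \<Rightarrow> ('u alg \<Rightarrow> 'x \<Rightarrow> 'u) ring" where
  "fun_ring A B =
     \<lparr>carrier = {\<phi> \<in> (\<Pi>\<^sub>E R\<in>algs A. carrier (sections B R) \<rightarrow>\<^sub>E alg_carrier R).
        \<forall>R\<in>algs A. \<forall>T\<in>algs A. \<forall>f\<in>alg_hom A R T. \<forall>x\<in>carrier (sections B R).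
          \<phi> T (transition B R T f x) = f (\<phi> R x)},
      monoid.mult = (\<lambda>\<phi> \<psi>. \<lambda>R\<in>algs A. \<lambda>x\<in>carrier (sections B R). \<phi> R x \<otimes>\<^bsub>fst R\<^esub> \<psi> R x),
      monoid.one = (\<lambda>R\<in>algs A. \<lambda>x\<in>carrier (sections B R). \<one>\<^bsub>fst R\<^esub>),
      ring.zero = (\<lambda>R\<in>algs A. \<lambda>x\<in>carrier (sections B R). \<zero>\<^bsub>fst R\<^esub>),
      ring.add = (\<lambda>\<phi> \<psi>. \<lambda>R\<in>algs A. \<lambda>x\<in>carrier (sections B R). \<phi> R x \<oplus>\<^bsub>fst R\<^esub> \<psi> R x)\<rparr>"

definition section_ideal ::
  "'u ring \<Rightarrow> ('u, 'x) grp_functor \<Rightarrow> ('u alg \<Rightarrow> 'x \<Rightarrow> 'u) set" where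
  "section_ideal A B = {\<phi> \<in> carrier (fun_ring A B).
     \<phi> (self_alg A) \<one>\<^bsub>sections B (self_alg A)\<^esub> = \<zero>\<^bsub>A\<^esub>}"

text \<open>Pullback of functions along multiplication by \<open>p\<close>.  The group law is written multiplicatively,
  so this is the power map; it only uses the product and the point of the record.\<close>

definition mult_pullback ::
  "'u ring \<Rightarrow> nat \<Rightarrow> ('u, 'x) grp_functor \<Rightarrow> ('u alg \<Rightarrow> 'x \<Rightarrow> 'u) \<Rightarrow> ('u alg \<Rightarrow> 'x \<Rightarrow> 'u)" where
  "mult_pullback A p B \<phi> =
     (\<lambda>R\<in>algs A. \<lambda>x\<in>carrier (sections B R). \<phi> R (x [^]\<^bsub>sections B R\<^esub> p))"

definition height_ge :: "'u ring \<Rightarrow> nat \<Rightarrow> nat \<Rightarrow> ('u, 'x) grp_functor \<Rightarrow> bool" where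
  "height_ge A p h B \<longleftrightarrow>
     mult_pullback A p B ` section_ideal A B
       \<subseteq> ideal_power (fun_ring A B) (section_ideal A B) (p ^ h)"

text \<open>A morphism \<open>Spec A \<rightarrow> \<B>\<close> lands in the open complement of a closed substack iff no base change to a
  nonempty scheme lies in that substack.\<close>

definition bud_has_height :: "'u ring \<Rightarrow> nat \<Rightarrow> nat \<Rightarrow> ('u, 'x) grp_functor \<Rightarrow> bool" where
  "bud_has_height A p h B \<longleftrightarrow>
     height_ge A p h B \<and>
     (\<forall>R\<in>algs A. \<one>\<^bsub>fst R\<^esub> \<noteq> \<zero>\<^bsub>fst R\<^esub> \<longrightarrow>
        \<not> height_ge (fst R) p (h + 1) (base_change A (snd R) B))"

definition has_height :: "'u ring \<Rightarrow> nat \<Rightarrow> nat \<Rightarrow> ('u, 'x) grp_functor \<Rightarrow> bool" where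
  "has_height A p h G \<longleftrightarrow> bud_has_height A p h (bud A (p ^ (h + 1)) G)"


section \<open>The groupoid of formal Lie groups of height h\<close>

record ('o, 'm) cat =
  Obj :: "'o set"
  Hom :: "'o \<Rightarrow> 'o \<Rightarrow> 'm set"
  Ident :: "'o \<Rightarrow> 'm"
  Comp :: "'o \<Rightarrow> 'o \<Rightarrow> 'o \<Rightarrow> 'm \<Rightarrow> 'm \<Rightarrow> 'm"

definition is_functor ::
  "('o, 'm) cat \<Rightarrow> ('o, 'm) cat \<Rightarrow> ('o \<Rightarrow> 'o) \<Rightarrow> ('o \<Rightarrow> 'o \<Rightarrow> 'm \<Rightarrow> 'm) \<Rightarrow> bool" where
  "is_functor C D F Fm \<longleftrightarrow>
     (\<forall>G\<in>Obj C. F G \<in> Obj D) \<and>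
     (\<forall>G\<in>Obj C. \<forall>H\<in>Obj C. \<forall>u\<in>Hom C G H. Fm G H u \<in> Hom D (F G) (F H)) \<and>
     (\<forall>G\<in>Obj C. Fm G G (Ident C G) = Ident D (F G)) \<and>
     (\<forall>G\<in>Obj C. \<forall>H\<in>Obj C. \<forall>L\<in>Obj C. \<forall>u\<in>Hom C G H. \<forall>v\<in>Hom C H L.
        Fm G L (Comp C G H L v u) = Comp D (F G) (F H) (F L) (Fm H L v) (Fm G H u))"

definition fully_faithful_functor ::
  "('o, 'm) cat \<Rightarrow> ('o, 'm) cat \<Rightarrow> ('o \<Rightarrow> 'o) \<Rightarrow> ('o \<Rightarrow> 'o \<Rightarrow> 'm \<Rightarrow> 'm) \<Rightarrow> bool" where
  "fully_faithful_functor C D F Fm \<longleftrightarrow>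
     is_functor C D F Fm \<and>
     (\<forall>G\<in>Obj C. \<forall>H\<in>Obj C. bij_betw (Fm G H) (Hom C G H) (Hom D (F G) (F H)))"

definition FLG_iso ::
  "'u ring \<Rightarrow> ('u, 'x) grp_functor \<Rightarrow> ('u, 'x) grp_functor \<Rightarrow> ('u alg \<Rightarrow> 'x \<Rightarrow> 'x) set" where
  "FLG_iso A G H = {u \<in> extensional (algs A).
     (\<forall>R\<in>algs A. u R \<in> iso (sections G R) (sections H R)
        \<and> u R \<in> extensional (carrier (sections G R))) \<and>
     (\<forall>R\<in>algs A. \<forall>T\<in>algs A. \<forall>f\<in>alg_hom A R T. \<forall>x\<in>carrier (sections G R).
        u T (transition G R T f x) = transition H R T f (u R x))}"

definition FLG_height ::
  "'u ring \<Rightarrow> nat \<Rightarrow> nat \<Rightarrow> (('u, 'x) grp_functor, 'u alg \<Rightarrow> 'x \<Rightarrow> 'x) cat" where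
  "FLG_height A p h =
     \<lparr>Obj = {G. formal_Lie_group A G \<and> has_height A p h G},
      Hom = FLG_iso A,
      Ident = (\<lambda>G. \<lambda>R\<in>algs A. \<lambda>x\<in>carrier (sections G R). x),
      Comp = (\<lambda>G H L v u. \<lambda>R\<in>algs A. compose (carrier (sections G R)) (v R) (u R))\<rparr>"

definition base_change_iso ::
  "'u ring \<Rightarrow> 'u ring \<Rightarrow> ('u \<Rightarrow> 'u) \<Rightarrow> ('u alg \<Rightarrow> 'x \<Rightarrow> 'x) \<Rightarrow> ('u alg \<Rightarrow> 'x \<Rightarrow> 'x)" where
  "base_change_iso A B f u = (\<lambda>R\<in>algs B. u (restrict_scalars A f R))"


section \<open>Valuation rings\<close>

definition is_fraction_field :: "'u ring \<Rightarrow> 'u ring \<Rightarrow> ('u \<Rightarrow> 'u) \<Rightarrow> bool" where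
  "is_fraction_field A K \<iota> \<longleftrightarrow>
     domain A \<and> field K \<and> \<iota> \<in> ring_hom A K \<and> inj_on \<iota> (carrier A) \<and>
     (\<forall>x\<in>carrier K. \<exists>a\<in>carrier A. \<exists>b\<in>carrier A - {\<zero>\<^bsub>A\<^esub>}. x = \<iota> a \<otimes>\<^bsub>K\<^esub> inv\<^bsub>K\<^esub> (\<iota> b))"

definition is_valuation_ring_of :: "'u ring \<Rightarrow> 'u ring \<Rightarrow> ('u \<Rightarrow> 'u) \<Rightarrow> bool" where
  "is_valuation_ring_of A K \<iota> \<longleftrightarrow>
     is_fraction_field A K \<iota> \<and>
     (\<forall>x\<in>carrier K - {\<zero>\<^bsub>K\<^esub>}. x \<in> \<iota> ` carrier A \<or> inv\<^bsub>K\<^esub> x \<in> \<iota> ` carrier A)"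

end

theory Submission
  imports Defs
begin

text \<open>
  Over the local ring \<open>\<O>\<close> every formal Lie group has a global coordinate, so homomorphisms are power
  series (Yoneda for truncated polynomial rings) and faithfulness is the injectivity of
  \<open>\<O>[[T]] \<rightarrow> K[[T]]\<close>. Fullness says that the series \<open>f\<close> of an isomorphism over \<open>K\<close> has integral
  coefficients. Put \<open>q = p\<^sup>h\<close>. Height \<open>h\<close> forces \<open>p = 0\<close> in \<open>\<O>\<close>, and in characteristic \<open>p\<close> an
  additive series without linear term has zero derivative; iterating, \<open>[p](T) = a T\<^sup>q + \<dots>\<close> is a
  series in \<open>T\<^sup>q\<close>, and \<open>a\<close> is a unit because otherwise the height over \<open>\<O>/(a)\<close> would be at least
  \<open>h + 1\<close>. Comparing the coefficients of \<open>T\<^sup>q\<^sup>n\<close> in \<open>f([p](T)) = [p]'(f(T))\<close> gives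
  \<open>a\<^sup>n f\<^sub>n - a' f\<^sub>n\<^sup>q \<in> \<O>\<close> by induction on \<open>n\<close>, so \<open>f\<^sub>n\<close> is integral over the valuation ring \<open>\<O>\<close>.
\<close>

section \<open>Truncated polynomial rings\<close>

text \<open>All rings live on the one type \<open>'u\<close>, where \<open>A[[T]]\<close> need not
  fit; \<open>A[T]/(T^n)\<close> always does, because \<open>n\<close>-tuples of an infinite type
  embed in it. So a series is never an element of a ring: it is a coefficient function acting on
  nilpotent points, and coefficients are read off at the class of \<open>T\<close> in a long enough
  truncation. Series in two variables are avoided in the same way: translation by a point
  \<open>x\<close> is a series in one variable over the ring of \<open>x\<close>, and the universal
  pair of points lives in an iterated truncation.

  The obstacle to fullness is that the coefficients of \<open>f\<close> might have denominators. In
  degree \<open>q n\<close> the side \<open>f([p](T))\<close> contains \<open>f_n\<close> linearly,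
  while \<open>[p]'(f(T))\<close> contains \<open>f_n^q\<close> with a unit coefficient. So
  \<open>f_n\<close> is a root of a polynomial over \<O> of degree \<open>q \<ge> 2\<close> with
  unit leading coefficient. Here \<open>h \<ge> 1\<close> enters twice, through
  \<open>q \<ge> 2\<close> and through \<open>p = 0\<close> in \<O>. The inverse of \<open>f\<close>
  is treated as well, since an integral series that is invertible over \<open>K\<close> need not be
  invertible over \<O>.\<close>

definition peval :: "('a, 'm) ring_scheme \<Rightarrow> nat \<Rightarrow> (nat \<Rightarrow> 'a) \<Rightarrow> 'a \<Rightarrow> 'a" where
  "peval S n c t = (\<Oplus>\<^bsub>S\<^esub>i\<in>{..<n}. c i \<otimes>\<^bsub>S\<^esub> t [^]\<^bsub>S\<^esub> i)"

context cring
begin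

lemma peval_term_closed:
  assumes "c \<in> UNIV \<rightarrow> carrier R" "t \<in> carrier R"
  shows "c i \<otimes> t [^] (i :: nat) \<in> carrier R"
proof -
  have "c i \<in> carrier R" using assms by auto
  thus ?thesis using assms by simp
qed

lemma peval_closed [simp, intro]:
  assumes "c \<in> UNIV \<rightarrow> carrier R" "t \<in> carrier R"
  shows "peval R n c t \<in> carrier R"
  unfolding peval_def using peval_term_closed[OF assms] by (intro finsum_closed Pi_I)

lemma peval_0 [simp]: "peval R 0 c t = \<zero>"
  by (simp add: peval_def)

lemma peval_Suc:
  assumes "c \<in> UNIV \<rightarrow> carrier R" "t \<in> carrier R"
  shows "peval R (Suc n) c t = c n \<otimes> t [^] n \<oplus> peval R n c t"
  unfolding peval_def lessThan_Suc using assms by (subst finsum_insert) auto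

lemma peval_1:
  assumes "c \<in> UNIV \<rightarrow> carrier R" "t \<in> carrier R"
  shows "peval R (Suc 0) c t = c 0"
proof -
  have "c 0 \<in> carrier R" using assms by auto
  thus ?thesis using assms by (simp add: peval_Suc)
qed

lemma peval_cong:
  assumes "c \<in> UNIV \<rightarrow> carrier R" "t \<in> carrier R" "\<And>i. i < n \<Longrightarrow> c i = d i"
  shows "peval R n c t = peval R n d t"
  unfolding peval_def
  by (rule finsum_cong') (use peval_term_closed[OF assms(1,2)] in \<open>auto simp flip: assms(3)\<close>)

lemma nat_pow_zero_mono:
  assumes "t \<in> carrier R" "t [^] (n::nat) = \<zero>" "n \<le> m"
  shows "t [^] m = \<zero>"
proof -
  have "t [^] m = t [^] n \<otimes> t [^] (m - n)"
    using assms(1,3) by (simp add: nat_pow_mult)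
  thus ?thesis by (simp only: assms(2) l_null nat_pow_closed[OF assms(1)])
qed

lemma peval_mono:
  assumes "c \<in> UNIV \<rightarrow> carrier R" "t \<in> carrier R" "t [^] n = \<zero>" "n \<le> m"
  shows "peval R m c t = peval R n c t"
  using assms(4)
proof (induction m rule: dec_induct)
  case (step m)
  have "t [^] m = \<zero>" using nat_pow_zero_mono[OF assms(2,3)] step by simp
  moreover have "c m \<in> carrier R" using assms by auto
  ultimately show ?case using step assms by (simp add: peval_Suc)
qed simp

text \<open>Beyond any nilpotency exponent of \<open>t\<close> the terms vanish, so the cut does not
  matter. This is what lets one coefficient function act on all nilpotent points.\<close>

lemma peval_eq:
  assumes "c \<in> UNIV \<rightarrow> carrier R" "t \<in> carrier R" "t [^] n = \<zero>" "t [^] m = \<zero>"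
  shows "peval R m c t = peval R n c t"
  using peval_mono[of c t n m] peval_mono[of c t m n] assms by (cases n m rule: linorder_cases) auto

lemma peval_zero_coeffs:
  assumes "t \<in> carrier R" "\<And>i. i < n \<Longrightarrow> c i = \<zero>"
  shows "peval R n c t = \<zero>"
proof -
  have "peval R n c t = (\<Oplus>i\<in>{..<n}. \<zero>)"
    unfolding peval_def by (rule finsum_cong') (use assms in auto)
  thus ?thesis by simp
qed

lemma peval_single:
  assumes "a \<in> carrier R" "t \<in> carrier R" "i < n"
  shows "peval R n (\<lambda>j. if j = i then a else \<zero>) t = a \<otimes> t [^] i"
  using assms(3)
proof (induction n)
  case (Suc n)
  let ?c = "\<lambda>j. if j = i then a else \<zero>"
  have c: "?c \<in> UNIV \<rightarrow> carrier R" using assms by auto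
  show ?case
  proof (cases "i = n")
    case True
    have "peval R n ?c t = \<zero>" by (rule peval_zero_coeffs) (use assms True in auto)
    thus ?thesis using peval_Suc[OF c assms(2)] True assms by simp
  next
    case False
    thus ?thesis using peval_Suc[OF c assms(2)] Suc assms by simp
  qed
qed simp

lemma peval_add:
  assumes "c \<in> UNIV \<rightarrow> carrier R" "d \<in> UNIV \<rightarrow> carrier R" "t \<in> carrier R"
  shows "peval R n c t \<oplus> peval R n d t = peval R n (\<lambda>i. c i \<oplus> d i) t"
proof (induction n)
  case (Suc n)
  have [simp]: "c n \<in> carrier R" "d n \<in> carrier R" and "(\<lambda>i. c i \<oplus> d i) \<in> UNIV \<rightarrow> carrier R"
    using assms by auto
  moreover have "peval R n c t \<in> carrier R" "peval R n d t \<in> carrier R" using assms by auto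
  ultimately show ?case using assms
    by (simp add: peval_Suc l_distr Suc[symmetric] a_ac)
qed simp

text \<open>Plays the role of dividing a power series by \<open>T^k\<close>; the cut drops by
  \<open>k\<close> together with the indices.\<close>

lemma peval_shift:
  assumes "c \<in> UNIV \<rightarrow> carrier R" "t \<in> carrier R" "k \<le> n" "\<And>i. i < k \<Longrightarrow> c i = \<zero>"
  shows "peval R n c t = t [^] k \<otimes> peval R (n - k) (\<lambda>i. c (i + k)) t"
  using assms(3)
proof (induction n rule: dec_induct)
  case base
  show ?case using assms by (simp add: peval_zero_coeffs)
next
  case (step n)
  have c: "(\<lambda>i. c (i + k)) \<in> UNIV \<rightarrow> carrier R" using assms by auto
  have cn: "c n \<in> carrier R" using assms by auto
  have "t [^] n = t [^] k \<otimes> t [^] (n - k)" using step assms by (simp add: nat_pow_mult)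
  moreover have "c n \<otimes> (t [^] k \<otimes> t [^] (n - k)) = t [^] k \<otimes> (c n \<otimes> t [^] (n - k))"
    using cn assms by (simp add: m_lcomm)
  moreover have "peval R (n - k) (\<lambda>i. c (i + k)) t \<in> carrier R" using c assms by blast
  ultimately show ?case using step c cn assms
    by (simp add: peval_Suc Suc_diff_le r_distr)
qed

end

section \<open>Homomorphisms and polynomial values\<close>

lemma ring_hom_nat_pow:
  assumes "cring R" "cring S" "f \<in> ring_hom R S" "x \<in> carrier R"
  shows "f (x [^]\<^bsub>R\<^esub> (n::nat)) = f x [^]\<^bsub>S\<^esub> n"
proof -
  interpret ring_hom_cring R S f
    using assms by (simp add: ring_hom_cring_def ring_hom_cring_axioms_def)
  show ?thesis using assms by simp
qed

lemma ring_hom_zero':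
  assumes "cring R" "cring S" "f \<in> ring_hom R S"
  shows "f \<zero>\<^bsub>R\<^esub> = \<zero>\<^bsub>S\<^esub>"
  using ring_hom_zero[OF assms(3) cring.axioms(1)[OF assms(1)] cring.axioms(1)[OF assms(2)]] .

lemma ring_hom_peval:
  assumes "cring R" "cring S" "f \<in> ring_hom R S" "c \<in> UNIV \<rightarrow> carrier R" "t \<in> carrier R"
  shows "f (peval R n c t) = peval S n (\<lambda>i. f (c i)) (f t)"
proof (induction n)
  case 0
  interpret R: cring R by fact
  interpret S: cring S by fact
  show ?case using ring_hom_zero'[OF assms(1-3)] by simp
next
  case (Suc n)
  interpret R: cring R by fact
  interpret S: cring S by fact
  have "(\<lambda>i. f (c i)) \<in> UNIV \<rightarrow> carrier S" "c n \<in> carrier R"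
    using assms ring_hom_closed[OF assms(3)] by auto
  thus ?case using assms Suc ring_hom_closed[OF assms(3)]
    by (simp add: R.peval_Suc S.peval_Suc ring_hom_add[OF assms(3)] ring_hom_mult[OF assms(3)]
        ring_hom_nat_pow[OF assms(1-3)])
qed

text \<open>\<open>P\<close> is \<open>R[T]/(T^n)\<close> and \<open>Z\<close> the class of
  \<open>T\<close>. Two descriptions are kept side by side: expansions, whose coefficients are
  determined below \<open>n\<close> only, serve to compare series; the lifting property into rings
  on the same type serves Yoneda.\<close>

definition is_trunc ::
  "'u ring \<Rightarrow> nat \<Rightarrow> 'u ring \<Rightarrow> ('u \<Rightarrow> 'u) \<Rightarrow> 'u \<Rightarrow> bool" where
  "is_trunc R n P c Z \<longleftrightarrow> cring R \<and> cring P \<and> c \<in> ring_hom R P \<inter> extensional (carrier R) \<and>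
     Z \<in> carrier P \<and> Z [^]\<^bsub>P\<^esub> n = \<zero>\<^bsub>P\<^esub> \<and>
     (\<forall>s\<in>carrier P. \<exists>a\<in>UNIV \<rightarrow> carrier R. s = peval P n (\<lambda>i. c (a i)) Z) \<and>
     (\<forall>a\<in>UNIV \<rightarrow> carrier R. \<forall>b\<in>UNIV \<rightarrow> carrier R.
        peval P n (\<lambda>i. c (a i)) Z = peval P n (\<lambda>i. c (b i)) Z \<longrightarrow> (\<forall>i<n. a i = b i)) \<and>
     (\<forall>S f s. cring (S :: 'u ring) \<and> f \<in> ring_hom R S \<and> s \<in> carrier S \<and> s [^]\<^bsub>S\<^esub> n = \<zero>\<^bsub>S\<^esub> \<longrightarrow>
        (\<exists>g\<in>ring_hom P S \<inter> extensional (carrier P). (\<forall>r\<in>carrier R. g (c r) = f r) \<and> g Z = s))"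

text \<open>This is where the infinitude of the universe enters: its square has the same
  cardinality, so pairs and then tuples are coded by single elements. A tuple is a function on all
  of \<open>nat\<close>, compared below \<open>n\<close> only.\<close>

lemma inj_tuples:
  assumes "infinite (UNIV :: 'u set)"
  shows "\<exists>e::(nat \<Rightarrow> 'u) \<Rightarrow> 'u. \<forall>a b. e a = e b \<longleftrightarrow> (\<forall>i<n. a i = b i)"
proof (induction n)
  case 0
  show ?case by auto
next
  case (Suc n)
  then obtain e :: "(nat \<Rightarrow> 'u) \<Rightarrow> 'u" where e: "\<And>a b. e a = e b \<longleftrightarrow> (\<forall>i<n. a i = b i)"
    by blast
  have "|UNIV \<times> UNIV :: ('u \<times> 'u) set| =o |UNIV :: 'u set|"
    using card_of_Times_same_infinite[OF assms] .
  then obtain d :: "'u \<times> 'u \<Rightarrow> 'u" where "bij_betw d (UNIV \<times> UNIV) UNIV"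
    using card_of_ordIso by blast
  hence d: "inj d" by (simp add: bij_betw_def)
  show ?case
    by (rule exI[of _ "\<lambda>a. d (e a, a n)"]) (auto simp: inj_eq[OF d] e less_Suc_eq)
qed

lemma cring_image_ring:
  assumes "cring R" "weak_ring_morphism f I R"
  shows "cring (image_ring f R)"
proof -
  interpret R: cring R by fact
  have r: "ring (image_ring f R)" by (rule R.image_ring_is_ring) fact
  have h: "f \<in> ring_hom R (image_ring f R)" by (rule R.weak_ring_morphism_is_hom) fact
  show ?thesis
  proof (rule cringI)
    show "abelian_group (image_ring f R)" using r by (simp add: ring_def)
    show "comm_monoid (image_ring f R)"
    proof (rule monoid.monoid_comm_monoidI)
      show "Group.monoid (image_ring f R)" using r by (simp add: ring_def)
      fix x y assume "x \<in> carrier (image_ring f R)" "y \<in> carrier (image_ring f R)"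
      then obtain a b where "a \<in> carrier R" "b \<in> carrier R" "x = f a" "y = f b"
        by (auto simp: image_ring_carrier)
      thus "x \<otimes>\<^bsub>image_ring f R\<^esub> y = y \<otimes>\<^bsub>image_ring f R\<^esub> x"
        using ring_hom_mult[OF h, of a b] ring_hom_mult[OF h, of b a] R.m_comm by simp
    qed
    show "(x \<oplus>\<^bsub>image_ring f R\<^esub> y) \<otimes>\<^bsub>image_ring f R\<^esub> z = x \<otimes>\<^bsub>image_ring f R\<^esub> z \<oplus>\<^bsub>image_ring f R\<^esub> y \<otimes>\<^bsub>image_ring f R\<^esub> z"
      if "x \<in> carrier (image_ring f R)" "y \<in> carrier (image_ring f R)" "z \<in> carrier (image_ring f R)" for x y z
      using ring.ring_simprules(13)[OF r] that by blast
  qed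
qed


text \<open>Polynomials in \<open>UP R\<close> are functions and not elements of \<open>'u\<close>,
  so each is sent to the code of its first \<open>n\<close> coefficients. The fibres of this map are
  the cosets of the ideal of polynomials divisible by \<open>T^n\<close>, hence the ring structure
  passes to the image.\<close>

lemma ex_trunc:
  assumes inf: "infinite (UNIV :: 'u set)" and R: "cring (R :: 'u ring)"
  shows "\<exists>P c Z. is_trunc R n P c Z"
proof -
  obtain e :: "(nat \<Rightarrow> 'u) \<Rightarrow> 'u" where e: "\<And>a b. e a = e b \<longleftrightarrow> (\<forall>i<n. a i = b i)"
    using inj_tuples[OF inf] by metis
  interpret R: cring R by fact
  interpret U: UP_cring R "UP R" by (simp add: UP_cring_def R)
  define f where "f p = e (coeff (UP R) p)" for p
  define I where "I = {p \<in> carrier (UP R). \<forall>i<n. coeff (UP R) p i = \<zero>\<^bsub>R\<^esub>}"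
  define Q where "Q = image_ring f (UP R)"
  have I: "ideal I (UP R)"
  proof (rule idealI)
    show "ring (UP R)" by (rule U.UP_ring)
    show "subgroup I (add_monoid (UP R))"
    proof (rule U.P.add.subgroupI)
      show "I \<subseteq> carrier (UP R)" by (auto simp: I_def)
      have "\<zero>\<^bsub>UP R\<^esub> \<in> I" by (simp add: I_def)
      thus "I \<noteq> {}" by blast
      show "\<ominus>\<^bsub>UP R\<^esub> a \<in> I" if "a \<in> I" for a using that by (auto simp: I_def)
      show "a \<oplus>\<^bsub>UP R\<^esub> b \<in> I" if "a \<in> I" "b \<in> I" for a b using that by (auto simp: I_def)
    qed
    show m: "x \<otimes>\<^bsub>UP R\<^esub> a \<in> I" if "a \<in> I" "x \<in> carrier (UP R)" for a x
    proof -
      have "(\<Oplus>\<^bsub>R\<^esub>j\<in>{..i}. coeff (UP R) x j \<otimes>\<^bsub>R\<^esub> coeff (UP R) a (i - j)) = (\<Oplus>\<^bsub>R\<^esub>j\<in>{..i}. \<zero>\<^bsub>R\<^esub>)" if "i < n" for i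
        by (rule R.finsum_cong') (use \<open>a \<in> I\<close> \<open>x \<in> _\<close> that in \<open>auto simp: I_def\<close>)
      thus ?thesis using that by (auto simp: I_def)
    qed
    show "a \<otimes>\<^bsub>UP R\<^esub> x \<in> I" if "a \<in> I" "x \<in> carrier (UP R)" for a x
      using m[OF that] that U.P.m_comm[of a x] by (auto simp: I_def)
  qed
  have w: "weak_ring_morphism f I (UP R)"
  proof (rule weak_ring_morphismI[OF I])
    fix a b assume ab: "a \<in> carrier (UP R)" "b \<in> carrier (UP R)"
    have "f a = f b \<longleftrightarrow> (\<forall>i<n. coeff (UP R) a i = coeff (UP R) b i)"
      by (simp add: f_def e)
    also have "\<dots> \<longleftrightarrow> a \<ominus>\<^bsub>UP R\<^esub> b \<in> I"
      using ab by (auto simp: I_def U.coeff_minus)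
    finally show "f a = f b \<longleftrightarrow> a \<ominus>\<^bsub>UP R\<^esub> b \<in> I" .
  qed
  have Q: "cring Q" unfolding Q_def by (rule cring_image_ring[OF U.UP_cring w])
  interpret Q: cring Q by fact
  have f: "f \<in> ring_hom (UP R) Q" unfolding Q_def by (rule U.P.weak_ring_morphism_is_hom[OF w])
  define c where "c = restrict (\<lambda>r. f (monom (UP R) r 0)) (carrier R)"
  define Z where "Z = f (monom (UP R) \<one>\<^bsub>R\<^esub> 1)"
  have c: "c \<in> ring_hom R Q \<inter> extensional (carrier R)"
    using ring_hom_trans[OF U.const_ring_hom f] by (auto simp: c_def ring_hom_def)
  have Z: "Z \<in> carrier Q" unfolding Z_def using ring_hom_closed[OF f] by simp
  have Zpow: "Z [^]\<^bsub>Q\<^esub> k = f (monom (UP R) \<one>\<^bsub>R\<^esub> k)" for k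
    unfolding Z_def using ring_hom_nat_pow[OF U.UP_cring Q f, of "monom (UP R) \<one>\<^bsub>R\<^esub> 1" k] U.monom_pow[of "\<one>\<^bsub>R\<^esub>" 1 k]
    by simp
  have Zn: "Z [^]\<^bsub>Q\<^esub> n = \<zero>\<^bsub>Q\<^esub>"
  proof -
    have "f (monom (UP R) \<one>\<^bsub>R\<^esub> n) = f \<zero>\<^bsub>UP R\<^esub>" by (simp add: f_def e)
    thus ?thesis using Zpow ring_hom_zero'[OF U.UP_cring Q f] by simp
  qed
  \<comment> \<open>Every truncated coefficient sequence comes from an honest polynomial, so
    existence and uniqueness of expansions become statements about the codes
    \<open>e\<close>.\<close>
  have poly: "\<exists>q\<in>carrier (UP R). (\<forall>i<m. coeff (UP R) q i = a i) \<and> (\<forall>i\<ge>m. coeff (UP R) q i = \<zero>\<^bsub>R\<^esub>) \<and>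
      f q = peval Q m (\<lambda>i. c (a i)) Z" if a: "a \<in> UNIV \<rightarrow> carrier R" for a m
  proof (induction m)
    case 0
    show ?case by (rule bexI[of _ "\<zero>\<^bsub>UP R\<^esub>"]) (auto simp: ring_hom_zero'[OF U.UP_cring Q f])
  next
    case (Suc m)
    then obtain q where q: "q \<in> carrier (UP R)" "\<And>i. i < m \<Longrightarrow> coeff (UP R) q i = a i"
      "\<And>i. m \<le> i \<Longrightarrow> coeff (UP R) q i = \<zero>\<^bsub>R\<^esub>" "f q = peval Q m (\<lambda>i. c (a i)) Z" by blast
    have ac: "a i \<in> carrier R" for i using a by auto
    hence am: "a m \<in> carrier R" .
    have ca: "(\<lambda>i. c (a i)) \<in> UNIV \<rightarrow> carrier Q" using a c ring_hom_closed[of c R Q] by auto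
    have "f (monom (UP R) (a m) m \<oplus>\<^bsub>UP R\<^esub> q) = f (monom (UP R) (a m) 0 \<otimes>\<^bsub>UP R\<^esub> monom (UP R) \<one>\<^bsub>R\<^esub> m) \<oplus>\<^bsub>Q\<^esub> f q"
      using am q U.monom_mult[of "a m" "\<one>\<^bsub>R\<^esub>" 0 m] by (simp add: ring_hom_add[OF f])
    also have "\<dots> = c (a m) \<otimes>\<^bsub>Q\<^esub> Z [^]\<^bsub>Q\<^esub> m \<oplus>\<^bsub>Q\<^esub> f q"
      using am by (simp add: ring_hom_mult[OF f] Zpow c_def)
    also have "\<dots> = peval Q (Suc m) (\<lambda>i. c (a i)) Z"
      using ca Z by (simp add: Q.peval_Suc q)
    finally have "f (monom (UP R) (a m) m \<oplus>\<^bsub>UP R\<^esub> q) = peval Q (Suc m) (\<lambda>i. c (a i)) Z" .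
    moreover have "\<forall>i<Suc m. coeff (UP R) (monom (UP R) (a m) m \<oplus>\<^bsub>UP R\<^esub> q) i = a i"
      using am q ac by (auto simp: less_Suc_eq)
    moreover have "\<forall>i\<ge>Suc m. coeff (UP R) (monom (UP R) (a m) m \<oplus>\<^bsub>UP R\<^esub> q) i = \<zero>\<^bsub>R\<^esub>"
      using am q by auto
    moreover have "monom (UP R) (a m) m \<oplus>\<^bsub>UP R\<^esub> q \<in> carrier (UP R)" using am q by simp
    ultimately show ?case by blast
  qed
  have feq: "f q = peval Q n (\<lambda>i. c (coeff (UP R) q i)) Z" if "q \<in> carrier (UP R)" for q
  proof -
    have "coeff (UP R) q \<in> UNIV \<rightarrow> carrier R" using that by auto
    from poly[OF this, of n] obtain q' where q': "\<And>i. i < n \<Longrightarrow> coeff (UP R) q' i = coeff (UP R) q i"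
      "f q' = peval Q n (\<lambda>i. c (coeff (UP R) q i)) Z" by blast
    have "f q = f q'" unfolding f_def e using q' by simp
    thus ?thesis using q' by simp
  qed
  have surj: "\<exists>a\<in>UNIV \<rightarrow> carrier R. s = peval Q n (\<lambda>i. c (a i)) Z" if "s \<in> carrier Q" for s
  proof -
    from that obtain q where q: "q \<in> carrier (UP R)" "s = f q" by (auto simp: Q_def image_ring_carrier)
    have "coeff (UP R) q \<in> UNIV \<rightarrow> carrier R" using q by auto
    thus ?thesis using feq[OF q(1)] q(2) by blast
  qed
  have inj: "a i = b i" if "a \<in> UNIV \<rightarrow> carrier R" "b \<in> UNIV \<rightarrow> carrier R" "i < n"
    "peval Q n (\<lambda>i. c (a i)) Z = peval Q n (\<lambda>i. c (b i)) Z" for a b i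
  proof -
    from poly[OF that(1), of n] obtain q where q: "\<And>i. i < n \<Longrightarrow> coeff (UP R) q i = a i"
      "f q = peval Q n (\<lambda>i. c (a i)) Z" by blast
    from poly[OF that(2), of n] obtain q' where q': "\<And>i. i < n \<Longrightarrow> coeff (UP R) q' i = b i"
      "f q' = peval Q n (\<lambda>i. c (b i)) Z" by blast
    have "f q = f q'" using q q' that by simp
    thus ?thesis using q q' that unfolding f_def e by metis
  qed
  \<comment> \<open>The lift is evaluation at \<open>s\<close>; since \<open>s^n = 0\<close> it
    depends only on the first \<open>n\<close> coefficients and hence factors through
    \<open>Q\<close>.\<close>
  have univ: "\<exists>g\<in>ring_hom Q S \<inter> extensional (carrier Q). (\<forall>r\<in>carrier R. g (c r) = j r) \<and> g Z = s"
    if S: "cring (S :: 'u ring)" and j: "j \<in> ring_hom R S" and s: "s \<in> carrier S" "s [^]\<^bsub>S\<^esub> n = \<zero>\<^bsub>S\<^esub>" for S j s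
  proof -
    interpret S: cring S by fact
    interpret j: ring_hom_cring R S j
      using R S j by (simp add: ring_hom_cring_def ring_hom_cring_axioms_def)
    interpret E: UP_pre_univ_prop R S j "UP R" by unfold_locales simp
    define E where "E = eval R S j s"
    have E: "E \<in> ring_hom (UP R) S" unfolding E_def by (rule E.eval_ring_hom) fact
    have Em: "E (monom (UP R) r 0) = j r" if "r \<in> carrier R" for r
      unfolding E_def using that E.eval_monom[OF that s(1), of 0] j.hom_closed[OF that] by simp
    have E1: "E (monom (UP R) \<one>\<^bsub>R\<^esub> 1) = s"
      unfolding E_def using E.eval_monom1[OF s(1)] by simp
    have Epow: "E q = peval S n (\<lambda>i. j (coeff (UP R) q i)) s" if q: "q \<in> carrier (UP R)" for q
    proof -
      have cj: "(\<lambda>i. j (coeff (UP R) q i)) \<in> UNIV \<rightarrow> carrier S" using q by auto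
      \<comment> \<open>A common cut: past the degree nothing is added, and past \<open>n\<close>
        the powers of \<open>s\<close> vanish.\<close>
      define m where "m = max n (Suc (deg R q))"
      have "E q = peval S (Suc (deg R q)) (\<lambda>i. j (coeff (UP R) q i)) s"
        unfolding E_def using q by (simp add: U.eval_on_carrier peval_def lessThan_Suc_atMost)
      also have "\<dots> = peval S m (\<lambda>i. j (coeff (UP R) q i)) s"
      proof -
        have "Suc (deg R q) \<le> m" by (simp add: m_def)
        thus ?thesis
        proof (induction m rule: dec_induct)
          case (step k)
          have "coeff (UP R) q k = \<zero>\<^bsub>R\<^esub>" using step q by (intro U.deg_aboveD) auto
          thus ?case using step cj s by (simp add: S.peval_Suc)
        qed simp
      qed
      also have "\<dots> = peval S n (\<lambda>i. j (coeff (UP R) q i)) s"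
        by (rule S.peval_mono[OF cj s]) (simp add: m_def)
      finally show ?thesis .
    qed
    define g where "g = restrict (\<lambda>y. E (inv_into (carrier (UP R)) f y)) (carrier Q)"
    have gf: "g (f q) = E q" if q: "q \<in> carrier (UP R)" for q
    proof -
      let ?q = "inv_into (carrier (UP R)) f (f q)"
      have q': "?q \<in> carrier (UP R)" "f ?q = f q"
        using q by (auto simp: inv_into_into f_inv_into_f)
      hence eq: "\<forall>i<n. coeff (UP R) ?q i = coeff (UP R) q i" unfolding f_def e by simp
      have "peval S n (\<lambda>i. j (coeff (UP R) ?q i)) s = peval S n (\<lambda>i. j (coeff (UP R) q i)) s"
        by (rule S.peval_cong) (use eq q' s in auto)
      hence "E ?q = E q" using Epow q q' by simp
      moreover have "f q \<in> carrier Q" using q ring_hom_closed[OF f] by blast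
      ultimately show ?thesis by (simp add: g_def)
    qed
    have sf: "\<exists>q\<in>carrier (UP R). y = f q" if "y \<in> carrier Q" for y
      using that by (auto simp: Q_def image_ring_carrier)
    have "g \<in> ring_hom Q S"
    proof (rule ring_hom_memI)
      fix x assume "x \<in> carrier Q"
      then obtain q where q: "q \<in> carrier (UP R)" "x = f q" using sf by blast
      show "g x \<in> carrier S" using q gf ring_hom_closed[OF E] by simp
      fix y assume "y \<in> carrier Q"
      then obtain r where r: "r \<in> carrier (UP R)" "y = f r" using sf by blast
      have "g (f (q \<otimes>\<^bsub>UP R\<^esub> r)) = E q \<otimes>\<^bsub>S\<^esub> E r" "g (f (q \<oplus>\<^bsub>UP R\<^esub> r)) = E q \<oplus>\<^bsub>S\<^esub> E r"
        using q r gf by (simp_all add: ring_hom_mult[OF E] ring_hom_add[OF E])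
      thus "g (x \<otimes>\<^bsub>Q\<^esub> y) = g x \<otimes>\<^bsub>S\<^esub> g y" "g (x \<oplus>\<^bsub>Q\<^esub> y) = g x \<oplus>\<^bsub>S\<^esub> g y"
        using q r gf by (simp_all add: ring_hom_mult[OF f] ring_hom_add[OF f])
    next
      show "g \<one>\<^bsub>Q\<^esub> = \<one>\<^bsub>S\<^esub>" using gf[of "\<one>\<^bsub>UP R\<^esub>"] ring_hom_one[OF f] ring_hom_one[OF E] by simp
    qed
    moreover have "\<forall>r\<in>carrier R. g (c r) = j r" using gf Em by (simp add: c_def)
    moreover have "g Z = s" using gf E1 by (simp add: Z_def)
    ultimately show ?thesis by (intro bexI[of _ g]) (auto simp: g_def)
  qed
  have "is_trunc R n Q c Z"
    unfolding is_trunc_def using R Q c Z Zn surj inj univ by auto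
  thus ?thesis by blast
qed

lemma is_truncD:
  assumes "is_trunc R n P c Z"
  shows "cring R" "cring P" "c \<in> ring_hom R P" "c \<in> extensional (carrier R)" "Z \<in> carrier P"
    "Z [^]\<^bsub>P\<^esub> n = \<zero>\<^bsub>P\<^esub>" "a \<in> UNIV \<rightarrow> carrier R \<Longrightarrow> (\<lambda>i. c (a i)) \<in> UNIV \<rightarrow> carrier P"
  using assms unfolding is_trunc_def by (auto intro!: ring_hom_closed[of c R P])

lemma trunc_expand:
  assumes "is_trunc R n P c Z" "s \<in> carrier P"
  obtains a where "a \<in> UNIV \<rightarrow> carrier R" "s = peval P n (\<lambda>i. c (a i)) Z"
  using assms unfolding is_trunc_def by blast

lemma trunc_coeff_eq:
  assumes "is_trunc R n P c Z" "a \<in> UNIV \<rightarrow> carrier R" "b \<in> UNIV \<rightarrow> carrier R"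
    "peval P n (\<lambda>i. c (a i)) Z = peval P n (\<lambda>i. c (b i)) Z" "i < n"
  shows "a i = b i"
  using assms unfolding is_trunc_def by blast

lemma trunc_coeff_zero:
  assumes "is_trunc R n P c Z" "a \<in> UNIV \<rightarrow> carrier R" "peval P n (\<lambda>i. c (a i)) Z = \<zero>\<^bsub>P\<^esub>" "i < n"
  shows "a i = \<zero>\<^bsub>R\<^esub>"
proof -
  note t = is_truncD[OF assms(1)]
  interpret R: cring R by fact
  interpret P: cring P by fact
  have "peval P n (\<lambda>i. c \<zero>\<^bsub>R\<^esub>) Z = \<zero>\<^bsub>P\<^esub>"
    by (rule P.peval_zero_coeffs) (use t ring_hom_zero'[OF t(1-3)] in auto)
  thus ?thesis using trunc_coeff_eq[OF assms(1,2), of "\<lambda>_. \<zero>\<^bsub>R\<^esub>" i] assms(3,4) by simp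
qed

lemma trunc_monomial_coeff:
  assumes "is_trunc R n P c Z" "a \<in> UNIV \<rightarrow> carrier R" "i < n" "r \<in> carrier R"
    "peval P n (\<lambda>i. c (a i)) Z = c r \<otimes>\<^bsub>P\<^esub> Z [^]\<^bsub>P\<^esub> i"
  shows "a i = r"
proof -
  note t = is_truncD[OF assms(1)]
  interpret R: cring R by fact
  interpret P: cring P by fact
  let ?b = "\<lambda>j. if j = i then r else \<zero>\<^bsub>R\<^esub>"
  have "(\<lambda>j. c (?b j)) = (\<lambda>j. if j = i then c r else \<zero>\<^bsub>P\<^esub>)"
    using ring_hom_zero'[OF t(1-3)] by auto
  hence "peval P n (\<lambda>j. c (?b j)) Z = c r \<otimes>\<^bsub>P\<^esub> Z [^]\<^bsub>P\<^esub> i"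
    using P.peval_single[of "c r" Z i n] assms t ring_hom_closed[OF t(3)] by simp
  moreover have "?b \<in> UNIV \<rightarrow> carrier R" using assms by auto
  ultimately have "a i = ?b i" using trunc_coeff_eq[OF assms(1,2), of ?b i] assms by simp
  thus ?thesis by simp
qed

lemma trunc_monomial_zero:
  assumes "is_trunc R n P c Z" "i < n" "r \<in> carrier R" "c r \<otimes>\<^bsub>P\<^esub> Z [^]\<^bsub>P\<^esub> i = \<zero>\<^bsub>P\<^esub>"
  shows "r = \<zero>\<^bsub>R\<^esub>"
proof -
  note t = is_truncD[OF assms(1)]
  interpret R: cring R by fact
  interpret P: cring P by fact
  have "peval P n (\<lambda>j. c \<zero>\<^bsub>R\<^esub>) Z = \<zero>\<^bsub>P\<^esub>"
    by (rule P.peval_zero_coeffs) (use t ring_hom_zero'[OF t(1-3)] in auto)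
  thus ?thesis using trunc_monomial_coeff[OF assms(1) _ assms(2,3), of "\<lambda>_. \<zero>\<^bsub>R\<^esub>"] assms(4) by simp
qed

lemma trunc_lift:
  fixes R S :: "'u ring"
  assumes "is_trunc R n P c Z" "cring S" "f \<in> ring_hom R S" "s \<in> carrier S" "s [^]\<^bsub>S\<^esub> n = \<zero>\<^bsub>S\<^esub>"
  obtains g where "g \<in> ring_hom P S" "g \<in> extensional (carrier P)"
    "\<And>r. r \<in> carrier R \<Longrightarrow> g (c r) = f r" "g Z = s"
proof -
  have "\<exists>g\<in>ring_hom P S \<inter> extensional (carrier P). (\<forall>r\<in>carrier R. g (c r) = f r) \<and> g Z = s"
    using assms unfolding is_trunc_def
    by blast
  thus thesis using that by blast
qed

text \<open>Injectivity is inherited because coefficients can be read off in the target. For \<O>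
  inside \<open>K\<close>, this embeds the truncated polynomial rings over \<O> in those over
  \<open>K\<close>.\<close>

lemma trunc_map:
  fixes R S :: "'u ring"
  assumes "is_trunc R n P c Z" "is_trunc S n Q d Y" "f \<in> ring_hom R S"
  obtains g where "g \<in> ring_hom P Q" "g \<in> extensional (carrier P)"
    "\<And>r. r \<in> carrier R \<Longrightarrow> g (c r) = d (f r)" "g Z = Y"
    "inj_on f (carrier R) \<Longrightarrow> inj_on g (carrier P)"
proof -
  note t = is_truncD[OF assms(1)] and u = is_truncD[OF assms(2)]
  have df: "d \<circ> f \<in> ring_hom R Q" using ring_hom_trans[OF assms(3) u(3)] .
  obtain g where g: "g \<in> ring_hom P Q" "g \<in> extensional (carrier P)"
    "\<And>r. r \<in> carrier R \<Longrightarrow> g (c r) = (d \<circ> f) r" "g Z = Y"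
    using trunc_lift[OF assms(1) u(2) df u(5,6)] by blast
  have "inj_on g (carrier P)" if inj: "inj_on f (carrier R)"
  proof (rule inj_onI)
    fix x y assume xy: "x \<in> carrier P" "y \<in> carrier P" "g x = g y"
    obtain a where a: "a \<in> UNIV \<rightarrow> carrier R" "x = peval P n (\<lambda>i. c (a i)) Z"
      using trunc_expand[OF assms(1) xy(1)] by blast
    obtain b where b: "b \<in> UNIV \<rightarrow> carrier R" "y = peval P n (\<lambda>i. c (b i)) Z"
      using trunc_expand[OF assms(1) xy(2)] by blast
    have img: "g (peval P n (\<lambda>i. c (a i)) Z) = peval Q n (\<lambda>i. d (f (a i))) Y" if "a \<in> UNIV \<rightarrow> carrier R" for a
    proof -
      have "(\<lambda>i. g (c (a i))) = (\<lambda>i. d (f (a i)))" using that g(3) by auto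
      thus ?thesis using ring_hom_peval[OF t(2) u(2) g(1) t(7)[OF that] t(5)] g(4) by simp
    qed
    have fc: "(\<lambda>i. f (a i)) \<in> UNIV \<rightarrow> carrier S" if "a \<in> UNIV \<rightarrow> carrier R" for a
      using that ring_hom_closed[OF assms(3)] by auto
    interpret P: cring P by (rule t(2))
    have "a i = b i" if "i < n" for i
    proof -
      have "f (a i) = f (b i)"
        using trunc_coeff_eq[OF assms(2) fc[OF a(1)] fc[OF b(1)] _ that] img[OF a(1)] img[OF b(1)] a b xy by simp
      thus ?thesis using inj a(1) b(1) by (auto dest: inj_onD)
    qed
    thus "x = y" unfolding a(2) b(2) by (intro P.peval_cong t(7)[OF a(1)] t(5)) auto
  qed
  thus thesis using that g by simp
qed

section \<open>Natural transformations and power series\<close>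

lemma ring_hom_cong:
  assumes "cring R" "f \<in> ring_hom R S" "\<And>r. r \<in> carrier R \<Longrightarrow> g r = f r"
  shows "g \<in> ring_hom R S"
proof -
  interpret cring R by fact
  show ?thesis using assms(2) by (auto simp: ring_hom_def assms(3))
qed

section \<open>Algebras, their homomorphisms and quotients\<close>

lemma algsD:
  assumes "R \<in> algs A"
  shows "cring (fst R)" "snd R \<in> ring_hom A (fst R)" "snd R \<in> extensional (carrier A)"
    "a \<in> carrier A \<Longrightarrow> snd R a \<in> alg_carrier R"
    "b \<in> UNIV \<rightarrow> carrier A \<Longrightarrow> (\<lambda>i. snd R (b i)) \<in> UNIV \<rightarrow> alg_carrier R"
  using assms by (auto simp: algs_def intro!: ring_hom_closed[of "snd R" A "fst R"])

lemma algsI: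
  assumes "cring P" "c \<in> ring_hom A P" "c \<in> extensional (carrier A)"
  shows "(P, c) \<in> algs A"
  using assms by (simp add: algs_def)

lemma alg_homD:
  assumes "f \<in> alg_hom A R T"
  shows "f \<in> ring_hom (fst R) (fst T)" "f \<in> extensional (alg_carrier R)"
    "a \<in> carrier A \<Longrightarrow> f (snd R a) = snd T a" "x \<in> alg_carrier R \<Longrightarrow> f x \<in> alg_carrier T"
  using assms by (auto simp: alg_hom_def intro!: ring_hom_closed[of f "fst R" "fst T"])

lemma alg_homI:
  assumes "f \<in> ring_hom (fst R) (fst T)" "f \<in> extensional (alg_carrier R)"
    "\<And>a. a \<in> carrier A \<Longrightarrow> f (snd R a) = snd T a"
  shows "f \<in> alg_hom A R T"
  using assms by (simp add: alg_hom_def)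

lemma identity_alg_hom:
  assumes "R \<in> algs A"
  shows "(\<lambda>r\<in>alg_carrier R. r) \<in> alg_hom A R R"
proof -
  interpret cring "fst R" using algsD(1)[OF assms] .
  show ?thesis using algsD(4)[OF assms] by (intro alg_homI) (auto simp: ring_hom_def)
qed

lemma self_alg_in_algs:
  assumes "cring A"
  shows "self_alg A \<in> algs A"
  using assms by (auto simp: algs_def self_alg_def ring_hom_def cring_def ring.ring_simprules)

lemma fst_self_alg [simp]: "fst (self_alg A) = A"
  by (simp add: self_alg_def)

lemma snd_self_alg [simp]: "a \<in> carrier A \<Longrightarrow> snd (self_alg A) a = a"
  by (simp add: self_alg_def)

lemma structure_alg_hom:
  assumes "R \<in> algs A"
  shows "snd R \<in> alg_hom A (self_alg A) R"
  using algsD[OF assms] by (auto simp: alg_hom_def)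

lemma fst_restrict_scalars [simp]: "fst (restrict_scalars A f R) = fst R"
  by (simp add: restrict_scalars_def)

lemma snd_restrict_scalars [simp]: "a \<in> carrier A \<Longrightarrow> snd (restrict_scalars A f R) a = snd R (f a)"
  by (simp add: restrict_scalars_def compose_eq)

lemma restrict_scalars_in_algs:
  assumes "cring A" "R \<in> algs B" "f \<in> ring_hom A B"
  shows "restrict_scalars A f R \<in> algs A"
proof -
  have "snd R \<circ> f \<in> ring_hom A (fst R)"
    using ring_hom_trans[OF assms(3) algsD(2)[OF assms(2)]] .
  hence "compose (carrier A) (snd R) f \<in> ring_hom A (fst R)"
    by (rule ring_hom_cong[OF assms(1)]) (simp add: compose_eq)
  thus ?thesis using algsD(1)[OF assms(2)]
    by (simp add: algs_def restrict_scalars_def)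
qed

lemma restrict_scalars_alg_hom:
  assumes "g \<in> alg_hom B R T" "f \<in> ring_hom A B"
  shows "g \<in> alg_hom A (restrict_scalars A f R) (restrict_scalars A f T)"
  using alg_homD[OF assms(1)] ring_hom_closed[OF assms(2)] by (intro alg_homI) auto

lemma structure_restrict_scalars:
  assumes "B \<in> algs A" "(P, c) \<in> algs (fst B)"
  shows "c \<in> alg_hom A B (restrict_scalars A (snd B) (P, c))"
  using algsD[OF assms(1)] algsD[OF assms(2)] by (intro alg_homI) auto

text \<open>The quotient has to be a ring on \<open>'u\<close> again, so each coset is replaced by
  an element chosen from it.\<close>

lemma ex_quotient:
  assumes "cring (R :: 'u ring)" "ideal I R"
  obtains Q q where "cring (Q :: 'u ring)" "q \<in> ring_hom R Q" "q \<in> extensional (carrier R)"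
    "q ` carrier R = carrier Q" "\<forall>r\<in>carrier R. q r = \<zero>\<^bsub>Q\<^esub> \<longleftrightarrow> r \<in> I"
proof -
  interpret R: cring R by fact
  interpret I: ideal I R by fact
  define f where "f r = (SOME y. y \<in> I +>\<^bsub>R\<^esub> r)" for r
  have fc: "f r \<in> I +>\<^bsub>R\<^esub> r" if "r \<in> carrier R" for r
    unfolding f_def using I.a_rcos_self[OF that] by (rule someI)
  have w: "weak_ring_morphism f I R"
  proof (rule weak_ring_morphismI[OF assms(2)])
    fix a b assume ab: "a \<in> carrier R" "b \<in> carrier R"
    show "f a = f b \<longleftrightarrow> a \<ominus>\<^bsub>R\<^esub> b \<in> I"
    proof
      assume "f a = f b"
      hence "f a \<in> I +>\<^bsub>R\<^esub> b" using fc ab by simp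
      hence "I +>\<^bsub>R\<^esub> a = I +>\<^bsub>R\<^esub> b"
        using I.a_repr_independence'[of "f a" a] I.a_repr_independence'[of "f a" b] fc ab by simp
      thus "a \<ominus>\<^bsub>R\<^esub> b \<in> I" using ab R.quotient_eq_iff_same_a_r_cos[OF assms(2)] by simp
    next
      assume "a \<ominus>\<^bsub>R\<^esub> b \<in> I"
      hence "I +>\<^bsub>R\<^esub> a = I +>\<^bsub>R\<^esub> b" using ab R.quotient_eq_iff_same_a_r_cos[OF assms(2)] by simp
      thus "f a = f b" by (simp add: f_def)
    qed
  qed
  let ?Q = "image_ring f R"
  have f: "f \<in> ring_hom R ?Q" by (rule R.weak_ring_morphism_is_hom[OF w])
  have ker: "f r = \<zero>\<^bsub>?Q\<^esub> \<longleftrightarrow> r \<in> I" if "r \<in> carrier R" for r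
    using weak_ring_morphism.inj_mod_ideal[OF w that R.zero_closed] that
    by (simp add: image_ring_zero R.minus_eq)
  show thesis
  proof (rule that)
    show "cring ?Q" by (rule cring_image_ring[OF assms(1) w])
    show "restrict f (carrier R) \<in> ring_hom R ?Q" by (rule ring_hom_cong[OF assms(1) f]) simp
    show "restrict f (carrier R) ` carrier R = carrier ?Q" by (simp add: image_ring_carrier)
    show "\<forall>r\<in>carrier R. restrict f (carrier R) r = \<zero>\<^bsub>?Q\<^esub> \<longleftrightarrow> r \<in> I"
      using ker by simp
  qed simp
qed

text \<open>The \<open>R\<close>-points of \<open>Spec A[T]/(T^n)\<close>, the layers of which
  \<open>Spf_power_series\<close> is the union.\<close>

definition nil_le :: "nat \<Rightarrow> 'u alg \<Rightarrow> 'u set" where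
  "nil_le n R = {t \<in> alg_carrier R. t [^]\<^bsub>fst R\<^esub> n = \<zero>\<^bsub>fst R\<^esub>}"

lemma nil_leD: "t \<in> nil_le n R \<Longrightarrow> t \<in> alg_carrier R" "t \<in> nil_le n R \<Longrightarrow> t [^]\<^bsub>fst R\<^esub> n = \<zero>\<^bsub>fst R\<^esub>"
  by (simp_all add: nil_le_def)

lemma nil_le_mono:
  assumes "R \<in> algs A" "t \<in> nil_le n R" "n \<le> m"
  shows "t \<in> nil_le m R"
  using assms cring.nat_pow_zero_mono[OF algsD(1)[OF assms(1)]] by (auto simp: nil_le_def)

lemma Spf_nil_le: "Spf_power_series R = (\<Union>n. nil_le n R)"
  by (simp add: Spf_power_series_def nil_le_def)

lemma nil_le_Spf: "t \<in> nil_le n R \<Longrightarrow> t \<in> Spf_power_series R"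
  by (auto simp: Spf_nil_le)

lemma Spf_closed: "t \<in> Spf_power_series R \<Longrightarrow> t \<in> alg_carrier R"
  by (auto simp: Spf_power_series_def)

lemma SpfE:
  assumes "t \<in> Spf_power_series R"
  obtains n where "t \<in> nil_le n R"
  using assms by (auto simp: Spf_nil_le)

lemma nil_le_hom:
  assumes "R \<in> algs A" "T \<in> algs A" "f \<in> alg_hom A R T" "t \<in> nil_le n R"
  shows "f t \<in> nil_le n T"
  using assms ring_hom_nat_pow[OF algsD(1)[OF assms(1)] algsD(1)[OF assms(2)] alg_homD(1)[OF assms(3)], of t n]
    ring_hom_zero'[OF algsD(1)[OF assms(1)] algsD(1)[OF assms(2)] alg_homD(1)[OF assms(3)]]
    alg_homD(4)[OF assms(3)]
  by (simp add: nil_le_def)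

lemma Spf_hom:
  assumes "R \<in> algs A" "T \<in> algs A" "f \<in> alg_hom A R T" "t \<in> Spf_power_series R"
  shows "f t \<in> Spf_power_series T"
  using assms nil_le_hom[OF assms(1-3)] by (auto simp: Spf_nil_le)

lemma zero_nil_le:
  assumes "R \<in> algs A"
  shows "\<zero>\<^bsub>fst R\<^esub> \<in> nil_le (Suc n) R" "\<zero>\<^bsub>fst R\<^esub> \<in> Spf_power_series R"
proof -
  interpret cring "fst R" using algsD(1)[OF assms] .
  show "\<zero>\<^bsub>fst R\<^esub> \<in> nil_le (Suc n) R" by (simp add: nil_le_def)
  thus "\<zero>\<^bsub>fst R\<^esub> \<in> Spf_power_series R" by (rule nil_le_Spf)
qed

definition natural_on :: "'u ring \<Rightarrow> ('u alg \<Rightarrow> 'u set) \<Rightarrow> ('u alg \<Rightarrow> 'u \<Rightarrow> 'u) \<Rightarrow> bool" where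
  "natural_on A D \<phi> \<longleftrightarrow>
     (\<forall>R\<in>algs A. \<forall>t\<in>D R. \<phi> R t \<in> alg_carrier R) \<and>
     (\<forall>R\<in>algs A. \<forall>T\<in>algs A. \<forall>f\<in>alg_hom A R T. \<forall>t\<in>D R. \<phi> T (f t) = f (\<phi> R t))"

lemma natural_onI:
  assumes "\<And>R t. R \<in> algs A \<Longrightarrow> t \<in> D R \<Longrightarrow> \<phi> R t \<in> alg_carrier R"
    "\<And>R T f t. R \<in> algs A \<Longrightarrow> T \<in> algs A \<Longrightarrow> f \<in> alg_hom A R T \<Longrightarrow> t \<in> D R \<Longrightarrow> \<phi> T (f t) = f (\<phi> R t)"
  shows "natural_on A D \<phi>"
  unfolding natural_on_def using assms by simp

lemma natural_onD:
  assumes "natural_on A D \<phi>" "R \<in> algs A" "t \<in> D R"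
  shows "\<phi> R t \<in> alg_carrier R" "T \<in> algs A \<Longrightarrow> f \<in> alg_hom A R T \<Longrightarrow> \<phi> T (f t) = f (\<phi> R t)"
  using assms unfolding natural_on_def by simp_all

lemma natural_on_mono:
  assumes "natural_on A D \<phi>" "\<And>R t. t \<in> E R \<Longrightarrow> t \<in> D R"
  shows "natural_on A E \<phi>"
  by (rule natural_onI) (simp_all add: natural_onD[OF assms(1)] assms(2))

section \<open>Power series acting on nilpotent points\<close>

abbreviation aeval :: "'u alg \<Rightarrow> nat \<Rightarrow> (nat \<Rightarrow> 'u) \<Rightarrow> 'u \<Rightarrow> 'u" where
  "aeval R n a t \<equiv> peval (fst R) n (\<lambda>i. snd R (a i)) t"

lemma aeval_closed:
  assumes "R \<in> algs A" "a \<in> UNIV \<rightarrow> carrier A" "t \<in> alg_carrier R"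
  shows "aeval R n a t \<in> alg_carrier R"
  using cring.peval_closed[OF algsD(1)[OF assms(1)] algsD(5)[OF assms(1,2)] assms(3)] .

lemma aeval_hom:
  assumes "R \<in> algs A" "T \<in> algs A" "f \<in> alg_hom A R T" "a \<in> UNIV \<rightarrow> carrier A" "t \<in> alg_carrier R"
  shows "f (aeval R n a t) = aeval T n a (f t)"
proof -
  have "(\<lambda>i. f (snd R (a i))) = (\<lambda>i. snd T (a i))" using assms(4) alg_homD(3)[OF assms(3)] by auto
  thus ?thesis
    using ring_hom_peval[OF algsD(1)[OF assms(1)] algsD(1)[OF assms(2)] alg_homD(1)[OF assms(3)]
        algsD(5)[OF assms(1,4)] assms(5), of n] by simp
qed

lemma aeval_eq:
  assumes "R \<in> algs A" "a \<in> UNIV \<rightarrow> carrier A" "t \<in> nil_le n R" "t \<in> nil_le m R"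
  shows "aeval R n a t = aeval R m a t"
  using cring.peval_eq[OF algsD(1)[OF assms(1)] algsD(5)[OF assms(1,2)], of t m n] assms(3,4)
  by (simp add: nil_le_def)

lemma aeval_cong:
  assumes "R \<in> algs A" "a \<in> UNIV \<rightarrow> carrier A" "t \<in> alg_carrier R" "\<And>i. i < n \<Longrightarrow> a i = b i"
  shows "aeval R n a t = aeval R n b t"
  using cring.peval_cong[OF algsD(1)[OF assms(1)] algsD(5)[OF assms(1,2)] assms(3)] assms(4) by simp

text \<open>Without constant term the value is a multiple of \<open>t\<close>, so the same power of
  it vanishes.\<close>

lemma aeval_nil_le:
  assumes "cring A" "R \<in> algs A" "a \<in> UNIV \<rightarrow> carrier A" "a 0 = \<zero>\<^bsub>A\<^esub>" "t \<in> nil_le n R"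
  shows "aeval R n a t \<in> nil_le n R"
proof -
  interpret R: cring "fst R" using algsD(1)[OF assms(2)] .
  note t = nil_leD[OF assms(5)]
  note c = algsD(5)[OF assms(2,3)]
  have a0: "snd R (a 0) = \<zero>\<^bsub>fst R\<^esub>"
    using ring_hom_zero'[OF assms(1) algsD(1,2)[OF assms(2)]] assms(4) by simp
  let ?s = "peval (fst R) n (\<lambda>i. snd R (a (i + 1))) t"
  \<comment> \<open>The cut is raised to \<open>n + 1\<close> so that a factor \<open>t\<close> can
    be split off even for \<open>n = 0\<close>.\<close>
  have "aeval R n a t = peval (fst R) (n + 1) (\<lambda>i. snd R (a i)) t"
    by (rule R.peval_mono[OF c t, symmetric]) simp
  also have "\<dots> = t \<otimes>\<^bsub>fst R\<^esub> ?s"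
    using R.peval_shift[OF c t(1), of 1 "n + 1"] a0 t(1) by simp
  finally have e: "aeval R n a t = t \<otimes>\<^bsub>fst R\<^esub> ?s" .
  have s: "?s \<in> alg_carrier R"
  proof (rule R.peval_closed[OF _ t(1)])
    have "(\<lambda>i. a (i + 1)) \<in> UNIV \<rightarrow> carrier A" using assms(3) by auto
    thus "(\<lambda>i. snd R (a (i + 1))) \<in> UNIV \<rightarrow> alg_carrier R" by (rule algsD(5)[OF assms(2)])
  qed
  have "(t \<otimes>\<^bsub>fst R\<^esub> ?s) [^]\<^bsub>fst R\<^esub> n = \<zero>\<^bsub>fst R\<^esub>"
    unfolding R.nat_pow_distrib[OF t(1) s] t(2) using s by (intro R.l_null R.nat_pow_closed)
  thus ?thesis unfolding e nil_le_def using t(1) s by blast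
qed

lemma trunc_alg:
  assumes "is_trunc A n P c Z"
  shows "(P, c) \<in> algs A" "Z \<in> nil_le n (P, c)"
  using is_truncD[OF assms] by (auto intro: algsI simp: nil_le_def)

lemma trunc_alg_lift:
  assumes "is_trunc A n P c Z" "R \<in> algs A" "t \<in> nil_le n R"
  obtains g where "g \<in> alg_hom A (P, c) R" "g Z = t"
proof -
  obtain g where "g \<in> ring_hom P (fst R)" "g \<in> extensional (carrier P)"
    "\<And>r. r \<in> carrier A \<Longrightarrow> g (c r) = snd R r" "g Z = t"
    using trunc_lift[OF assms(1) algsD(1,2)[OF assms(2)] nil_leD[OF assms(3)]] by blast
  thus thesis by (intro that[of g] alg_homI) auto
qed

text \<open>Yoneda: every point of \<open>nil_le n\<close> is the image of the class
  \<open>Z\<close> of \<open>T\<close> in the truncated ring, and the coefficients wanted are those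
  of the value at \<open>Z\<close>.\<close>

lemma natural_expansion_le:
  fixes A :: "'u ring"
  assumes "infinite (UNIV :: 'u set)" "cring A" "natural_on A (nil_le n) \<phi>"
  shows "\<exists>a\<in>UNIV \<rightarrow> carrier A. \<forall>R\<in>algs A. \<forall>t\<in>nil_le n R. \<phi> R t = aeval R n a t"
proof -
  obtain P c Z where t: "is_trunc A n P c Z" using ex_trunc[OF assms(1,2)] by blast
  note P = trunc_alg[OF t]
  have "\<phi> (P, c) Z \<in> carrier P" using assms(3) P by (auto simp: natural_on_def)
  then obtain a where a: "a \<in> UNIV \<rightarrow> carrier A" "\<phi> (P, c) Z = peval P n (\<lambda>i. c (a i)) Z"
    using trunc_expand[OF t] by blast
  have "\<phi> R s = aeval R n a s" if R: "R \<in> algs A" and s: "s \<in> nil_le n R" for R s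
  proof -
    obtain g where g: "g \<in> alg_hom A (P, c) R" "g Z = s" using trunc_alg_lift[OF t R s] .
    have "\<phi> R s = g (\<phi> (P, c) Z)" using assms(3) P R g by (auto simp: natural_on_def)
    also have "\<dots> = aeval R n a s"
      using aeval_hom[OF P(1) R g(1) a(1), of Z n] a(2) g(2) nil_leD[OF P(2)] by simp
    finally show ?thesis .
  qed
  thus ?thesis using a(1) by blast
qed

text \<open>The generic point \<open>Z\<close> alone separates the coefficients below
  \<open>n\<close>.\<close>

lemma expansion_unique:
  fixes A :: "'u ring"
  assumes "infinite (UNIV :: 'u set)" "cring A" "a \<in> UNIV \<rightarrow> carrier A" "b \<in> UNIV \<rightarrow> carrier A"
    "\<And>R t. R \<in> algs A \<Longrightarrow> t \<in> nil_le n R \<Longrightarrow> aeval R n a t = aeval R n b t" "i < n"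
  shows "a i = b i"
proof -
  obtain P c Z where t: "is_trunc A n P c Z" using ex_trunc[OF assms(1,2)] by blast
  show ?thesis
    using trunc_coeff_eq[OF t assms(3,4) _ assms(6)] assms(5)[OF trunc_alg[OF t]] by simp
qed

text \<open>The formal power series \<open>a\<close> describes a map on all nilpotent points.
  Quantifying over every \<open>n\<close> with \<open>t\<close> in \<open>nil_le n R\<close> makes
  the value independent of the exponent used as the cut.\<close>

definition represents :: "'u ring \<Rightarrow> ('u alg \<Rightarrow> 'u \<Rightarrow> 'u) \<Rightarrow> (nat \<Rightarrow> 'u) \<Rightarrow> bool" where
  "represents A \<phi> a \<longleftrightarrow> a \<in> UNIV \<rightarrow> carrier A \<and>
     (\<forall>R\<in>algs A. \<forall>n. \<forall>t\<in>nil_le n R. \<phi> R t = aeval R n a t)"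

lemma representsD:
  assumes "represents A \<phi> a"
  shows "a \<in> UNIV \<rightarrow> carrier A" "R \<in> algs A \<Longrightarrow> t \<in> nil_le n R \<Longrightarrow> \<phi> R t = aeval R n a t"
  using assms by (simp_all add: represents_def)

lemma natural_expansion:
  fixes A :: "'u ring"
  assumes "infinite (UNIV :: 'u set)" "cring A" "natural_on A Spf_power_series \<phi>"
  obtains a where "represents A \<phi> a"
proof -
  have "\<exists>a. a \<in> UNIV \<rightarrow> carrier A \<and> (\<forall>R\<in>algs A. \<forall>t\<in>nil_le n R. \<phi> R t = aeval R n a t)" for n
  proof -
    have "natural_on A (nil_le n) \<phi>"
      by (rule natural_on_mono[OF assms(3)]) (rule nil_le_Spf)
    from natural_expansion_le[OF assms(1,2) this] show ?thesis by (simp only: Bex_def)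
  qed
  hence "\<exists>a. \<forall>n. a n \<in> UNIV \<rightarrow> carrier A \<and> (\<forall>R\<in>algs A. \<forall>t\<in>nil_le n R. \<phi> R t = aeval R n (a n) t)"
    by (intro choice allI)
  then obtain a where "\<forall>n. a n \<in> UNIV \<rightarrow> carrier A \<and> (\<forall>R\<in>algs A. \<forall>t\<in>nil_le n R. \<phi> R t = aeval R n (a n) t)"
    by (rule exE)
  hence a: "\<And>n. a n \<in> UNIV \<rightarrow> carrier A"
    "\<And>n R t. R \<in> algs A \<Longrightarrow> t \<in> nil_le n R \<Longrightarrow> \<phi> R t = aeval R n (a n) t"
    by simp_all
  have eq: "a n i = a m i" if "i < n" "n \<le> m" for n m i
  proof (rule expansion_unique[OF assms(1,2) a(1) a(1) _ that(1)])
    fix R t assume R: "R \<in> algs A" and t: "t \<in> nil_le n R"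
    have tm: "t \<in> nil_le m R" by (rule nil_le_mono[OF R t that(2)])
    show "aeval R n (a n) t = aeval R n (a m) t"
      using a(2)[OF R t] a(2)[OF R tm] aeval_eq[OF R a(1) t tm, of m] by simp
  qed
  \<comment> \<open>Coefficient \<open>i\<close> is fixed from level \<open>i + 1\<close> on, so the
    diagonal collects the compatible truncations into one series.\<close>
  define b where "b i = a (Suc i) i" for i
  have b: "b \<in> UNIV \<rightarrow> carrier A" using funcset_mem[OF a(1)] by (simp add: b_def)
  have "\<phi> R t = aeval R n b t" if R: "R \<in> algs A" and t: "t \<in> nil_le n R" for R t n
  proof -
    have "b i = a n i" if "i < n" for i unfolding b_def using that by (intro eq) auto
    hence "aeval R n b t = aeval R n (a n) t"
      by (intro aeval_cong[OF R b nil_leD(1)[OF t]])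
    thus ?thesis using a(2)[OF R t] by simp
  qed
  hence "represents A \<phi> b" using b by (simp add: represents_def)
  thus thesis by (rule that)
qed

lemma represents_unique:
  fixes A :: "'u ring"
  assumes "infinite (UNIV :: 'u set)" "cring A" "represents A \<phi> a" "represents A \<psi> b"
    "\<And>R t. R \<in> algs A \<Longrightarrow> t \<in> Spf_power_series R \<Longrightarrow> \<phi> R t = \<psi> R t"
  shows "a = b"
proof
  fix i
  show "a i = b i"
  proof (rule expansion_unique[OF assms(1,2) representsD(1)[OF assms(3)] representsD(1)[OF assms(4)], of "Suc i"])
    fix R t assume "R \<in> algs A" "t \<in> nil_le (Suc i) R"
    thus "aeval R (Suc i) a t = aeval R (Suc i) b t"
      using representsD(2)[OF assms(3), of R t "Suc i"] representsD(2)[OF assms(4), of R t "Suc i"]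
        assms(5)[of R t] nil_le_Spf[of t "Suc i" R] by simp
  qed simp
qed

section \<open>Frobenius and first order expansion\<close>

context cring
begin

lemma binomial_theorem:
  assumes [simp]: "x \<in> carrier R" "y \<in> carrier R"
  shows "(x \<oplus> y) [^] (n::nat) = (\<Oplus>i\<in>{..n}. add_pow R (n choose i) (x [^] i \<otimes> y [^] (n - i)))"
proof (induction n)
  case 0
  show ?case by (simp add: finsum_0)
next
  case (Suc n)
  let ?B = "\<lambda>m k i. add_pow R (m choose i) (x [^] i \<otimes> y [^] (k - i))"
  let ?S = "\<Oplus>i\<in>{..n}. ?B n n i"
  have B: "?B m k i \<in> carrier R" for m k i :: nat by simp
  have xS: "x \<otimes> ?S = (\<Oplus>i\<in>{..n}. add_pow R (n choose i) (x [^] Suc i \<otimes> y [^] (n - i)))"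
    by (simp add: finsum_rdistr Pi_I add_pow_rdistr m_assoc[symmetric] m_comm[of x "x [^] _"])
  have yS: "y \<otimes> ?S = (\<Oplus>i\<in>{..n}. ?B n (Suc n) i)"
  proof -
    have "y \<otimes> ?S = (\<Oplus>i\<in>{..n}. y \<otimes> ?B n n i)"
      by (simp add: finsum_rdistr Pi_I)
    also have "\<dots> = (\<Oplus>i\<in>{..n}. ?B n (Suc n) i)"
    proof (rule finsum_cong')
      fix i assume "i \<in> {..n}"
      hence "y \<otimes> (x [^] i \<otimes> y [^] (n - i)) = x [^] i \<otimes> y [^] (Suc n - i)"
        by (simp add: Suc_diff_le m_lcomm[of y] m_comm[of y] m_assoc)
      thus "y \<otimes> ?B n n i = ?B n (Suc n) i" by (simp add: add_pow_rdistr)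
    qed (use B in auto)
    finally show ?thesis .
  qed
  also have "\<dots> = (\<Oplus>i\<in>{..Suc n}. ?B n (Suc n) i)"
    by (subst finsum_Suc) (use B in \<open>auto intro: finsum_closed simp: binomial_eq_0\<close>)
  also have "\<dots> = (\<Oplus>i\<in>{..n}. ?B n (Suc n) (Suc i)) \<oplus> ?B n (Suc n) 0"
    by (rule finsum_Suc2) (use B in auto)
  finally have yS: "y \<otimes> ?S = (\<Oplus>i\<in>{..n}. add_pow R (n choose Suc i) (x [^] Suc i \<otimes> y [^] (n - i))) \<oplus> y [^] Suc n"
    by simp
  have C: "add_pow R (m::nat) (x [^] Suc i \<otimes> y [^] (n - i)) \<in> carrier R" for m i by simp
  have "(\<Oplus>i\<in>{..Suc n}. ?B (Suc n) (Suc n) i) = (\<Oplus>i\<in>{..n}. ?B (Suc n) (Suc n) (Suc i)) \<oplus> ?B (Suc n) (Suc n) 0"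
    by (rule finsum_Suc2) (use B in auto)
  also have "(\<Oplus>i\<in>{..n}. ?B (Suc n) (Suc n) (Suc i))
      = (\<Oplus>i\<in>{..n}. add_pow R (n choose i) (x [^] Suc i \<otimes> y [^] (n - i)) \<oplus> add_pow R (n choose Suc i) (x [^] Suc i \<otimes> y [^] (n - i)))"
    by (rule finsum_cong') (simp_all add: add.nat_pow_mult del: nat_pow_Suc)
  also have "\<dots> = x \<otimes> ?S \<oplus> (\<Oplus>i\<in>{..n}. add_pow R (n choose Suc i) (x [^] Suc i \<otimes> y [^] (n - i)))"
    unfolding xS by (rule finsum_addf) (use C in auto)
  finally have "(\<Oplus>i\<in>{..Suc n}. ?B (Suc n) (Suc n) i)
    = x \<otimes> ?S \<oplus> (\<Oplus>i\<in>{..n}. add_pow R (n choose Suc i) (x [^] Suc i \<otimes> y [^] (n - i))) \<oplus> y [^] Suc n" by simp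
  moreover have "?S \<in> carrier R" by (rule finsum_closed) (use B in auto)
  moreover have "(\<Oplus>i\<in>{..n}. add_pow R (n choose Suc i) (x [^] Suc i \<otimes> y [^] (n - i))) \<in> carrier R"
    by (rule finsum_closed) (use C in auto)
  moreover have "(x \<oplus> y) [^] Suc n = ?S \<otimes> (x \<oplus> y)" using Suc by simp
  ultimately show ?case using yS
    by (simp add: r_distr m_comm[of ?S] a_assoc del: nat_pow_Suc)
qed

lemma char_dvd_add_pow:
  assumes "add_pow R (p::nat) \<one> = \<zero>" "p dvd k" "x \<in> carrier R"
  shows "add_pow R k x = \<zero>"
proof -
  obtain j where j: "k = p * j" using assms(2) by blast
  have "add_pow R p x = add_pow R p \<one> \<otimes> x"
    using assms(3) by (simp add: add_pow_ldistr)
  hence "add_pow R p x = \<zero>" using assms(1,3) by simp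
  thus ?thesis using add.nat_pow_pow[OF assms(3), of j p] j by simp
qed

text \<open>Bezout makes \<open>k\<close> invertible modulo \<open>p\<close>, so
  \<open>k x = 0\<close> forces \<open>x = 0\<close>.\<close>

lemma char_cancel_add_pow:
  assumes "add_pow R (p::nat) \<one> = \<zero>" "Factorial_Ring.prime p" "\<not> p dvd k" "x \<in> carrier R" "add_pow R k x = \<zero>"
  shows "x = \<zero>"
proof -
  have "k \<noteq> 0" using assms(3) by (cases k) auto
  then obtain u v where uv: "k * u = p * v + gcd k p" using bezout_nat by blast
  moreover have "gcd k p = 1" using assms(2,3) by (metis gcd.commute prime_imp_coprime coprime_iff_gcd_eq_1)
  ultimately have "add_pow R (k * u) x = add_pow R (p * v) x \<oplus> x"
    using assms(4) by (simp add: add.nat_pow_Suc)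
  moreover have "add_pow R (k * u) x = \<zero>"
    using add.nat_pow_pow[OF assms(4), of u k] assms(5) by simp
  moreover have "add_pow R (p * v) x = \<zero>" by (rule char_dvd_add_pow) (use assms in auto)
  ultimately show ?thesis using assms(4) by simp
qed

lemma frobenius_add:
  assumes p: "Factorial_Ring.prime p" "add_pow R (p::nat) \<one> = \<zero>" and [simp]: "x \<in> carrier R" "y \<in> carrier R"
  shows "(x \<oplus> y) [^] p = x [^] p \<oplus> y [^] p"
proof -
  let ?f = "\<lambda>i. add_pow R (p choose i) (x [^] i \<otimes> y [^] (p - i))"
  have p0: "p > 0" using p(1) prime_gt_0_nat by blast
  have f: "?f i \<in> carrier R" for i by simp
  have "{..p} = insert 0 (insert p {0<..<p})" using p0 by auto
  hence "(x \<oplus> y) [^] p = (\<Oplus>i\<in>insert 0 (insert p {0<..<p}). ?f i)"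
    using binomial_theorem[of x y p] by simp
  also have "\<dots> = ?f 0 \<oplus> (?f p \<oplus> (\<Oplus>i\<in>{0<..<p}. ?f i))"
    by (subst finsum_insert; (subst finsum_insert)?) (use f p0 in auto)
  also have "(\<Oplus>i\<in>{0<..<p}. ?f i) = (\<Oplus>i\<in>{0<..<p}. \<zero>)"
  proof (rule finsum_cong')
    fix i assume "i \<in> {0<..<p}"
    hence "p dvd p choose i" using p(1) by (intro dvd_choose_prime) auto
    thus "?f i = \<zero>" by (intro char_dvd_add_pow[OF p(2)]) auto
  qed auto
  finally show ?thesis by (simp add: a_comm)
qed

lemma frobenius_power_add:
  assumes p: "Factorial_Ring.prime p" "add_pow R (p::nat) \<one> = \<zero>" and xy: "x \<in> carrier R" "y \<in> carrier R"
  shows "(x \<oplus> y) [^] (p ^ k) = x [^] (p ^ k) \<oplus> y [^] (p ^ k)"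
proof (induction k)
  case (Suc k)
  have *: "z [^] (p ^ Suc k) = (z [^] (p ^ k)) [^] p" if "z \<in> carrier R" for z
    using that by (simp add: nat_pow_pow mult.commute)
  show ?case using Suc xy by (simp add: * frobenius_add[OF p] del: power_Suc)
qed (use xy in simp)

lemma frobenius_peval:
  assumes p: "Factorial_Ring.prime p" "add_pow R (p::nat) \<one> = \<zero>"
    and c: "c \<in> UNIV \<rightarrow> carrier R" "t \<in> carrier R"
  shows "peval R n c t [^] (p ^ k) = peval R n (\<lambda>i. c i [^] (p ^ k)) (t [^] (p ^ k))"
proof (induction n)
  case 0
  have "p ^ k \<noteq> 0" using p(1) prime_gt_0_nat by simp
  thus ?case by (simp add: nat_pow_zero)
next
  case (Suc n)
  have ci: "c i \<in> carrier R" for i using c by auto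
  have "(\<lambda>i. c i [^] (p ^ k)) \<in> UNIV \<rightarrow> carrier R" using ci by simp
  moreover have "peval R n c t \<in> carrier R" using c by (rule peval_closed)
  ultimately show ?case using c ci[of n] Suc
    by (simp add: peval_Suc frobenius_power_add[OF p] nat_pow_distrib nat_pow_pow mult.commute)
qed

text \<open>The Taylor formula to first order, multiplied by \<open>z\<close>: the derivative
  \<open>j z^(j - 1)\<close> becomes \<open>j z^j\<close>, and no subtraction of natural numbers
  occurs.\<close>

lemma first_order_power:
  assumes [simp]: "z \<in> carrier R" "e \<in> carrier R" and e: "e \<otimes> e = \<zero>"
  shows "z \<otimes> (z \<oplus> e) [^] (j::nat) = z \<otimes> z [^] j \<oplus> add_pow R j (z [^] j \<otimes> e)"
proof (induction j)
  case (Suc j)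
  have "z \<otimes> (z \<oplus> e) [^] Suc j = (z \<otimes> (z \<oplus> e) [^] j) \<otimes> (z \<oplus> e)"
    by (simp add: m_assoc)
  also have "\<dots> = (z \<otimes> z [^] j \<oplus> add_pow R j (z [^] j \<otimes> e)) \<otimes> (z \<oplus> e)" by (simp only: Suc)
  also have "\<dots> = z \<otimes> z [^] j \<otimes> z \<oplus> (add_pow R j (z [^] j \<otimes> e \<otimes> z) \<oplus> z \<otimes> z [^] j \<otimes> e)
      \<oplus> add_pow R j (z [^] j \<otimes> (e \<otimes> e))"
    by (simp add: r_distr l_distr add_pow_ldistr a_ac m_assoc)
  also have "z [^] j \<otimes> e \<otimes> z = z [^] Suc j \<otimes> e" by (simp add: m_ac)
  also have "z \<otimes> z [^] j \<otimes> e = z [^] Suc j \<otimes> e" by (simp add: m_ac)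
  also have "z \<otimes> z [^] j \<otimes> z = z \<otimes> z [^] Suc j" by (simp add: m_assoc)
  finally show ?case by (simp add: e)
qed simp

text \<open>Multiplying by \<open>v\<^sup>q\<close> avoids a shift of the coefficients of the derivative.\<close>

lemma first_order_peval:
  assumes c: "c \<in> UNIV \<rightarrow> carrier R" "\<And>i. \<not> q dvd i \<Longrightarrow> c i = \<zero>"
    and [simp]: "v \<in> carrier R" "w \<in> carrier R" "e \<in> carrier R"
    and q: "0 < q" and w: "w [^] (q::nat) = v [^] q \<oplus> e" and e: "e \<otimes> e = \<zero>"
  shows "v [^] q \<otimes> peval R n c w = v [^] q \<otimes> peval R n c v \<oplus> peval R n (\<lambda>i. add_pow R (i div q) (c i)) v \<otimes> e"
proof (induction n)
  case (Suc n)
  have ci [simp]: "c i \<in> carrier R" for i using c by auto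
  let ?d = "\<lambda>i. add_pow R (i div q) (c i)"
  have d: "?d \<in> UNIV \<rightarrow> carrier R" by simp
  have pc [simp]: "peval R n c w \<in> carrier R" "peval R n c v \<in> carrier R" "peval R n ?d v \<in> carrier R"
    using c(1) d by (auto intro!: peval_closed)
  \<comment> \<open>A term with \<open>n = q j\<close> is a power of \<open>w^q = v^q + e\<close>,
    and all other terms vanish; the factor \<open>j\<close> is that of the derivative with respect
    to \<open>T^q\<close>.\<close>
  have *: "v [^] q \<otimes> (c n \<otimes> w [^] n) = v [^] q \<otimes> (c n \<otimes> v [^] n) \<oplus> ?d n \<otimes> v [^] n \<otimes> e"
  proof (cases "q dvd n")
    case False
    thus ?thesis using c(2)[OF False] by simp
  next
    case True
    then obtain j where j: "n = q * j" by blast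
    have div: "?d n = add_pow R j (c n)"
      using q by (simp add: j)
    have "v [^] q \<otimes> w [^] n = v [^] q \<otimes> v [^] n \<oplus> add_pow R j (v [^] n \<otimes> e)"
      using first_order_power[of "v [^] q" e j] w e by (simp add: j nat_pow_pow[symmetric])
    hence "c n \<otimes> (v [^] q \<otimes> w [^] n) = c n \<otimes> (v [^] q \<otimes> v [^] n) \<oplus> c n \<otimes> add_pow R j (v [^] n \<otimes> e)"
      by (simp add: r_distr)
    thus ?thesis by (simp add: div m_lcomm[of "c n"] add_pow_ldistr add_pow_rdistr m_assoc)
  qed
  have "v [^] q \<otimes> peval R (Suc n) c w = v [^] q \<otimes> (c n \<otimes> w [^] n) \<oplus> v [^] q \<otimes> peval R n c w"
    using c(1) by (simp add: peval_Suc r_distr)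
  also have "\<dots> = (v [^] q \<otimes> (c n \<otimes> v [^] n) \<oplus> v [^] q \<otimes> peval R n c v) \<oplus> (?d n \<otimes> v [^] n \<oplus> peval R n ?d v) \<otimes> e"
    unfolding * Suc by (simp add: l_distr a_ac)
  also have "v [^] q \<otimes> (c n \<otimes> v [^] n) \<oplus> v [^] q \<otimes> peval R n c v = v [^] q \<otimes> peval R (Suc n) c v"
    using c(1) by (simp add: peval_Suc r_distr)
  also have "?d n \<otimes> v [^] n \<oplus> peval R n ?d v = peval R (Suc n) ?d v"
    using d by (simp add: peval_Suc)
  finally show ?case .
qed simp

end

lemma ring_hom_add_pow:
  assumes "cring R" "cring S" "f \<in> ring_hom R S" "x \<in> carrier R"
  shows "f (add_pow R (n::nat) x) = add_pow S n (f x)"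
proof (induction n)
  case 0
  interpret R: cring R by fact
  interpret S: cring S by fact
  show ?case using ring_hom_zero'[OF assms(1-3)] by simp
next
  case (Suc n)
  interpret R: cring R by fact
  interpret S: cring S by fact
  show ?case using Suc assms(4) by (simp add: R.add.nat_pow_Suc S.add.nat_pow_Suc ring_hom_add[OF assms(3)])
qed

lemma ring_hom_char:
  assumes "cring R" "cring S" "f \<in> ring_hom R S" "add_pow R (p::nat) \<one>\<^bsub>R\<^esub> = \<zero>\<^bsub>R\<^esub>"
  shows "add_pow S p \<one>\<^bsub>S\<^esub> = \<zero>\<^bsub>S\<^esub>"
proof -
  interpret R: cring R by fact
  show ?thesis
    using ring_hom_add_pow[OF assms(1-3) R.one_closed, of p] ring_hom_one[OF assms(3)]
      ring_hom_zero'[OF assms(1-3)] assms(4) by simp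
qed

section \<open>Formal group laws on nilpotent points\<close>

definition pts :: "('u alg \<Rightarrow> 'u \<Rightarrow> 'u \<Rightarrow> 'u) \<Rightarrow> 'u alg \<Rightarrow> 'u monoid" where
  "pts mul R = \<lparr>carrier = Spf_power_series R, monoid.mult = mul R, monoid.one = \<zero>\<^bsub>fst R\<^esub>\<rparr>"

lemma pts_simps [simp]:
  "carrier (pts mul R) = Spf_power_series R" "x \<otimes>\<^bsub>pts mul R\<^esub> y = mul R x y"
  "\<one>\<^bsub>pts mul R\<^esub> = \<zero>\<^bsub>fst R\<^esub>"
  by (simp_all add: pts_def)

text \<open>A formal Lie group with a global coordinate, the group law being transported to the points
  of \<open>Spf A[[T]]\<close>.\<close>

locale formal_group_law =
  fixes A :: "'u ring" and mul :: "'u alg \<Rightarrow> 'u \<Rightarrow> 'u \<Rightarrow> 'u"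
  assumes inf: "infinite (UNIV :: 'u set)"
    and cring_base: "cring A"
    and group_pts: "R \<in> algs A \<Longrightarrow> comm_group (pts mul R)"
    and mul_natural: "R \<in> algs A \<Longrightarrow> T \<in> algs A \<Longrightarrow> f \<in> alg_hom A R T \<Longrightarrow>
      x \<in> Spf_power_series R \<Longrightarrow> y \<in> Spf_power_series R \<Longrightarrow> f (mul R x y) = mul T (f x) (f y)"

lemma restrict_scalars_Spf [simp]:
  "Spf_power_series (restrict_scalars A f R) = Spf_power_series R"
  by (simp add: Spf_power_series_def)

lemma restrict_scalars_nil_le [simp]: "nil_le n (restrict_scalars A f R) = nil_le n R"
  by (simp add: nil_le_def)

definition base_change_law ::
  "'u ring \<Rightarrow> ('u \<Rightarrow> 'u) \<Rightarrow> ('u alg \<Rightarrow> 'u \<Rightarrow> 'u \<Rightarrow> 'u) \<Rightarrow> ('u alg \<Rightarrow> 'u \<Rightarrow> 'u \<Rightarrow> 'u)" where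
  "base_change_law A f mul R = mul (restrict_scalars A f R)"

lemma pts_base_change_law: "pts (base_change_law A f mul) R = pts mul (restrict_scalars A f R)"
  by (simp add: pts_def base_change_law_def)

lemma aeval_restrict_scalars:
  assumes "a \<in> UNIV \<rightarrow> carrier A"
  shows "aeval (restrict_scalars A f R) n a t = aeval R n (\<lambda>i. f (a i)) t"
proof -
  have "(\<lambda>i. snd (restrict_scalars A f R) (a i)) = (\<lambda>i. snd R (f (a i)))"
  proof
    fix i
    have "a i \<in> carrier A" using assms by auto
    thus "snd (restrict_scalars A f R) (a i) = snd R (f (a i))" by simp
  qed
  thus ?thesis by simp
qed

lemma represents_restrict_scalars:
  assumes "cring A" "f \<in> ring_hom A B" "represents A \<phi> a"
  shows "represents B (\<lambda>R. \<phi> (restrict_scalars A f R)) (\<lambda>i. f (a i))"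
  unfolding represents_def
proof (intro conjI ballI allI)
  note a = representsD(1)[OF assms(3)]
  show "(\<lambda>i. f (a i)) \<in> UNIV \<rightarrow> carrier B" using a ring_hom_closed[OF assms(2)] by auto
  fix R n t assume R: "R \<in> algs B" and t: "t \<in> nil_le n R"
  show "\<phi> (restrict_scalars A f R) t = aeval R n (\<lambda>i. f (a i)) t"
    using representsD(2)[OF assms(3) restrict_scalars_in_algs[OF assms(1) R assms(2)], of t n] t
      aeval_restrict_scalars[OF a, of f R n t] by simp
qed

text \<open>A homomorphism from \<open>R\<close> to \<open>S\<close> is the same as an
  \<open>R\<close>-algebra structure on \<open>S\<close>. Returning to \<open>A\<close> gives back
  literally \<open>S\<close>, because structure maps are extensional.\<close>

lemma restrict_scalars_over:
  assumes "R \<in> algs A" "S \<in> algs A" "g \<in> alg_hom A R S"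
  shows "(fst S, g) \<in> algs (fst R)" "restrict_scalars A (snd R) (fst S, g) = S"
proof -
  show "(fst S, g) \<in> algs (fst R)" using algsD(1)[OF assms(2)] alg_homD[OF assms(3)] by (intro algsI)
  have "snd (restrict_scalars A (snd R) (fst S, g)) = snd S"
    using alg_homD(3)[OF assms(3)] algsD(3)[OF assms(2)]
    by (auto simp: restrict_scalars_def compose_def fun_eq_iff extensional_def)
  thus "restrict_scalars A (snd R) (fst S, g) = S" by (simp add: prod_eq_iff)
qed

context formal_group_law
begin

lemma base_change:
  assumes "cring B" "f \<in> ring_hom A B"
  shows "formal_group_law B (base_change_law A f mul)"
proof (rule formal_group_law.intro)
  fix R assume "R \<in> algs B"
  thus "comm_group (pts (base_change_law A f mul) R)"
    using group_pts restrict_scalars_in_algs[OF cring_base _ assms(2)] by (simp add: pts_base_change_law)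
next
  fix R T g x y
  assume R: "R \<in> algs B" and T: "T \<in> algs B" and g: "g \<in> alg_hom B R T"
    and "x \<in> Spf_power_series R" "y \<in> Spf_power_series R"
  thus "g (base_change_law A f mul R x y) = base_change_law A f mul T (g x) (g y)"
    using mul_natural[OF restrict_scalars_in_algs[OF cring_base R assms(2)]
        restrict_scalars_in_algs[OF cring_base T assms(2)] restrict_scalars_alg_hom[OF g assms(2)]]
    by (simp add: base_change_law_def)
qed (use assms inf in auto)

lemma mul_closed:
  assumes "R \<in> algs A" "x \<in> Spf_power_series R" "y \<in> Spf_power_series R"
  shows "mul R x y \<in> Spf_power_series R"
proof -
  interpret comm_group "pts mul R" by (rule group_pts) fact
  show ?thesis using m_closed[of x y] assms by simp
qed

lemma mul_zero:
  assumes "R \<in> algs A" "x \<in> Spf_power_series R"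
  shows "mul R x \<zero>\<^bsub>fst R\<^esub> = x" "mul R \<zero>\<^bsub>fst R\<^esub> x = x"
proof -
  interpret comm_group "pts mul R" by (rule group_pts) fact
  show "mul R x \<zero>\<^bsub>fst R\<^esub> = x" "mul R \<zero>\<^bsub>fst R\<^esub> x = x"
    using r_one[of x] l_one[of x] assms by simp_all
qed

text \<open>Translation by a point. That the linear coefficient is \<open>1\<close> modulo \<open>x\<close> is seen over \<open>R/(x)\<close>,
  where the translation is the identity.\<close>

lemma translation_expansion:
  assumes R: "R \<in> algs A" and x: "x \<in> Spf_power_series R"
  obtains c d where "c \<in> UNIV \<rightarrow> alg_carrier R" "c 0 = x" "d \<in> alg_carrier R"
    "c 1 = \<one>\<^bsub>fst R\<^esub> \<oplus>\<^bsub>fst R\<^esub> x \<otimes>\<^bsub>fst R\<^esub> d"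
    "\<forall>S\<in>algs A. \<forall>g\<in>alg_hom A R S. \<forall>n. \<forall>y\<in>nil_le n S. mul S (g x) y = peval (fst S) n (\<lambda>i. g (c i)) y"
proof -
  interpret B: cring "fst R" using algsD(1)[OF R] .
  note B = algsD(1,2)[OF R]
  \<comment> \<open>The fixed point \<open>x\<close> is carried along by the structure map, so that
    translation by \<open>x\<close> becomes a natural map in one variable over the base
    \<open>fst R\<close>.\<close>
  define \<phi> where "\<phi> T y = mul (restrict_scalars A (snd R) T) (snd T x) y" for T y
  have xc: "x \<in> alg_carrier R" using x by (rule Spf_closed)
  have nx: "snd T x \<in> Spf_power_series T" if T: "T \<in> algs (fst R)" for T
  proof -
    obtain n where "x \<in> nil_le n R" using x by (rule SpfE)
    hence "x \<in> nil_le n (self_alg (fst R))" by (simp add: nil_le_def)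
    hence "snd T x \<in> nil_le n T"
      by (rule nil_le_hom[OF self_alg_in_algs[OF B(1)] T structure_alg_hom[OF T]])
    thus ?thesis by (rule nil_le_Spf)
  qed
  have rs: "restrict_scalars A (snd R) T \<in> algs A" if "T \<in> algs (fst R)" for T
    using restrict_scalars_in_algs[OF cring_base that B(2)] .
  have "natural_on (fst R) Spf_power_series \<phi>"
  proof (rule natural_onI)
    fix T t assume T: "T \<in> algs (fst R)" and t: "t \<in> Spf_power_series T"
    show "\<phi> T t \<in> alg_carrier T"
      using mul_closed[OF rs[OF T]] nx[OF T] t by (auto simp: \<phi>_def dest: Spf_closed)
    fix U f assume U: "U \<in> algs (fst R)" and f: "f \<in> alg_hom (fst R) T U"
    show "\<phi> U (f t) = f (\<phi> T t)"
      using mul_natural[OF rs[OF T] rs[OF U] restrict_scalars_alg_hom[OF f B(2)], of "snd T x" t]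
        nx[OF T] t alg_homD(3)[OF f xc] by (simp add: \<phi>_def)
  qed
  then obtain c where c: "represents (fst R) \<phi> c"
    using natural_expansion[OF inf B(1)] by blast
  note cc = representsD(1)[OF c]
  have exp: "mul S (g x) y = peval (fst S) n (\<lambda>i. g (c i)) y"
    if S: "S \<in> algs A" and g: "g \<in> alg_hom A R S" and y: "y \<in> nil_le n S" for S g y n
    using representsD(2)[OF c restrict_scalars_over(1)[OF R S g], of y n] y
      restrict_scalars_over(2)[OF R S g] by (simp add: \<phi>_def nil_le_def)
  have c0: "c 0 = x"
  proof -
    let ?i = "\<lambda>r\<in>alg_carrier R. r"
    have i: "?i \<in> alg_hom A R R"
      by (rule identity_alg_hom[OF R])
    have "c i \<in> alg_carrier R" for i using cc by auto
    hence "(\<lambda>i. ?i (c i)) = c" by simp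
    hence "mul R x \<zero>\<^bsub>fst R\<^esub> = c 0"
      using exp[OF R i zero_nil_le(1)[OF R, of 0]] xc B.peval_1[OF cc B.zero_closed] by simp
    thus ?thesis using mul_zero[OF R x] by simp
  qed
  obtain Q :: "'u ring" and q where Q: "cring Q" "q \<in> ring_hom (fst R) Q" "q \<in> extensional (alg_carrier R)"
    "q ` alg_carrier R = carrier Q" "\<forall>r\<in>alg_carrier R. q r = \<zero>\<^bsub>Q\<^esub> \<longleftrightarrow> r \<in> PIdl\<^bsub>fst R\<^esub> x"
    using ex_quotient[OF B(1) B.cgenideal_ideal[OF xc]] .
  interpret Q: cring Q by fact
  have Qalg: "(Q, q) \<in> algs (fst R)" using Q by (intro algsI)
  have qx: "q x = \<zero>\<^bsub>Q\<^esub>" using Q(5) xc B.cgenideal_self[OF xc] by simp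
  have qc: "(\<lambda>i. q (c i)) \<in> UNIV \<rightarrow> carrier Q" using cc ring_hom_closed[OF Q(2)] by auto
  \<comment> \<open>\<open>?e\<close> is the series of the identity. Points of square zero suffice
    to see the linear coefficient, hence the truncation at \<open>2\<close> below.\<close>
  let ?e = "\<lambda>i::nat. if i = 1 then \<one>\<^bsub>Q\<^esub> else \<zero>\<^bsub>Q\<^esub>"
  have ec: "?e \<in> UNIV \<rightarrow> carrier Q" by auto
  have "aeval T 2 (\<lambda>i. q (c i)) y = aeval T 2 ?e y" if T: "T \<in> algs Q" and y: "y \<in> nil_le 2 T" for T y
  proof -
    interpret T: cring "fst T" using algsD(1)[OF T] .
    define T' where "T' = restrict_scalars (fst R) q T"
    have T': "T' \<in> algs (fst R)" unfolding T'_def by (rule restrict_scalars_in_algs[OF B(1) T Q(2)])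
    have 0: "snd T \<zero>\<^bsub>Q\<^esub> = \<zero>\<^bsub>fst T\<^esub>" by (rule ring_hom_zero'[OF Q(1) algsD(1,2)[OF T]])
    have yc: "y \<in> alg_carrier T" and ys: "y \<in> Spf_power_series T"
      using nil_leD(1)[OF y] nil_le_Spf[OF y] .
    have "y = mul (restrict_scalars A (snd R) T') \<zero>\<^bsub>fst T\<^esub> y"
      using mul_zero(2)[OF rs[OF T'], of y] ys by (simp add: T'_def)
    also have "\<dots> = \<phi> T' y" using xc qx 0 by (simp add: \<phi>_def T'_def)
    also have "\<dots> = aeval T 2 (\<lambda>i. q (c i)) y"
      using representsD(2)[OF c T', of y 2] y aeval_restrict_scalars[OF cc, of q T] by (simp add: T'_def)
    finally have "aeval T 2 (\<lambda>i. q (c i)) y = y" by simp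
    moreover have "(\<lambda>i. snd T (?e i)) = (\<lambda>i. if i = 1 then \<one>\<^bsub>fst T\<^esub> else \<zero>\<^bsub>fst T\<^esub>)"
      using 0 ring_hom_one[OF algsD(2)[OF T]] by auto
    hence "aeval T 2 ?e y = y"
      using T.peval_single[OF T.one_closed yc, of 1 2] yc by simp
    ultimately show ?thesis by simp
  qed
  from expansion_unique[OF inf Q(1) qc ec this, of 1] have q1: "q (c 1) = \<one>\<^bsub>Q\<^esub>" by simp
  have c1: "c 1 \<in> alg_carrier R" using cc by auto
  have "q (c 1 \<ominus>\<^bsub>fst R\<^esub> \<one>\<^bsub>fst R\<^esub>) = \<zero>\<^bsub>Q\<^esub>"
  proof -
    interpret q: ring_hom_cring "fst R" Q q
      using B(1) Q by (simp add: ring_hom_cring_def ring_hom_cring_axioms_def)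
    show ?thesis using c1 q1 by (simp add: B.minus_eq Q.r_neg)
  qed
  hence "c 1 \<ominus>\<^bsub>fst R\<^esub> \<one>\<^bsub>fst R\<^esub> \<in> PIdl\<^bsub>fst R\<^esub> x" using Q(5) c1 by simp
  then obtain d where d: "d \<in> alg_carrier R" "c 1 \<ominus>\<^bsub>fst R\<^esub> \<one>\<^bsub>fst R\<^esub> = d \<otimes>\<^bsub>fst R\<^esub> x"
    by (auto simp: cgenideal_def)
  have "c 1 = \<one>\<^bsub>fst R\<^esub> \<oplus>\<^bsub>fst R\<^esub> (c 1 \<ominus>\<^bsub>fst R\<^esub> \<one>\<^bsub>fst R\<^esub>)"
    using c1 B.a_lcomm[OF B.one_closed c1, of "\<ominus>\<^bsub>fst R\<^esub> \<one>\<^bsub>fst R\<^esub>"] B.r_neg[OF B.one_closed]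
    unfolding B.minus_eq by simp
  also have "\<dots> = \<one>\<^bsub>fst R\<^esub> \<oplus>\<^bsub>fst R\<^esub> x \<otimes>\<^bsub>fst R\<^esub> d" using d xc by (simp add: B.m_comm)
  finally have "c 1 = \<one>\<^bsub>fst R\<^esub> \<oplus>\<^bsub>fst R\<^esub> x \<otimes>\<^bsub>fst R\<^esub> d" .
  from that[OF cc c0 d(1) this] exp show thesis by simp
qed

text \<open>As \<open>y^2 = 0\<close>, the translation by \<open>x\<close> stops at its linear term;
  as \<open>x y = 0\<close>, the correction \<open>x d\<close> in the linear coefficient contributes
  nothing.\<close>

lemma mul_tangent:
  assumes R: "R \<in> algs A" and x: "x \<in> Spf_power_series R" and y: "y \<in> nil_le 2 R"
    and xy: "x \<otimes>\<^bsub>fst R\<^esub> y = \<zero>\<^bsub>fst R\<^esub>"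
  shows "mul R x y = x \<oplus>\<^bsub>fst R\<^esub> y"
proof -
  interpret cring "fst R" using algsD(1)[OF R] .
  obtain c d where c: "c \<in> UNIV \<rightarrow> alg_carrier R" "c 0 = x" "d \<in> alg_carrier R"
    "c 1 = \<one>\<^bsub>fst R\<^esub> \<oplus>\<^bsub>fst R\<^esub> x \<otimes>\<^bsub>fst R\<^esub> d"
    "\<forall>S\<in>algs A. \<forall>g\<in>alg_hom A R S. \<forall>n. \<forall>y\<in>nil_le n S. mul S (g x) y = peval (fst S) n (\<lambda>i. g (c i)) y"
    using translation_expansion[OF R x] .
  let ?i = "\<lambda>r\<in>alg_carrier R. r"
  have i: "?i \<in> alg_hom A R R"
    by (rule identity_alg_hom[OF R])
  have "c i \<in> alg_carrier R" for i using c(1) by auto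
  hence ic: "(\<lambda>i. ?i (c i)) = c" by simp
  note [simp] = Spf_closed[OF x] nil_leD(1)[OF y]
  have "mul R x y = peval (fst R) (Suc (Suc 0)) c y"
    using bspec[OF bspec[OF c(5) R] i] y unfolding ic by (simp add: numeral_2_eq_2)
  also have "\<dots> = c 1 \<otimes>\<^bsub>fst R\<^esub> y \<oplus>\<^bsub>fst R\<^esub> x"
    using c(1) by (subst peval_Suc; (subst peval_Suc)?) (simp_all add: c(2))
  also have "c 1 \<otimes>\<^bsub>fst R\<^esub> y = y \<oplus>\<^bsub>fst R\<^esub> d \<otimes>\<^bsub>fst R\<^esub> (x \<otimes>\<^bsub>fst R\<^esub> y)"
    using c(3) unfolding c(4) by (simp add: l_distr r_distr m_ac)
  finally show ?thesis using xy c(3) by (simp add: a_comm)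
qed

section \<open>Multiplication by n as a power series\<close>

definition mult_by :: "nat \<Rightarrow> 'u alg \<Rightarrow> 'u \<Rightarrow> 'u" where
  "mult_by n R x = x [^]\<^bsub>pts mul R\<^esub> n"

lemma mult_by_closed:
  assumes "R \<in> algs A" "x \<in> Spf_power_series R"
  shows "mult_by n R x \<in> Spf_power_series R"
proof -
  interpret comm_group "pts mul R" by (rule group_pts) fact
  show ?thesis unfolding mult_by_def using nat_pow_closed[of x n] assms by simp
qed

lemma mult_by_0: "mult_by 0 R x = \<zero>\<^bsub>fst R\<^esub>"
  by (simp add: mult_by_def nat_pow_def)

lemma mult_by_Suc: "mult_by (Suc n) R x = mul R (mult_by n R x) x"
  by (simp add: mult_by_def nat_pow_def)

lemma mult_by_natural:
  assumes "R \<in> algs A" "T \<in> algs A" "f \<in> alg_hom A R T" "x \<in> Spf_power_series R"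
  shows "mult_by n T (f x) = f (mult_by n R x)"
proof (induction n)
  case 0
  show ?case
    using ring_hom_zero'[OF algsD(1)[OF assms(1)] algsD(1)[OF assms(2)] alg_homD(1)[OF assms(3)]]
    by (simp add: mult_by_0)
next
  case (Suc n)
  thus ?case using mul_natural[OF assms(1-3) mult_by_closed[OF assms(1,4)] assms(4)]
    by (simp add: mult_by_Suc)
qed

lemma mult_by_mul:
  assumes "R \<in> algs A" "x \<in> Spf_power_series R" "y \<in> Spf_power_series R"
  shows "mult_by n R (mul R x y) = mul R (mult_by n R x) (mult_by n R y)"
proof -
  interpret comm_group "pts mul R" by (rule group_pts) fact
  show ?thesis using nat_pow_distrib[of x y n] assms by (simp add: mult_by_def)
qed

lemma mult_by_zero:
  assumes "R \<in> algs A"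
  shows "mult_by n R \<zero>\<^bsub>fst R\<^esub> = \<zero>\<^bsub>fst R\<^esub>"
proof -
  interpret comm_group "pts mul R" by (rule group_pts) fact
  show ?thesis using nat_pow_one[of n] by (simp add: mult_by_def)
qed

lemma mult_by_expansion:
  obtains a where "represents A (mult_by n) a"
  by (rule natural_expansion[OF inf cring_base, of "mult_by n"], rule natural_onI)
    (auto intro: Spf_closed[OF mult_by_closed] mult_by_natural)

text \<open>The partial result is a multiple of \<open>x\<close>, so its product with
  \<open>x\<close> vanishes along with \<open>x^2\<close> and the tangent formula applies again at
  each step.\<close>

lemma mult_by_tangent:
  assumes R: "R \<in> algs A" and x: "x \<in> nil_le 2 R"
  shows "mult_by n R x = add_pow (fst R) n x"
proof (induction n)
  case 0
  interpret cring "fst R" using algsD(1)[OF R] .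
  show ?case by (simp add: mult_by_0)
next
  case (Suc n)
  interpret cring "fst R" using algsD(1)[OF R] .
  note [simp] = nil_leD(1)[OF x]
  have "x \<otimes>\<^bsub>fst R\<^esub> x = \<zero>\<^bsub>fst R\<^esub>" using nil_leD(2)[OF x] by (simp add: numeral_2_eq_2)
  hence "add_pow (fst R) n x \<otimes>\<^bsub>fst R\<^esub> x = \<zero>\<^bsub>fst R\<^esub>" by (simp add: add_pow_ldistr)
  thus ?case
    using mul_tangent[OF R mult_by_closed[OF R nil_le_Spf[OF x], of n] x] Suc
    by (simp add: mult_by_Suc)
qed

lemma expansion_zero:
  assumes "represents A \<phi> a" "\<phi> (self_alg A) \<zero>\<^bsub>A\<^esub> = \<zero>\<^bsub>A\<^esub>"
  shows "a 0 = \<zero>\<^bsub>A\<^esub>"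
proof -
  interpret cring A by (rule cring_base)
  note a = representsD(1)[OF assms(1)]
  have "a i \<in> carrier A" for i using a by auto
  hence "(\<lambda>i. snd (self_alg A) (a i)) = a" by simp
  thus ?thesis
    using representsD(2)[OF assms(1) self_alg_in_algs[OF cring_base], of "\<zero>\<^bsub>A\<^esub>" "Suc 0"] assms(2)
      zero_nil_le(1)[OF self_alg_in_algs[OF cring_base], of 0] peval_1[OF a zero_closed] by simp
qed

text \<open>At the generic point of square zero \<open>[n]\<close> is the \<open>n\<close>-fold sum,
  which exhibits its linear coefficient.\<close>

lemma mult_by_linear_coeff:
  assumes "represents A (mult_by n) a"
  shows "a 0 = \<zero>\<^bsub>A\<^esub>" "a 1 = add_pow A n \<one>\<^bsub>A\<^esub>"
proof -
  interpret A: cring A by (rule cring_base)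
  show a0: "a 0 = \<zero>\<^bsub>A\<^esub>"
    using mult_by_zero[OF self_alg_in_algs[OF cring_base]] by (intro expansion_zero[OF assms]) simp
  obtain P c Z where t: "is_trunc A 2 P c Z" using ex_trunc[OF inf cring_base] by blast
  note P = trunc_alg[OF t] and T = is_truncD[OF t]
  interpret P: cring P by fact
  have "peval P 2 (\<lambda>i. c (a i)) Z = add_pow P n Z"
    using representsD(2)[OF assms P] mult_by_tangent[OF P] by simp
  also have "\<dots> = c (add_pow A n \<one>\<^bsub>A\<^esub>) \<otimes>\<^bsub>P\<^esub> Z [^]\<^bsub>P\<^esub> (1::nat)"
    using ring_hom_add_pow[OF T(1-3), of "\<one>\<^bsub>A\<^esub>" n] ring_hom_one[OF T(3)] T(5)
    by (simp add: P.add_pow_ldistr)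
  finally show "a 1 = add_pow A n \<one>\<^bsub>A\<^esub>"
    using trunc_monomial_coeff[OF t representsD(1)[OF assms], of 1 "add_pow A n \<one>\<^bsub>A\<^esub>"] by simp
qed

text \<open>Let \<open>q = p^k\<close>, and let \<open>X\<close>, \<open>Y\<close> be generic points
  with \<open>Y^(2 q) = 0\<close>. Below degree \<open>2 q\<close> the series can only have the
  exponents \<open>0\<close> and \<open>q\<close>, and both coefficients vanish; so
  \<open>f(Y) = 0\<close>, and \<open>f\<close> takes the same value at \<open>X\<close> and at the
  group sum of \<open>X\<close> and \<open>Y\<close>. To first order in \<open>Y^q\<close> this
  kills the derivative of \<open>f\<close> with respect to \<open>T^q\<close>, up to a unit. Hence
  \<open>(i/q) a_i = 0\<close>, and \<open>i/q\<close> can be cancelled unless \<open>p\<close>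
  divides it.\<close>

lemma additive_expansion_step:
  assumes p: "Factorial_Ring.prime p" "add_pow A (p::nat) \<one>\<^bsub>A\<^esub> = \<zero>\<^bsub>A\<^esub>"
    and f: "represents A f a" "\<And>R t. R \<in> algs A \<Longrightarrow> t \<in> Spf_power_series R \<Longrightarrow> f R t \<in> Spf_power_series R"
      "\<And>R x y. R \<in> algs A \<Longrightarrow> x \<in> Spf_power_series R \<Longrightarrow> y \<in> Spf_power_series R \<Longrightarrow>
        f R (mul R x y) = mul R (f R x) (f R y)"
    and a: "\<And>i. \<not> p ^ k dvd i \<Longrightarrow> a i = \<zero>\<^bsub>A\<^esub>" "a 0 = \<zero>\<^bsub>A\<^esub>" "a (p ^ k) = \<zero>\<^bsub>A\<^esub>"
    and i: "\<not> p ^ Suc k dvd i"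
  shows "a i = \<zero>\<^bsub>A\<^esub>"
proof (cases "p ^ k dvd i")
  case False
  thus ?thesis by (rule a(1))
next
  case True
  note ac = representsD(1)[OF f(1)]
  define q where "q = p ^ k"
  \<comment> \<open>With \<open>M = i + 1\<close> the coefficient of index \<open>i\<close> is still
    visible in \<open>P\<close>.\<close>
  define M where "M = Suc i"
  have q: "0 < q" using p(1) prime_gt_0_nat by (simp add: q_def)
  interpret A: cring A by (rule cring_base)
  obtain P c X' where t: "is_trunc A M P c X'" using ex_trunc[OF inf cring_base] by blast
  note R = trunc_alg[OF t] and T = is_truncD[OF t]
  \<comment> \<open>The exponent \<open>2 q\<close> makes \<open>Y^q\<close> a first-order
    parameter: its square vanishes, yet its coefficient can still be read off.\<close>
  obtain P2 d Y where t2: "is_trunc P (2 * q) P2 d Y" using ex_trunc[OF inf T(2)] by blast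
  note S0 = trunc_alg[OF t2] and T2 = is_truncD[OF t2]
  interpret P: cring P by (rule T)
  interpret P2: cring P2 by (rule T2)
  define S where "S = restrict_scalars A c (P2, d)"
  have S: "S \<in> algs A" unfolding S_def by (rule restrict_scalars_in_algs[OF cring_base S0(1) T(3)])
  have fS: "fst S = P2" by (simp add: S_def)
  have d: "d \<in> alg_hom A (P, c) S"
    using structure_restrict_scalars[OF R(1), of P2 d] S0(1) by (simp add: S_def)
  have Y: "Y \<in> nil_le (2 * q) S" using S0(2) by (simp add: S_def)
  have X: "X' \<in> Spf_power_series (P, c)" by (rule nil_le_Spf[OF R(2)])
  have dX: "d X' \<in> nil_le M S" by (rule nil_le_hom[OF R(1) S d R(2)])
  obtain e u where e: "e \<in> UNIV \<rightarrow> carrier P" "e 0 = X'" "u \<in> carrier P" "e 1 = \<one>\<^bsub>P\<^esub> \<oplus>\<^bsub>P\<^esub> X' \<otimes>\<^bsub>P\<^esub> u"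
    "\<forall>S\<in>algs A. \<forall>g\<in>alg_hom A (P, c) S. \<forall>n. \<forall>y\<in>nil_le n S.
       mul S (g X') y = peval (fst S) n (\<lambda>i. g (e i)) y"
    using translation_expansion[OF R(1) X, unfolded fst_conv] .
  define w where "w = mul S (d X') Y"
  have ws: "w \<in> Spf_power_series S"
    unfolding w_def using mul_closed[OF S] nil_le_Spf[OF dX] nil_le_Spf[OF Y] by blast
  then obtain N0 where "w \<in> nil_le N0 S" by (rule SpfE)
  hence wN: "w \<in> nil_le (max N0 M) S" by (rule nil_le_mono[OF S]) simp
  \<comment> \<open>A common bound for \<open>w\<close> and \<open>d X'\<close>, so that
    \<open>f\<close> is evaluated at both points with the same cut.\<close>
  define N where "N = max N0 M"
  have wN: "w \<in> nil_le N S" using wN by (simp add: N_def)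
  have XN: "d X' \<in> nil_le N S" by (rule nil_le_mono[OF S dX]) (simp add: N_def)
  have [simp]: "w \<in> carrier P2" "d X' \<in> carrier P2" "Y \<in> carrier P2"
    using nil_leD(1)[OF wN] nil_leD(1)[OF XN] nil_leD(1)[OF Y] by (simp_all add: fS)
  have "f S Y = \<zero>\<^bsub>P2\<^esub>"
  proof -
    have "snd S (a j) = \<zero>\<^bsub>P2\<^esub>" if "j < 2 * q" for j
    proof -
      have "a j = \<zero>\<^bsub>A\<^esub>"
      proof (cases "q dvd j")
        case True
        then obtain r where "j = q * r" by blast
        moreover from this have "r < 2" using that q by simp
        ultimately show ?thesis using a(2,3) by (auto simp: q_def less_2_cases_iff)
      qed (use a(1) q_def in auto)
      thus ?thesis using ring_hom_zero'[OF cring_base algsD(1,2)[OF S]] fS by simp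
    qed
    hence "aeval S (2 * q) a Y = \<zero>\<^bsub>P2\<^esub>" unfolding fS by (intro P2.peval_zero_coeffs) auto
    thus ?thesis using representsD(2)[OF f(1) S Y] by simp
  qed
  hence "f S w = f S (d X')"
    using f(3)[OF S nil_le_Spf[OF dX] nil_le_Spf[OF Y]] mul_zero(1)[OF S f(2)[OF S nil_le_Spf[OF dX]]]
    by (simp add: w_def fS)
  hence fw: "aeval S N a w = aeval S N a (d X')"
    using representsD(2)[OF f(1) S wN] representsD(2)[OF f(1) S XN] by simp
  have de: "(\<lambda>i. d (e i)) \<in> UNIV \<rightarrow> carrier P2" using T2(7)[OF e(1)] .
  have charP: "add_pow P p \<one>\<^bsub>P\<^esub> = \<zero>\<^bsub>P\<^esub>" by (rule ring_hom_char[OF T(1-3) p(2)])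
  have charP2: "add_pow P2 p \<one>\<^bsub>P2\<^esub> = \<zero>\<^bsub>P2\<^esub>" by (rule ring_hom_char[OF T2(1-3) charP])
  \<comment> \<open>The partial derivative of the group law in its second argument, at the point
    with coordinates \<open>X'\<close> and \<open>0\<close>.\<close>
  define v where "v = e 1"
  define \<epsilon> where "\<epsilon> = d (v [^]\<^bsub>P\<^esub> q) \<otimes>\<^bsub>P2\<^esub> Y [^]\<^bsub>P2\<^esub> q"
  have e1: "v \<in> carrier P" using e(1) by (auto simp: v_def)
  have de1 [simp]: "d (v) \<in> carrier P2" using ring_hom_closed[OF T2(3) e1] .
  have dpow: "d (v [^]\<^bsub>P\<^esub> q) = d (v) [^]\<^bsub>P2\<^esub> q" by (rule ring_hom_nat_pow[OF T2(1-3) e1])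
  have \<epsilon>c [simp]: "\<epsilon> \<in> carrier P2" unfolding \<epsilon>_def dpow by simp
  have Y2: "(Y [^]\<^bsub>P2\<^esub> q) [^]\<^bsub>P2\<^esub> (2::nat) = \<zero>\<^bsub>P2\<^esub>"
    using nil_leD(2)[OF Y] by (simp add: fS P2.nat_pow_pow mult.commute)
  have "\<epsilon> \<otimes>\<^bsub>P2\<^esub> \<epsilon> = d (v) [^]\<^bsub>P2\<^esub> q \<otimes>\<^bsub>P2\<^esub> (d (v) [^]\<^bsub>P2\<^esub> q \<otimes>\<^bsub>P2\<^esub> (Y [^]\<^bsub>P2\<^esub> q \<otimes>\<^bsub>P2\<^esub> Y [^]\<^bsub>P2\<^esub> q))"
    unfolding \<epsilon>_def dpow by (simp add: P2.m_ac)
  also have "Y [^]\<^bsub>P2\<^esub> q \<otimes>\<^bsub>P2\<^esub> Y [^]\<^bsub>P2\<^esub> q = \<zero>\<^bsub>P2\<^esub>" using Y2 by (simp add: numeral_2_eq_2)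
  finally have \<epsilon>2: "\<epsilon> \<otimes>\<^bsub>P2\<^esub> \<epsilon> = \<zero>\<^bsub>P2\<^esub>" by simp
  \<comment> \<open>Frobenius makes \<open>w^q\<close> a polynomial in \<open>Y^q\<close>, which
    stops after the linear term.\<close>
  have wq: "w [^]\<^bsub>P2\<^esub> q = d X' [^]\<^bsub>P2\<^esub> q \<oplus>\<^bsub>P2\<^esub> \<epsilon>"
  proof -
    let ?g = "\<lambda>i. d (e i) [^]\<^bsub>P2\<^esub> q"
    have "d (e i) \<in> carrier P2" for i using de by auto
    hence g: "?g \<in> UNIV \<rightarrow> carrier P2" by simp
    have "w = peval P2 (2 * q) (\<lambda>i. d (e i)) Y"
      using bspec[OF bspec[OF e(5) S] d] Y by (simp add: w_def fS)
    hence "w [^]\<^bsub>P2\<^esub> q = peval P2 (2 * q) ?g (Y [^]\<^bsub>P2\<^esub> q)"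
      using P2.frobenius_peval[OF p(1) charP2 de, of Y "2 * q" k] by (simp add: q_def)
    also have "\<dots> = peval P2 2 ?g (Y [^]\<^bsub>P2\<^esub> q)"
      by (rule P2.peval_mono[OF g _ Y2]) (use q in auto)
    also have "\<dots> = d v [^]\<^bsub>P2\<^esub> q \<otimes>\<^bsub>P2\<^esub> Y [^]\<^bsub>P2\<^esub> q \<oplus>\<^bsub>P2\<^esub> d X' [^]\<^bsub>P2\<^esub> q"
      using P2.peval_Suc[OF g, of "Y [^]\<^bsub>P2\<^esub> q" "Suc 0"] P2.peval_1[OF g, of "Y [^]\<^bsub>P2\<^esub> q"]
      by (simp add: numeral_2_eq_2 v_def e(2))
    finally show ?thesis unfolding \<epsilon>_def dpow by (simp add: P2.a_comm)
  qed
  \<comment> \<open>The coefficients of \<open>T^q\<close> times the derivative with respect to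
    \<open>T^q\<close>, in the shape produced by \<open>first_order_peval\<close>.\<close>
  define b where "b j = add_pow A (j div q) (a j)" for j
  have aj: "a j \<in> carrier A" for j using ac by auto
  have b: "b \<in> UNIV \<rightarrow> carrier A" using aj by (simp add: b_def)
  have sa: "(\<lambda>j. snd S (a j)) \<in> UNIV \<rightarrow> carrier P2" using algsD(5)[OF S ac] by (simp add: fS)
  have sz: "snd S (a j) = \<zero>\<^bsub>P2\<^esub>" if "\<not> q dvd j" for j
    using a(1)[of j] that ring_hom_zero'[OF cring_base algsD(1,2)[OF S]] by (simp add: fS q_def)
  have sb: "(\<lambda>j. add_pow P2 (j div q) (snd S (a j))) = (\<lambda>j. snd S (b j))"
    using ring_hom_add_pow[OF cring_base algsD(1,2)[OF S] aj] by (simp add: b_def fS)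
  have "d X' [^]\<^bsub>P2\<^esub> q \<otimes>\<^bsub>P2\<^esub> aeval S N a w
      = d X' [^]\<^bsub>P2\<^esub> q \<otimes>\<^bsub>P2\<^esub> aeval S N a (d X') \<oplus>\<^bsub>P2\<^esub> aeval S N b (d X') \<otimes>\<^bsub>P2\<^esub> \<epsilon>"
    using P2.first_order_peval[OF sa sz _ _ _ q wq \<epsilon>2, of N] unfolding sb fS by simp
  moreover have cl: "aeval S N a (d X') \<in> carrier P2" "aeval S N b (d X') \<in> carrier P2"
    using aeval_closed[OF S ac, of "d X'" N] aeval_closed[OF S b, of "d X'" N] by (simp_all add: fS)
  ultimately have z: "aeval S N b (d X') \<otimes>\<^bsub>P2\<^esub> \<epsilon> = \<zero>\<^bsub>P2\<^esub>"
    unfolding fw by (simp add: P2.r_right_minus_eq)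
  define r where "r = peval P M (\<lambda>j. c (b j)) X'"
  have r: "r \<in> carrier P" unfolding r_def by (rule P.peval_closed[OF T(7)[OF b] T(5)])
  have "aeval S N b (d X') = d r"
    using aeval_eq[OF S b XN dX] aeval_hom[OF R(1) S d b, of X' M] T(5) by (simp add: r_def)
  hence "d (r \<otimes>\<^bsub>P\<^esub> v [^]\<^bsub>P\<^esub> q) \<otimes>\<^bsub>P2\<^esub> Y [^]\<^bsub>P2\<^esub> q = \<zero>\<^bsub>P2\<^esub>"
    using z r e1 ring_hom_closed[OF T2(3) r] unfolding \<epsilon>_def
    by (simp add: ring_hom_mult[OF T2(3)] dpow P2.m_assoc)
  hence re: "r \<otimes>\<^bsub>P\<^esub> v [^]\<^bsub>P\<^esub> q = \<zero>\<^bsub>P\<^esub>"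
    using trunc_monomial_zero[OF t2, of q "r \<otimes>\<^bsub>P\<^esub> v [^]\<^bsub>P\<^esub> q"] q r e1 by simp
  \<comment> \<open>The derivative of the translation is a unit: its \<open>p\<^sup>M\<close>-th power is \<open>1\<close>.\<close>
  have "v [^]\<^bsub>P\<^esub> (p ^ M) = \<one>\<^bsub>P\<^esub>"
  proof -
    have "M \<le> p ^ M" using p(1) prime_ge_2_nat[of p] less_exp[of M] power_mono[of 2 p M] by simp
    hence "X' [^]\<^bsub>P\<^esub> (p ^ M) = \<zero>\<^bsub>P\<^esub>" using P.nat_pow_zero_mono[OF T(5,6)] by simp
    thus ?thesis using e(3) T(5) P.frobenius_power_add[OF p(1) charP, of "\<one>\<^bsub>P\<^esub>" "X' \<otimes>\<^bsub>P\<^esub> u" M]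
      unfolding v_def e(4) by (simp add: P.nat_pow_distrib)
  qed
  hence "v [^]\<^bsub>P\<^esub> (q * p ^ M) = \<one>\<^bsub>P\<^esub>"
    using P.nat_pow_pow[OF e1, of "p ^ M" q] by (simp add: mult.commute)
  moreover have "v [^]\<^bsub>P\<^esub> (q * p ^ M) = v [^]\<^bsub>P\<^esub> q \<otimes>\<^bsub>P\<^esub> v [^]\<^bsub>P\<^esub> (q * p ^ M - q)"
  proof -
    have "q \<le> q * p ^ M" using prime_gt_0_nat[OF p(1)] by (simp add: Suc_le_eq)
    thus ?thesis using e1 by (simp add: P.nat_pow_mult)
  qed
  ultimately have "r = r \<otimes>\<^bsub>P\<^esub> (v [^]\<^bsub>P\<^esub> q \<otimes>\<^bsub>P\<^esub> v [^]\<^bsub>P\<^esub> (q * p ^ M - q))" using r by simp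
  also have "\<dots> = (r \<otimes>\<^bsub>P\<^esub> v [^]\<^bsub>P\<^esub> q) \<otimes>\<^bsub>P\<^esub> v [^]\<^bsub>P\<^esub> (q * p ^ M - q)"
    using r e1 by (simp add: P.m_assoc)
  also have "\<dots> = \<zero>\<^bsub>P\<^esub>" using e1 by (simp add: re)
  finally have "b i = \<zero>\<^bsub>A\<^esub>"
    using trunc_coeff_zero[OF t b, of i] by (simp add: r_def M_def)
  moreover have "\<not> p dvd i div q"
  proof
    assume "p dvd i div q"
    then obtain s where "i div q = p * s" by blast
    hence "i = q * (p * s)" using True by (metis dvd_mult_div_cancel q_def)
    thus False using i by (simp add: q_def mult.assoc mult.left_commute)
  qed
  ultimately show ?thesis
    using A.char_cancel_add_pow[OF p(2,1) _ aj] by (simp add: b_def)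
qed

text \<open>Each round gains a factor \<open>p\<close> in the common divisor of the exponents, and
  the only additional coefficient that must vanish for it is the one at \<open>p^k\<close>. So
  vanishing at powers of \<open>p\<close> spreads to all indices not divisible by
  \<open>p^h\<close>.\<close>

lemma mult_by_sparse:
  assumes p: "Factorial_Ring.prime p" "add_pow A (p::nat) \<one>\<^bsub>A\<^esub> = \<zero>\<^bsub>A\<^esub>"
    and a: "represents A (mult_by n) a" "\<And>k. k < h \<Longrightarrow> a (p ^ k) = \<zero>\<^bsub>A\<^esub>"
    and i: "\<not> p ^ h dvd i"
  shows "a i = \<zero>\<^bsub>A\<^esub>"
  using a(2) i
proof (induction h arbitrary: i)
  case (Suc h)
  show ?case
  proof (rule additive_expansion_step[OF p a(1), where k = h])
    show "a j = \<zero>\<^bsub>A\<^esub>" if "\<not> p ^ h dvd j" for j by (rule Suc.IH[OF _ that]) (simp add: Suc.prems(1))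
    show "a 0 = \<zero>\<^bsub>A\<^esub>" by (rule mult_by_linear_coeff(1)[OF a(1)])
    show "a (p ^ h) = \<zero>\<^bsub>A\<^esub>" by (rule Suc.prems(1)) simp
    show "\<not> p ^ Suc h dvd i" by (rule Suc.prems(2))
  qed (simp_all add: mult_by_closed mult_by_mul)
qed simp

end

section \<open>Coordinates and infinitesimal neighbourhoods\<close>

definition global_coordinate ::
  "'u ring \<Rightarrow> ('u, 'x) grp_functor \<Rightarrow> ('u alg \<Rightarrow> 'x \<Rightarrow> 'u) \<Rightarrow> bool" where
  "global_coordinate A G \<eta> \<longleftrightarrow>
     (\<forall>R\<in>algs A. bij_betw (\<eta> R) (carrier (sections G R)) (Spf_power_series R) \<and>
        \<eta> R \<one>\<^bsub>sections G R\<^esub> = \<zero>\<^bsub>fst R\<^esub>) \<and>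
     (\<forall>R\<in>algs A. \<forall>T\<in>algs A. \<forall>g\<in>alg_hom A R T.
        \<forall>x\<in>carrier (sections G R). \<eta> T (transition G R T g x) = g (\<eta> R x))"

definition coord_law ::
  "('u, 'x) grp_functor \<Rightarrow> ('u alg \<Rightarrow> 'x \<Rightarrow> 'u) \<Rightarrow> 'u alg \<Rightarrow> 'u \<Rightarrow> 'u \<Rightarrow> 'u" where
  "coord_law G \<eta> R s t = \<eta> R (inv_into (carrier (sections G R)) (\<eta> R) s
     \<otimes>\<^bsub>sections G R\<^esub> inv_into (carrier (sections G R)) (\<eta> R) t)"

locale coordinate_group =
  fixes A :: "'u ring" and G :: "('u, 'x) grp_functor" and \<eta> :: "'u alg \<Rightarrow> 'x \<Rightarrow> 'u"
  assumes inf: "infinite (UNIV :: 'u set)" and cring_base: "cring A"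
    and presheaf: "comm_group_presheaf A G" and sheaf: "fppf_sheaf A G"
    and coordinate: "global_coordinate A G \<eta>"
begin

lemma group_sections: "R \<in> algs A \<Longrightarrow> comm_group (sections G R)"
  using presheaf by (simp add: comm_group_presheaf_def)

lemma transition_hom:
  "R \<in> algs A \<Longrightarrow> T \<in> algs A \<Longrightarrow> f \<in> alg_hom A R T \<Longrightarrow>
     transition G R T f \<in> hom (sections G R) (sections G T)"
  using presheaf by (simp add: comm_group_presheaf_def)

lemma transition_closed:
  "R \<in> algs A \<Longrightarrow> T \<in> algs A \<Longrightarrow> f \<in> alg_hom A R T \<Longrightarrow> x \<in> carrier (sections G R) \<Longrightarrow>
     transition G R T f x \<in> carrier (sections G T)"
  using transition_hom[of R T f] by (auto simp: hom_def)

lemma transition_id: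
  assumes "R \<in> algs A" "x \<in> carrier (sections G R)"
  shows "transition G R R (\<lambda>r\<in>alg_carrier R. r) x = x"
  using presheaf assms unfolding comm_group_presheaf_def by simp

lemma transition_comp:
  assumes "R \<in> algs A" "T \<in> algs A" "U \<in> algs A" "f \<in> alg_hom A R T" "g \<in> alg_hom A T U"
    "x \<in> carrier (sections G R)"
  shows "transition G R U (compose (alg_carrier R) g f) x = transition G T U g (transition G R T f x)"
  using presheaf assms unfolding comm_group_presheaf_def by simp

lemma transition_one:
  assumes "R \<in> algs A" "T \<in> algs A" "f \<in> alg_hom A R T"
  shows "transition G R T f \<one>\<^bsub>sections G R\<^esub> = \<one>\<^bsub>sections G T\<^esub>"
  using hom_one[OF transition_hom[OF assms]] group_sections[OF assms(1)] group_sections[OF assms(2)]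
  by (simp add: comm_group_def)

lemma sheaf_glue:
  assumes "R \<in> algs A" "fppf_cover A R n C c" "\<forall>i<n. x i \<in> carrier (sections G (C i))"
    "\<forall>i<n. \<forall>j<n. \<forall>T\<in>algs A. \<forall>f\<in>alg_hom A (C i) T. \<forall>g\<in>alg_hom A (C j) T.
       (\<forall>r\<in>alg_carrier R. f (c i r) = g (c j r)) \<longrightarrow>
       transition G (C i) T f (x i) = transition G (C j) T g (x j)"
  shows "\<exists>!y. y \<in> carrier (sections G R) \<and> (\<forall>i<n. transition G R (C i) (c i) y = x i)"
  using sheaf[unfolded fppf_sheaf_def, THEN bspec, OF assms(1), THEN spec[of _ n], THEN spec[of _ C],
      THEN spec[of _ c], THEN spec[of _ x], THEN mp, OF conjI[OF assms(2) conjI[OF assms(3,4)]]] .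

lemma coord_bij: "R \<in> algs A \<Longrightarrow> bij_betw (\<eta> R) (carrier (sections G R)) (Spf_power_series R)"
  using coordinate by (simp add: global_coordinate_def)

lemma coord_closed: "R \<in> algs A \<Longrightarrow> x \<in> carrier (sections G R) \<Longrightarrow> \<eta> R x \<in> Spf_power_series R"
  using coord_bij bij_betwE by blast

lemma coord_inj:
  "R \<in> algs A \<Longrightarrow> x \<in> carrier (sections G R) \<Longrightarrow> y \<in> carrier (sections G R) \<Longrightarrow> \<eta> R x = \<eta> R y \<Longrightarrow> x = y"
  using coord_bij[of R] by (auto simp: bij_betw_def dest: inj_onD)

lemma coord_one: "R \<in> algs A \<Longrightarrow> \<eta> R \<one>\<^bsub>sections G R\<^esub> = \<zero>\<^bsub>fst R\<^esub>"
  using coordinate by (simp add: global_coordinate_def)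

lemma coord_natural:
  "R \<in> algs A \<Longrightarrow> T \<in> algs A \<Longrightarrow> g \<in> alg_hom A R T \<Longrightarrow> x \<in> carrier (sections G R) \<Longrightarrow>
     \<eta> T (transition G R T g x) = g (\<eta> R x)"
  using coordinate by (simp add: global_coordinate_def)

definition pt :: "'u alg \<Rightarrow> 'u \<Rightarrow> 'x" where
  "pt R = inv_into (carrier (sections G R)) (\<eta> R)"

lemma pt_closed: "R \<in> algs A \<Longrightarrow> t \<in> Spf_power_series R \<Longrightarrow> pt R t \<in> carrier (sections G R)"
  using coord_bij[of R] by (auto simp: pt_def bij_betw_def inv_into_into)

lemma coord_pt: "R \<in> algs A \<Longrightarrow> t \<in> Spf_power_series R \<Longrightarrow> \<eta> R (pt R t) = t"
  using coord_bij[of R] by (auto simp: pt_def bij_betw_def f_inv_into_f)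

lemma pt_coord: "R \<in> algs A \<Longrightarrow> x \<in> carrier (sections G R) \<Longrightarrow> pt R (\<eta> R x) = x"
  using coord_bij[of R] by (auto simp: pt_def bij_betw_def)

lemma coord_mult:
  assumes "R \<in> algs A" "x \<in> carrier (sections G R)" "y \<in> carrier (sections G R)"
  shows "\<eta> R (x \<otimes>\<^bsub>sections G R\<^esub> y) = coord_law G \<eta> R (\<eta> R x) (\<eta> R y)"
  using pt_coord[OF assms(1)] assms by (simp add: coord_law_def pt_def)

lemma coord_iso:
  assumes "R \<in> algs A"
  shows "\<eta> R \<in> iso (sections G R) (pts (coord_law G \<eta>) R)"
  using coord_bij[OF assms] coord_closed[OF assms] coord_mult[OF assms]
  by (auto simp: iso_def hom_def)

lemma formal_group_law: "formal_group_law A (coord_law G \<eta>)"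
proof (rule formal_group_law.intro)
  fix R assume R: "R \<in> algs A"
  have "comm_group ((pts (coord_law G \<eta>) R) \<lparr>one := \<eta> R \<one>\<^bsub>sections G R\<^esub>\<rparr>)"
    using comm_group.iso_imp_img_comm_group[OF group_sections[OF R] coord_iso[OF R]] .
  thus "comm_group (pts (coord_law G \<eta>) R)" by (simp add: pts_def coord_one[OF R])
next
  fix R T f s t
  assume R: "R \<in> algs A" and T: "T \<in> algs A" and f: "f \<in> alg_hom A R T"
    and s: "s \<in> Spf_power_series R" and t: "t \<in> Spf_power_series R"
  interpret R: comm_group "sections G R" by (rule group_sections[OF R])
  let ?x = "pt R s" and ?y = "pt R t" and ?f = "transition G R T f"
  note x = pt_closed[OF R s] pt_closed[OF R t]
  have "f (coord_law G \<eta> R s t) = f (\<eta> R (?x \<otimes>\<^bsub>sections G R\<^esub> ?y))"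
    by (simp add: coord_law_def pt_def)
  also have "\<dots> = \<eta> T (?f (?x \<otimes>\<^bsub>sections G R\<^esub> ?y))"
    using coord_natural[OF R T f] x by simp
  also have "?f (?x \<otimes>\<^bsub>sections G R\<^esub> ?y) = ?f ?x \<otimes>\<^bsub>sections G T\<^esub> ?f ?y"
    using transition_hom[OF R T f] x by (simp add: hom_mult)
  also have "\<eta> T \<dots> = coord_law G \<eta> T (f s) (f t)"
    using coord_mult[OF T] transition_closed[OF R T f] coord_natural[OF R T f] coord_pt[OF R] x s t by simp
  finally show "f (coord_law G \<eta> R s t) = coord_law G \<eta> T (f s) (f t)" .
qed (use inf cring_base in auto)

sublocale law: formal_group_law A "coord_law G \<eta>"
  by (rule formal_group_law)

lemma coord_pow:
  assumes "R \<in> algs A" "x \<in> carrier (sections G R)"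
  shows "\<eta> R (x [^]\<^bsub>sections G R\<^esub> (n::nat)) = law.mult_by n R (\<eta> R x)"
proof -
  interpret R: comm_group "sections G R" by (rule group_sections[OF assms(1)])
  show ?thesis
  proof (induction n)
    case 0
    show ?case using coord_one[OF assms(1)] by (simp add: law.mult_by_0)
  next
    case (Suc n)
    thus ?case using coord_mult[OF assms(1) _ assms(2), of "x [^]\<^bsub>sections G R\<^esub> n"] assms(2)
      by (simp add: law.mult_by_Suc)
  qed
qed

text \<open>The sheaf axiom is the delicate part. Gluing over \<open>A\<close> asks for
  compatibility on all common \<open>A\<close>-algebras of two members of the cover, whereas the
  given family is only known to be compatible on \<open>B\<close>-algebras.\<close>

lemma base_change_coordinate_group:
  assumes "cring B" "f \<in> ring_hom A B"
  shows "coordinate_group B (base_change A f G) (\<lambda>R. \<eta> (restrict_scalars A f R))"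
proof (rule coordinate_group.intro)
  note rs = restrict_scalars_in_algs[OF cring_base _ assms(2)]
  note rh = restrict_scalars_alg_hom[OF _ assms(2)]
  show "comm_group_presheaf B (base_change A f G)"
    unfolding comm_group_presheaf_def
  proof (intro conjI ballI)
    fix R assume R: "R \<in> algs B"
    show "comm_group (sections (base_change A f G) R)"
      using group_sections[OF rs[OF R]] by (simp add: base_change_def)
    show "transition (base_change A f G) R R (\<lambda>r\<in>alg_carrier R. r) x = x"
      if "x \<in> carrier (sections (base_change A f G) R)" for x
      using transition_id[OF rs[OF R]] that by (simp add: base_change_def)
    fix T g assume T: "T \<in> algs B" and g: "g \<in> alg_hom B R T"
    show "transition (base_change A f G) R T g \<in> hom (sections (base_change A f G) R) (sections (base_change A f G) T)"
      using transition_hom[OF rs[OF R] rs[OF T] rh[OF g]] by (simp add: base_change_def)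
    fix U h x assume U: "U \<in> algs B" and h: "h \<in> alg_hom B T U" and x: "x \<in> carrier (sections (base_change A f G) R)"
    have "x \<in> carrier (sections G (restrict_scalars A f R))" using x by (simp add: base_change_def)
    from transition_comp[OF rs[OF R] rs[OF T] rs[OF U] rh[OF g] rh[OF h] this]
    show "transition (base_change A f G) R U (compose (alg_carrier R) h g) x =
       transition (base_change A f G) T U h (transition (base_change A f G) R T g x)"
      by (simp add: base_change_def)
  qed
  show "fppf_sheaf B (base_change A f G)"
    unfolding fppf_sheaf_def
  proof (intro ballI allI impI, elim conjE)
    fix R n C c x
    assume R: "R \<in> algs B" and cov: "fppf_cover B R n C c"
      and x: "\<forall>i<n. x i \<in> carrier (sections (base_change A f G) (C i))"
      and comp: "\<forall>i<n. \<forall>j<n. \<forall>T\<in>algs B. \<forall>g\<in>alg_hom B (C i) T. \<forall>h\<in>alg_hom B (C j) T.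
           (\<forall>r\<in>alg_carrier R. g (c i r) = h (c j r)) \<longrightarrow>
           transition (base_change A f G) (C i) T g (x i) = transition (base_change A f G) (C j) T h (x j)"
    let ?r = "restrict_scalars A f"
    have C: "C i \<in> algs B" "c i \<in> alg_hom B R (C i)" if "i < n" for i
      using cov that by (auto simp: fppf_cover_def)
    have cov': "fppf_cover A (?r R) n (\<lambda>i. ?r (C i)) c"
      using cov rs rh by (simp add: fppf_cover_def)
    have comp': "transition G (?r (C i)) T g (x i) = transition G (?r (C j)) T h (x j)"
      if ij: "i < n" "j < n" and T: "T \<in> algs A" and g: "g \<in> alg_hom A (?r (C i)) T" and h: "h \<in> alg_hom A (?r (C j)) T"
        and gh: "\<forall>r\<in>alg_carrier R. g (c i r) = h (c j r)" for i j T g h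
    proof -
      \<comment> \<open>The two composites agree on \<open>R\<close>, so they put the same \<open>B\<close>-algebra structure on \<open>T\<close>.\<close>
      define s where "s = compose (carrier B) g (snd (C i))"
      define T' where "T' = (fst T, s)"
      have sg: "s b = g (snd (C i) b)" if "b \<in> carrier B" for b using that by (simp add: s_def compose_eq)
      have sh: "s b = h (snd (C j) b)" if b: "b \<in> carrier B" for b
      proof -
        have "g (c i (snd R b)) = h (c j (snd R b))" using gh algsD(4)[OF R b] by blast
        thus ?thesis using alg_homD(3)[OF C(2)[OF ij(1)] b] alg_homD(3)[OF C(2)[OF ij(2)] b] sg[OF b] by simp
      qed
      have "g \<circ> snd (C i) \<in> ring_hom B (fst T)"
        using ring_hom_trans[OF algsD(2)[OF C(1)[OF ij(1)]]] alg_homD(1)[OF g] by simp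
      hence "s \<in> ring_hom B (fst T)" by (rule ring_hom_cong[OF assms(1)]) (simp add: sg)
      hence T': "T' \<in> algs B" unfolding T'_def using algsD(1)[OF T] by (intro algsI) (simp_all add: s_def)
      have rT: "?r T' = T"
      proof -
        have "snd (?r T') a = snd T a" for a
        proof (cases "a \<in> carrier A")
          case True
          thus ?thesis using alg_homD(3)[OF g True] ring_hom_closed[OF assms(2) True]
            by (simp add: T'_def sg)
        next
          case False
          thus ?thesis using algsD(3)[OF T]
            by (simp add: restrict_scalars_def compose_def extensional_def)
        qed
        thus ?thesis by (auto simp: T'_def prod_eq_iff)
      qed
      have "g \<in> alg_hom B (C i) T'" "h \<in> alg_hom B (C j) T'"
        using alg_homD(1,2)[OF g] alg_homD(1,2)[OF h] sg sh by (auto intro!: alg_homI simp: T'_def)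
      moreover have bt: "transition (base_change A f G) U V = transition G (?r U) (?r V)" for U V
        by (simp add: base_change_def)
      ultimately have "transition G (?r (C i)) (?r T') g (x i) = transition G (?r (C j)) (?r T') h (x j)"
        using comp[unfolded bt] ij T' gh by blast
      thus ?thesis unfolding rT .
    qed
    have "\<exists>!y. y \<in> carrier (sections G (?r R)) \<and> (\<forall>i<n. transition G (?r R) (?r (C i)) (c i) y = x i)"
    proof (rule sheaf_glue[OF rs[OF R] cov'])
      show "\<forall>i<n. x i \<in> carrier (sections G (?r (C i)))" using x by (simp add: base_change_def)
    qed (intro allI impI ballI, rule comp', simp_all)
    thus "\<exists>!y. y \<in> carrier (sections (base_change A f G) R) \<and>
        (\<forall>i<n. transition (base_change A f G) R (C i) (c i) y = x i)"
      by (simp add: base_change_def)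
  qed
  show "global_coordinate B (base_change A f G) (\<lambda>R. \<eta> (restrict_scalars A f R))"
    unfolding global_coordinate_def
  proof (intro conjI ballI)
    fix R assume R: "R \<in> algs B"
    show "bij_betw (\<eta> (restrict_scalars A f R)) (carrier (sections (base_change A f G) R)) (Spf_power_series R)"
      using coord_bij[OF rs[OF R]] by (simp add: base_change_def)
    show "\<eta> (restrict_scalars A f R) \<one>\<^bsub>sections (base_change A f G) R\<^esub> = \<zero>\<^bsub>fst R\<^esub>"
      using coord_one[OF rs[OF R]] by (simp add: base_change_def)
    fix T g x assume T: "T \<in> algs B" and g: "g \<in> alg_hom B R T" and "x \<in> carrier (sections (base_change A f G) R)"
    thus "\<eta> (restrict_scalars A f T) (transition (base_change A f G) R T g x) = g (\<eta> (restrict_scalars A f R) x)"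
      using coord_natural[OF rs[OF R] rs[OF T] rh[OF g]] by (simp add: base_change_def)
  qed
qed (use inf assms in auto)

text \<open>A global coordinate is a local coordinate on the single principal open
  \<open>D(1)\<close>.\<close>

lemma formal_Lie_group: "formal_Lie_group A G"
proof -
  interpret A: cring A by (rule cring_base)
  have "genideal A {\<one>\<^bsub>A\<^esub>} = carrier A" by (simp add: A.genideal_one)
  moreover have D: "R \<in> algs A" if "R \<in> algs_over_D A \<one>\<^bsub>A\<^esub>" for R
    using that by (simp add: algs_over_D_def)
  have "\<forall>R\<in>algs_over_D A \<one>\<^bsub>A\<^esub>. \<forall>T\<in>algs_over_D A \<one>\<^bsub>A\<^esub>. \<forall>g\<in>alg_hom A R T.
      \<forall>x\<in>carrier (sections G R). \<eta> T (transition G R T g x) = g (\<eta> R x)"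
    using coord_natural D by blast
  moreover have "\<forall>R\<in>algs_over_D A \<one>\<^bsub>A\<^esub>. bij_betw (\<eta> R) (carrier (sections G R)) (Spf_power_series R) \<and>
      \<eta> R \<one>\<^bsub>sections G R\<^esub> = \<zero>\<^bsub>fst R\<^esub>"
    using coord_bij coord_one D by blast
  ultimately show ?thesis
    unfolding formal_Lie_group_def formal_Lie_variety_def
    using presheaf sheaf A.one_closed by (intro conjI exI[of _ "{\<one>\<^bsub>A\<^esub>}"] ballI exI[of _ \<eta>]) simp_all
qed

end

lemma coord_law_base_change:
  "coord_law (base_change A f G) (\<lambda>R. \<eta> (restrict_scalars A f R)) = base_change_law A f (coord_law G \<eta>)"
  by (intro ext) (simp add: coord_law_def base_change_law_def base_change_def)

section \<open>The identity as an fppf cover\<close>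

lemma linear_map_finsum:
  assumes "module R M" "module R N" "linear_map R M N f" "g \<in> {..<k} \<rightarrow> carrier M"
  shows "f (\<Oplus>\<^bsub>M\<^esub>i\<in>{..<k}. g i) = (\<Oplus>\<^bsub>N\<^esub>i\<in>{..<(k::nat)}. f (g i))"
proof -
  interpret M: module R M by fact
  interpret N: module R N by fact
  have fc: "f x \<in> carrier N" if "x \<in> carrier M" for x using assms(3) that by (auto simp: linear_map_def)
  have add: "f (x \<oplus>\<^bsub>M\<^esub> y) = f x \<oplus>\<^bsub>N\<^esub> f y" if "x \<in> carrier M" "y \<in> carrier M" for x y
    using assms(3) that by (auto simp: linear_map_def)
  show ?thesis using assms(4)
  proof (induction k)
    case 0
    have "f \<zero>\<^bsub>M\<^esub> \<oplus>\<^bsub>N\<^esub> f \<zero>\<^bsub>M\<^esub> = f \<zero>\<^bsub>M\<^esub>" using add[of "\<zero>\<^bsub>M\<^esub>" "\<zero>\<^bsub>M\<^esub>"] by simp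
    thus ?case using fc[of "\<zero>\<^bsub>M\<^esub>"] by simp
  next
    case (Suc k)
    have g: "g \<in> {..<k} \<rightarrow> carrier M" "g k \<in> carrier M" using Suc.prems by auto
    have fg: "(\<lambda>i. f (g i)) \<in> {..<k} \<rightarrow> carrier N" "f (g k) \<in> carrier N" using g fc by auto
    have "(\<Oplus>\<^bsub>M\<^esub>i\<in>{..<k}. g i) \<in> carrier M" using g by simp
    thus ?case using g fg Suc.IH[OF g(1)] add by (simp add: lessThan_Suc)
  qed
qed

text \<open>Scalar multiplication identifies the tensor product of \<open>N\<close> with
  \<open>R\<close> and \<open>N\<close> itself: the bilinear map into \<open>N'\<close> turns the
  hypothesis into a vanishing sum, injectivity of \<open>f\<close> moves it to \<open>N\<close>, and
  every bilinear map on \<open>N\<close> and \<open>R\<close> is a linear map applied to that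
  sum.\<close>

lemma flat_self:
  assumes "cring R"
  shows "flat_module R (alg_module (R, \<lambda>r\<in>carrier R. r))"
proof -
  let ?M = "alg_module (R, \<lambda>r\<in>carrier R. r)"
  have cM: "carrier ?M = carrier R" by (simp add: alg_module_def)
  interpret R: cring R by fact
  show ?thesis unfolding flat_module_def
  proof (intro allI impI, elim conjE)
    fix N N' f k x y
    assume N: "module R N" and N': "module R N'" and f: "linear_map R N N' f" and inj: "inj_on f (carrier N)"
      and x: "x \<in> {..<k} \<rightarrow> carrier N" and y: "y \<in> {..<k} \<rightarrow> carrier ?M"
      and z: "tensor_zero R N' ?M k (f \<circ> x) y"
    interpret N: module R N by fact
    interpret N': module R N' by fact
    have fc: "f u \<in> carrier N'" if "u \<in> carrier N" for u using f that by (auto simp: linear_map_def)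
    have xi: "x i \<in> carrier N" and yi: "y i \<in> carrier R" if "i < k" for i using x y that cM by auto
    have "bilinear_map R N' ?M N' (\<lambda>n r. r \<odot>\<^bsub>N'\<^esub> n)"
      unfolding bilinear_map_def linear_map_def
      by (auto simp: alg_module_def N'.smult_l_distr N'.smult_r_distr N'.smult_assoc1[symmetric] R.m_comm)
    hence 0: "(\<Oplus>\<^bsub>N'\<^esub>i\<in>{..<k}. y i \<odot>\<^bsub>N'\<^esub> f (x i)) = \<zero>\<^bsub>N'\<^esub>"
      using z N' by (auto simp: tensor_zero_def)
    have "f (\<Oplus>\<^bsub>N\<^esub>i\<in>{..<k}. y i \<odot>\<^bsub>N\<^esub> x i) = (\<Oplus>\<^bsub>N'\<^esub>i\<in>{..<k}. f (y i \<odot>\<^bsub>N\<^esub> x i))"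
      by (rule linear_map_finsum[OF N N' f]) (use xi yi in auto)
    also have "\<dots> = (\<Oplus>\<^bsub>N'\<^esub>i\<in>{..<k}. y i \<odot>\<^bsub>N'\<^esub> f (x i))"
      by (rule N'.finsum_cong') (use xi yi fc f in \<open>auto simp: linear_map_def\<close>)
    also have "\<dots> = f \<zero>\<^bsub>N\<^esub>" unfolding 0 using linear_map_finsum[OF N N' f, of "\<lambda>_. undefined" 0] by simp
    finally have s: "(\<Oplus>\<^bsub>N\<^esub>i\<in>{..<k}. y i \<odot>\<^bsub>N\<^esub> x i) = \<zero>\<^bsub>N\<^esub>"
      by (rule inj_onD[OF inj]) (use xi yi in \<open>auto intro!: N.finsum_closed\<close>)
    show "tensor_zero R N ?M k x y"
      unfolding tensor_zero_def
    proof (intro allI impI, elim conjE)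
      fix P b assume P: "module R P" and b: "bilinear_map R N ?M P b"
      interpret P: module R P by fact
      have b1: "linear_map R ?M P (b u)" if "u \<in> carrier N" for u using b that by (simp add: bilinear_map_def)
      have b2: "linear_map R N P (\<lambda>u. b u \<one>\<^bsub>R\<^esub>)" using b cM by (simp add: bilinear_map_def)
      have bc: "b u \<one>\<^bsub>R\<^esub> \<in> carrier P" if "u \<in> carrier N" for u using b2 that by (auto simp: linear_map_def)
      have eq: "b (x i) (y i) = b (y i \<odot>\<^bsub>N\<^esub> x i) \<one>\<^bsub>R\<^esub>" if i: "i < k" for i
      proof -
        have "b (x i) (y i \<odot>\<^bsub>?M\<^esub> \<one>\<^bsub>R\<^esub>) = y i \<odot>\<^bsub>P\<^esub> b (x i) \<one>\<^bsub>R\<^esub>"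
          using b1[OF xi[OF i]] yi[OF i] cM by (simp add: linear_map_def)
        moreover have "y i \<odot>\<^bsub>?M\<^esub> \<one>\<^bsub>R\<^esub> = y i" using yi[OF i] by (simp add: alg_module_def)
        moreover have "b (y i \<odot>\<^bsub>N\<^esub> x i) \<one>\<^bsub>R\<^esub> = y i \<odot>\<^bsub>P\<^esub> b (x i) \<one>\<^bsub>R\<^esub>"
          using b2 xi[OF i] yi[OF i] by (simp add: linear_map_def)
        ultimately show ?thesis by simp
      qed
      have "(\<Oplus>\<^bsub>P\<^esub>i\<in>{..<k}. b (x i) (y i)) = (\<Oplus>\<^bsub>P\<^esub>i\<in>{..<k}. b (y i \<odot>\<^bsub>N\<^esub> x i) \<one>\<^bsub>R\<^esub>)"
        by (rule P.finsum_cong') (use eq bc xi yi in auto)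
      also have "\<dots> = b (\<Oplus>\<^bsub>N\<^esub>i\<in>{..<k}. y i \<odot>\<^bsub>N\<^esub> x i) \<one>\<^bsub>R\<^esub>"
        by (rule linear_map_finsum[OF N P b2, symmetric]) (use xi yi in auto)
      also have "\<dots> = \<zero>\<^bsub>P\<^esub>" unfolding s using linear_map_finsum[OF N P b2, of "\<lambda>_. undefined" 0] by simp
      finally show "(\<Oplus>\<^bsub>P\<^esub>i\<in>{..<k}. b (x i) (y i)) = \<zero>\<^bsub>P\<^esub>" .
    qed
  qed
qed

lemma finitely_presented_self: "finitely_presented R (R, \<lambda>r\<in>carrier R. r)"
  unfolding finitely_presented_def
proof (intro exI[of _ "0::nat"] exI[of _ "{}"] exI conjI ballI allI impI)
  fix T assume T: "T \<in> algs R"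
  show "\<exists>!f. f \<in> alg_hom R (R, \<lambda>r\<in>carrier R. r) T \<and> (\<forall>i<0. f (b i) = t i)" for b t :: "nat \<Rightarrow> 'a"
  proof (rule ex1I[of _ "snd T"])
    show "snd T \<in> alg_hom R (R, \<lambda>r\<in>carrier R. r) T \<and> (\<forall>i<0. snd T (b i) = t i)"
      using algsD[OF T] by (auto intro!: alg_homI)
    fix f assume "f \<in> alg_hom R (R, \<lambda>r\<in>carrier R. r) T \<and> (\<forall>i<0. f (b i) = t i)"
    hence "f \<in> alg_hom R (R, \<lambda>r\<in>carrier R. r) T" by simp
    from alg_homD(2,3)[OF this] show "f = snd T" using algsD(3)[OF T]
      by (intro extensionalityI[of _ "carrier R"]) auto
  qed
qed (auto simp: solution_def)

text \<open>With this cover a section that is already pre-infinitesimal belongs to the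
  sheafification.\<close>

lemma identity_cover:
  assumes "R \<in> algs A"
  shows "fppf_cover A R 1 (\<lambda>_. R) (\<lambda>_. \<lambda>r\<in>alg_carrier R. r)"
proof -
  have i: "(\<lambda>r\<in>alg_carrier R. r) \<in> alg_hom A R R"
    by (rule identity_alg_hom[OF assms])
  have "P = {r \<in> alg_carrier R. (\<lambda>r\<in>alg_carrier R. r) r \<in> P}" if "primeideal P (fst R)" for P
  proof -
    interpret primeideal P "fst R" by fact
    show ?thesis using a_subset by auto
  qed
  thus ?thesis unfolding fppf_cover_def
    using assms i flat_self[OF algsD(1)[OF assms]] finitely_presented_self by auto
qed

section \<open>Infinitesimal neighbourhoods in a coordinate\<close>

lemma infinitesimalI:
  assumes "x \<in> carrier (sections G R)" "fppf_cover A R m C c"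
    "\<And>i. i < m \<Longrightarrow> transition G R (C i) (c i) x \<in> pre_infinitesimal A n G (C i)"
  shows "x \<in> infinitesimal A n G R"
  unfolding infinitesimal_def using assms by blast

lemma power_in_ideal_power:
  assumes "cring R" "t \<in> I" "I \<subseteq> carrier R"
  shows "t [^]\<^bsub>R\<^esub> n \<in> ideal_power R I n"
proof (induction n)
  case 0
  interpret cring R by fact
  show ?case by simp
next
  case (Suc n)
  interpret cring R by fact
  show ?case using ideal_prod.prod[OF Suc assms(2), of R] by simp
qed

lemma ideal_power_principal:
  assumes "cring R" "t \<in> carrier R" "x \<in> ideal_power R (PIdl\<^bsub>R\<^esub> t) n"
  shows "\<exists>s\<in>carrier R. x = t [^]\<^bsub>R\<^esub> n \<otimes>\<^bsub>R\<^esub> s"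
  using assms(3)
proof (induction n arbitrary: x)
  case 0
  interpret cring R by fact
  show ?case using 0 by auto
next
  case (Suc n)
  interpret cring R by fact
  from Suc.prems have "x \<in> ideal_prod R (ideal_power R (PIdl\<^bsub>R\<^esub> t) n) (PIdl\<^bsub>R\<^esub> t)" by simp
  thus ?case
  proof (induction rule: ideal_prod.induct)
    case (prod i j)
    obtain s where s: "s \<in> carrier R" "i = t [^]\<^bsub>R\<^esub> n \<otimes>\<^bsub>R\<^esub> s" using Suc.IH[OF prod(1)] by blast
    obtain r where r: "r \<in> carrier R" "j = r \<otimes>\<^bsub>R\<^esub> t" using prod(2) by (auto simp: cgenideal_def)
    have "i \<otimes>\<^bsub>R\<^esub> j = t [^]\<^bsub>R\<^esub> Suc n \<otimes>\<^bsub>R\<^esub> (s \<otimes>\<^bsub>R\<^esub> r)"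
      using s r assms(2) by (simp add: m_ac)
    thus ?case using s r by blast
  next
    case (sum u v)
    then obtain s r where s: "s \<in> carrier R" "u = t [^]\<^bsub>R\<^esub> Suc n \<otimes>\<^bsub>R\<^esub> s"
      and r: "r \<in> carrier R" "v = t [^]\<^bsub>R\<^esub> Suc n \<otimes>\<^bsub>R\<^esub> r" by blast
    have "u \<oplus>\<^bsub>R\<^esub> v = t [^]\<^bsub>R\<^esub> Suc n \<otimes>\<^bsub>R\<^esub> (s \<oplus>\<^bsub>R\<^esub> r)"
      using s r assms(2) by (simp add: r_distr del: nat_pow_Suc)
    thus ?case using s r by blast
  qed
qed

context coordinate_group
begin

text \<open>If \<open>x\<close> becomes trivial in a quotient, its coordinate lies in the kernel,
  whose power \<open>n + 1\<close> vanishes. Conversely the quotient by the principal ideal of the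
  coordinate trivialises \<open>x\<close>, and the power \<open>n + 1\<close> of that ideal consists
  of multiples of the same power of the generator.\<close>

lemma pre_infinitesimal_coord:
  assumes R: "R \<in> algs A" and x: "x \<in> carrier (sections G R)"
  shows "x \<in> pre_infinitesimal A n G R \<longleftrightarrow> \<eta> R x \<in> nil_le (n + 1) R"
proof
  interpret R: cring "fst R" using algsD(1)[OF R] .
  define t where "t = \<eta> R x"
  have t: "t \<in> alg_carrier R" unfolding t_def by (rule Spf_closed[OF coord_closed[OF R x]])
  {
    assume "x \<in> pre_infinitesimal A n G R"
    then obtain R' q where R': "R' \<in> algs A" and q: "q \<in> alg_hom A R R'"
      and I: "ideal_power (fst R) (a_kernel (fst R) (fst R') q) (n + 1) = {\<zero>\<^bsub>fst R\<^esub>}"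
      and e: "transition G R R' q x = \<one>\<^bsub>sections G R'\<^esub>"
      by (auto simp: pre_infinitesimal_def)
    have "q t = \<zero>\<^bsub>fst R'\<^esub>"
      using coord_natural[OF R R' q x] coord_one[OF R'] e by (simp add: t_def)
    hence "t \<in> a_kernel (fst R) (fst R') q" using t by (simp add: a_kernel_def')
    from power_in_ideal_power[OF R.is_cring this, of "n + 1"] I
    have "t [^]\<^bsub>fst R\<^esub> (n + 1) = \<zero>\<^bsub>fst R\<^esub>" by (auto simp: a_kernel_def')
    thus "\<eta> R x \<in> nil_le (n + 1) R" using t by (simp add: nil_le_def t_def)
  next
    assume n: "\<eta> R x \<in> nil_le (n + 1) R"
    obtain Q :: "'u ring" and q where Q: "cring Q" "q \<in> ring_hom (fst R) Q" "q \<in> extensional (alg_carrier R)"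
      "q ` alg_carrier R = carrier Q" "\<forall>r\<in>alg_carrier R. q r = \<zero>\<^bsub>Q\<^esub> \<longleftrightarrow> r \<in> PIdl\<^bsub>fst R\<^esub> t"
      using ex_quotient[OF R.is_cring R.cgenideal_ideal[OF t]] .
    have Qa: "(Q, q) \<in> algs (fst R)" using Q by (intro algsI)
    define R' where "R' = restrict_scalars A (snd R) (Q, q)"
    have R': "R' \<in> algs A" unfolding R'_def by (rule restrict_scalars_in_algs[OF cring_base Qa algsD(2)[OF R]])
    have q: "q \<in> alg_hom A R R'" unfolding R'_def by (rule structure_restrict_scalars[OF R Qa])
    have ker: "a_kernel (fst R) (fst R') q = PIdl\<^bsub>fst R\<^esub> t"
      using Q(5) ideal.Icarr[OF R.cgenideal_ideal[OF t]] by (auto simp: a_kernel_def' R'_def)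
    have "q t = \<zero>\<^bsub>Q\<^esub>" using Q(5) t R.cgenideal_self[OF t] by blast
    hence qx: "\<eta> R' (transition G R R' q x) = \<eta> R' \<one>\<^bsub>sections G R'\<^esub>"
      using coord_natural[OF R R' q x] coord_one[OF R'] by (simp add: t_def R'_def)
    interpret G': comm_group "sections G R'" by (rule group_sections[OF R'])
    from qx have e: "transition G R R' q x = \<one>\<^bsub>sections G R'\<^esub>"
      using coord_inj[OF R'] transition_closed[OF R R' q x] by simp
    have "ideal_power (fst R) (PIdl\<^bsub>fst R\<^esub> t) (n + 1) = {\<zero>\<^bsub>fst R\<^esub>}"
    proof (intro equalityI subsetI)
      fix y assume "y \<in> ideal_power (fst R) (PIdl\<^bsub>fst R\<^esub> t) (n + 1)"
      from ideal_power_principal[OF R.is_cring t this] obtain s where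
        "s \<in> alg_carrier R" "y = t [^]\<^bsub>fst R\<^esub> (n + 1) \<otimes>\<^bsub>fst R\<^esub> s" by blast
      thus "y \<in> {\<zero>\<^bsub>fst R\<^esub>}" using nil_leD(2)[OF n] unfolding t_def by simp
    next
      fix y assume "y \<in> {\<zero>\<^bsub>fst R\<^esub>}"
      thus "y \<in> ideal_power (fst R) (PIdl\<^bsub>fst R\<^esub> t) (n + 1)"
        using power_in_ideal_power[OF R.is_cring R.cgenideal_self[OF t], of "n + 1"]
          ideal.Icarr[OF R.cgenideal_ideal[OF t]] nil_leD(2)[OF n] by (auto simp: t_def)
    qed
    hence "ideal_power (fst R) (a_kernel (fst R) (fst R') q) (n + 1) = {\<zero>\<^bsub>fst R\<^esub>}" by (simp only: ker)
    moreover have "q ` alg_carrier R = alg_carrier R'" using Q(4) by (simp add: R'_def)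
    ultimately have "\<exists>R'\<in>algs A. \<exists>q\<in>alg_hom A R R'. q ` alg_carrier R = alg_carrier R' \<and>
        ideal_power (fst R) (a_kernel (fst R) (fst R') q) (n + 1) = {\<zero>\<^bsub>fst R\<^esub>} \<and>
        transition G R R' q x = \<one>\<^bsub>sections G R'\<^esub>"
      using e by (intro bexI[OF _ R'] bexI[OF _ q] conjI)
    thus "x \<in> pre_infinitesimal A n G R"
      unfolding pre_infinitesimal_def using x by blast
  }
qed

text \<open>Nilpotence of the coordinate descends along a cover because \<open>G\<close> is separated: the section with
  coordinate \<open>t\<^sup>n\<^sup>+\<^sup>1\<close> becomes trivial on the cover.\<close>

lemma infinitesimal_coord:
  assumes R: "R \<in> algs A"
  shows "infinitesimal A n G R = {x \<in> carrier (sections G R). \<eta> R x \<in> nil_le (n + 1) R}"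
proof (intro equalityI subsetI)
  fix x assume "x \<in> infinitesimal A n G R"
  then obtain m C c where x: "x \<in> carrier (sections G R)" and cov: "fppf_cover A R m C c"
    and pre: "\<And>i. i < m \<Longrightarrow> transition G R (C i) (c i) x \<in> pre_infinitesimal A n G (C i)"
    by (auto simp: infinitesimal_def)
  interpret R: cring "fst R" using algsD(1)[OF R] .
  have C: "C i \<in> algs A" "c i \<in> alg_hom A R (C i)" if "i < m" for i
    using cov that by (auto simp: fppf_cover_def)
  define t where "t = \<eta> R x"
  define s where "s = t [^]\<^bsub>fst R\<^esub> (n + 1)"
  have ts: "t \<in> Spf_power_series R" unfolding t_def by (rule coord_closed[OF R x])
  have t: "t \<in> alg_carrier R" by (rule Spf_closed[OF ts])
  obtain k where k: "t \<in> nil_le k R" using ts by (rule SpfE)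
  \<comment> \<open>With \<open>t\<close> also \<open>s\<close> is nilpotent and therefore the
    coordinate of a section; separatedness of \<open>G\<close> says nothing about bare ring
    elements.\<close>
  have "s [^]\<^bsub>fst R\<^esub> k = (t [^]\<^bsub>fst R\<^esub> k) [^]\<^bsub>fst R\<^esub> (n + 1)"
    unfolding s_def R.nat_pow_pow[OF t] by (simp only: mult.commute)
  also have "\<dots> = \<zero>\<^bsub>fst R\<^esub>" using nil_leD(2)[OF k] by simp
  finally have "s \<in> nil_le k R" using t by (simp add: nil_le_def s_def)
  hence ss: "s \<in> Spf_power_series R" by (rule nil_le_Spf)
  have triv: "transition G R (C i) (c i) (pt R s) = \<one>\<^bsub>sections G (C i)\<^esub>" if i: "i < m" for i
  proof -
    interpret Ci: comm_group "sections G (C i)" by (rule group_sections[OF C(1)[OF i]])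
    have "c i t \<in> nil_le (n + 1) (C i)"
      using pre[OF i] pre_infinitesimal_coord[OF C(1)[OF i] transition_closed[OF R C[OF i] x], of n]
        coord_natural[OF R C[OF i] x] by (simp add: t_def)
    hence "c i s = \<zero>\<^bsub>fst (C i)\<^esub>"
      using ring_hom_nat_pow[OF algsD(1)[OF R] algsD(1)[OF C(1)[OF i]] alg_homD(1)[OF C(2)[OF i]] t, of "n + 1"]
      by (simp only: s_def nil_le_def mem_Collect_eq)
    thus ?thesis
      using coord_natural[OF R C[OF i] pt_closed[OF R ss]] coord_pt[OF R ss] coord_one[OF C(1)[OF i]]
        coord_inj[OF C(1)[OF i] transition_closed[OF R C[OF i] pt_closed[OF R ss]]] by simp
  qed
  interpret GR: comm_group "sections G R" by (rule group_sections[OF R])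
  have "\<exists>!y. y \<in> carrier (sections G R) \<and> (\<forall>i<m. transition G R (C i) (c i) y = \<one>\<^bsub>sections G (C i)\<^esub>)"
  proof (rule sheaf_glue[OF R cov]; intro allI impI ballI)
    show "\<one>\<^bsub>sections G (C i)\<^esub> \<in> carrier (sections G (C i))" if "i < m" for i
    proof -
      interpret Ci: comm_group "sections G (C i)" by (rule group_sections[OF C(1)[OF that]])
      show ?thesis by simp
    qed
    show "transition G (C i) T f \<one>\<^bsub>sections G (C i)\<^esub> = transition G (C j) T g \<one>\<^bsub>sections G (C j)\<^esub>"
      if "i < m" "j < m" "T \<in> algs A" "f \<in> alg_hom A (C i) T" "g \<in> alg_hom A (C j) T" for i j T f g
      using transition_one[OF C(1)[OF that(1)] that(3,4)] transition_one[OF C(1)[OF that(2)] that(3,5)] by simp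
  qed
  moreover have "\<forall>i<m. transition G R (C i) (c i) \<one>\<^bsub>sections G R\<^esub> = \<one>\<^bsub>sections G (C i)\<^esub>"
    using transition_one[OF R C] by blast
  ultimately have "pt R s = \<one>\<^bsub>sections G R\<^esub>" using triv pt_closed[OF R ss] GR.one_closed by blast
  hence "s = \<zero>\<^bsub>fst R\<^esub>" using coord_pt[OF R ss] coord_one[OF R] by simp
  hence "\<eta> R x \<in> nil_le (n + 1) R" using t by (simp add: nil_le_def s_def t_def)
  thus "x \<in> {x \<in> carrier (sections G R). \<eta> R x \<in> nil_le (n + 1) R}" using x by simp
next
  fix x assume x: "x \<in> {x \<in> carrier (sections G R). \<eta> R x \<in> nil_le (n + 1) R}"
  have "transition G R R (\<lambda>r\<in>alg_carrier R. r) x = x"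
    using transition_id[OF R] x by simp
  moreover have "x \<in> pre_infinitesimal A n G R" using x pre_infinitesimal_coord[OF R] by simp
  ultimately show "x \<in> infinitesimal A n G R"
    using x by (intro infinitesimalI[OF _ identity_cover[OF R]]) simp_all
qed

end

section \<open>Height in terms of coefficients\<close>

text \<open>Elements of \<open>fun_ring\<close> are extensional in both arguments; this normal form
  reduces their equality to equality on sections.\<close>

definition mk_fun ::
  "'u ring \<Rightarrow> ('u, 'x) grp_functor \<Rightarrow> ('u alg \<Rightarrow> 'x \<Rightarrow> 'u) \<Rightarrow> ('u alg \<Rightarrow> 'x \<Rightarrow> 'u)" where
  "mk_fun A B g = (\<lambda>R\<in>algs A. \<lambda>x\<in>carrier (sections B R). g R x)"

lemma mk_fun_apply [simp]:
  "R \<in> algs A \<Longrightarrow> x \<in> carrier (sections B R) \<Longrightarrow> mk_fun A B g R x = g R x"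
  by (simp add: mk_fun_def)

lemma mk_fun_cong:
  assumes "\<And>R x. R \<in> algs A \<Longrightarrow> x \<in> carrier (sections B R) \<Longrightarrow> g R x = h R x"
  shows "mk_fun A B g = mk_fun A B h"
  unfolding mk_fun_def by (intro restrict_ext) (use assms in auto)

lemma fun_ring_simps:
  "monoid.mult (fun_ring A B) \<phi> \<psi> = mk_fun A B (\<lambda>R x. \<phi> R x \<otimes>\<^bsub>fst R\<^esub> \<psi> R x)"
  "ring.add (fun_ring A B) \<phi> \<psi> = mk_fun A B (\<lambda>R x. \<phi> R x \<oplus>\<^bsub>fst R\<^esub> \<psi> R x)"
  by (simp_all add: fun_ring_def mk_fun_def)

lemma mk_fun_in_fun_ring:
  assumes "\<And>R x. R \<in> algs A \<Longrightarrow> x \<in> carrier (sections B R) \<Longrightarrow> g R x \<in> alg_carrier R"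
    "\<And>R T f x. R \<in> algs A \<Longrightarrow> T \<in> algs A \<Longrightarrow> f \<in> alg_hom A R T \<Longrightarrow> x \<in> carrier (sections B R) \<Longrightarrow>
       g T (transition B R T f x) = f (g R x)"
    "\<And>R T f x. R \<in> algs A \<Longrightarrow> T \<in> algs A \<Longrightarrow> f \<in> alg_hom A R T \<Longrightarrow> x \<in> carrier (sections B R) \<Longrightarrow>
       transition B R T f x \<in> carrier (sections B T)"
  shows "mk_fun A B g \<in> carrier (fun_ring A B)"
proof -
  have "mk_fun A B g \<in> (\<Pi>\<^sub>E R\<in>algs A. carrier (sections B R) \<rightarrow>\<^sub>E alg_carrier R)"
    unfolding mk_fun_def using assms(1) by (intro restrict_PiE_iff[THEN iffD2] ballI)
  thus ?thesis using assms(2,3) by (simp add: fun_ring_def)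
qed

lemma fun_ringD:
  assumes "\<phi> \<in> carrier (fun_ring A B)"
  shows "R \<in> algs A \<Longrightarrow> x \<in> carrier (sections B R) \<Longrightarrow> \<phi> R x \<in> alg_carrier R"
    "R \<in> algs A \<Longrightarrow> T \<in> algs A \<Longrightarrow> f \<in> alg_hom A R T \<Longrightarrow> x \<in> carrier (sections B R) \<Longrightarrow>
       \<phi> T (transition B R T f x) = f (\<phi> R x)"
    "\<phi> = mk_fun A B \<phi>"
proof -
  have P: "\<phi> \<in> (\<Pi>\<^sub>E R\<in>algs A. carrier (sections B R) \<rightarrow>\<^sub>E alg_carrier R)"
    using assms by (simp add: fun_ring_def)
  have PR: "\<phi> R \<in> carrier (sections B R) \<rightarrow>\<^sub>E alg_carrier R" if "R \<in> algs A" for R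
    using PiE_mem[OF P that] .
  show "R \<in> algs A \<Longrightarrow> x \<in> carrier (sections B R) \<Longrightarrow> \<phi> R x \<in> alg_carrier R"
    using PiE_mem[OF PR] by blast
  show "R \<in> algs A \<Longrightarrow> T \<in> algs A \<Longrightarrow> f \<in> alg_hom A R T \<Longrightarrow> x \<in> carrier (sections B R) \<Longrightarrow>
       \<phi> T (transition B R T f x) = f (\<phi> R x)"
    using assms by (simp add: fun_ring_def)
  show "\<phi> = mk_fun A B \<phi>"
  proof
    fix R
    show "\<phi> R = mk_fun A B \<phi> R"
    proof (cases "R \<in> algs A")
      case True
      thus ?thesis using PR[OF True] by (auto simp: mk_fun_def PiE_def extensional_def fun_eq_iff)
    next
      case False
      thus ?thesis using PiE_arb[OF P False] by (simp add: mk_fun_def)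
    qed
  qed
qed

text \<open>A functor that behaves like the \<open>N - 1\<close>-bud of a formal Lie group with a global coordinate, the
  series \<open>a\<close> being multiplication by \<open>p\<close>.\<close>

locale bud_coordinate =
  fixes A :: "'u ring" and N :: nat and B :: "('u, 'x) grp_functor" and \<beta> :: "'u alg \<Rightarrow> 'x \<Rightarrow> 'u"
    and p :: nat and a :: "nat \<Rightarrow> 'u"
  assumes inf: "infinite (UNIV :: 'u set)" and cring_base: "cring A" and N: "0 < N"
    and bij: "R \<in> algs A \<Longrightarrow> bij_betw (\<beta> R) (carrier (sections B R)) (nil_le N R)"
    and one_closed: "R \<in> algs A \<Longrightarrow> \<one>\<^bsub>sections B R\<^esub> \<in> carrier (sections B R)"
    and one_coord: "R \<in> algs A \<Longrightarrow> \<beta> R \<one>\<^bsub>sections B R\<^esub> = \<zero>\<^bsub>fst R\<^esub>"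
    and trans_closed: "R \<in> algs A \<Longrightarrow> T \<in> algs A \<Longrightarrow> f \<in> alg_hom A R T \<Longrightarrow> x \<in> carrier (sections B R) \<Longrightarrow>
       transition B R T f x \<in> carrier (sections B T)"
    and trans_coord: "R \<in> algs A \<Longrightarrow> T \<in> algs A \<Longrightarrow> f \<in> alg_hom A R T \<Longrightarrow> x \<in> carrier (sections B R) \<Longrightarrow>
       \<beta> T (transition B R T f x) = f (\<beta> R x)"
    and coeffs: "a \<in> UNIV \<rightarrow> carrier A"
    and pow_closed: "R \<in> algs A \<Longrightarrow> x \<in> carrier (sections B R) \<Longrightarrow> x [^]\<^bsub>sections B R\<^esub> p \<in> carrier (sections B R)"
    and pow_coord: "R \<in> algs A \<Longrightarrow> x \<in> carrier (sections B R) \<Longrightarrow>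
       \<beta> R (x [^]\<^bsub>sections B R\<^esub> p) = aeval R N a (\<beta> R x)"
begin

lemma coord_nil: "R \<in> algs A \<Longrightarrow> x \<in> carrier (sections B R) \<Longrightarrow> \<beta> R x \<in> nil_le N R"
  by (rule bij_betw_apply[OF bij])

lemma coord_closed: "R \<in> algs A \<Longrightarrow> x \<in> carrier (sections B R) \<Longrightarrow> \<beta> R x \<in> alg_carrier R"
  by (rule nil_leD(1)[OF coord_nil])

lemma coord_inj: "R \<in> algs A \<Longrightarrow> x \<in> carrier (sections B R) \<Longrightarrow> y \<in> carrier (sections B R) \<Longrightarrow>
    \<beta> R x = \<beta> R y \<Longrightarrow> x = y"
  using bij[of R] by (auto simp: bij_betw_def dest: inj_onD)

lemma ex_point:
  assumes "R \<in> algs A" "t \<in> nil_le N R"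
  shows "\<exists>x\<in>carrier (sections B R). \<beta> R x = t"
proof -
  have "t \<in> \<beta> R ` carrier (sections B R)"
    using bij_betw_imp_surj_on[OF bij[OF assms(1)]] assms(2) by simp
  thus ?thesis by auto
qed

text \<open>The locale does not make the transition maps homomorphisms, so compatibility with the
  power map is read off in the coordinate, where it is evaluation of the series
  \<open>a\<close>.\<close>

lemma trans_pow:
  assumes R: "R \<in> algs A" and T: "T \<in> algs A" and f: "f \<in> alg_hom A R T" and x: "x \<in> carrier (sections B R)"
  shows "transition B R T f (x [^]\<^bsub>sections B R\<^esub> p) = transition B R T f x [^]\<^bsub>sections B T\<^esub> p"
proof (rule coord_inj[OF T])
  note tx = trans_closed[OF R T f x]
  show "transition B R T f (x [^]\<^bsub>sections B R\<^esub> p) \<in> carrier (sections B T)"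
    by (rule trans_closed[OF R T f pow_closed[OF R x]])
  show "transition B R T f x [^]\<^bsub>sections B T\<^esub> p \<in> carrier (sections B T)"
    by (rule pow_closed[OF T tx])
  show "\<beta> T (transition B R T f (x [^]\<^bsub>sections B R\<^esub> p)) = \<beta> T (transition B R T f x [^]\<^bsub>sections B T\<^esub> p)"
    using trans_coord[OF R T f pow_closed[OF R x]] pow_coord[OF R x] pow_coord[OF T tx] trans_coord[OF R T f x]
      aeval_hom[OF R T f coeffs coord_closed[OF R x], of N] by simp
qed

section \<open>Functions on a bud and the ideal of its unit section\<close>

abbreviation "F \<equiv> fun_ring A B"
abbreviation "I \<equiv> section_ideal A B"

lemma coord_in_ideal: "mk_fun A B \<beta> \<in> I"
proof -
  have "mk_fun A B \<beta> \<in> carrier F"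
    by (rule mk_fun_in_fun_ring) (simp_all add: coord_closed trans_coord trans_closed)
  thus ?thesis using self_alg_in_algs[OF cring_base] one_closed one_coord
    by (simp add: section_ideal_def)
qed

text \<open>Transported along the coordinate, a function on the bud is a natural map on
  \<open>nil_le N\<close>, hence a truncated polynomial by Yoneda.\<close>

lemma fun_expansion:
  assumes \<phi>: "\<phi> \<in> carrier F"
  obtains b where "b \<in> UNIV \<rightarrow> carrier A"
    "\<forall>R\<in>algs A. \<forall>x\<in>carrier (sections B R). \<phi> R x = aeval R N b (\<beta> R x)"
proof -
  define \<psi> where "\<psi> R t = \<phi> R (inv_into (carrier (sections B R)) (\<beta> R) t)" for R t
  have \<psi>: "\<psi> R (\<beta> R x) = \<phi> R x" if "R \<in> algs A" "x \<in> carrier (sections B R)" for R x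
    using bij[OF that(1)] that by (simp add: \<psi>_def bij_betw_def)
  have "natural_on A (nil_le N) \<psi>"
  proof (rule natural_onI)
    fix R t assume R: "R \<in> algs A" and t: "t \<in> nil_le N R"
    then obtain x where x: "x \<in> carrier (sections B R)" "t = \<beta> R x" using ex_point by blast
    show "\<psi> R t \<in> alg_carrier R" using \<psi>[OF R x(1)] x fun_ringD(1)[OF \<phi> R x(1)] by simp
    fix T f assume T: "T \<in> algs A" and f: "f \<in> alg_hom A R T"
    show "\<psi> T (f t) = f (\<psi> R t)"
      using \<psi>[OF T trans_closed[OF R T f x(1)]] trans_coord[OF R T f x(1)] \<psi>[OF R x(1)] x(2)
        fun_ringD(2)[OF \<phi> R T f x(1)] by simp
  qed
  from natural_expansion_le[OF inf cring_base this]
  obtain b where b: "b \<in> UNIV \<rightarrow> carrier A" "\<forall>R\<in>algs A. \<forall>t\<in>nil_le N R. \<psi> R t = aeval R N b t" by blast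
  have "\<forall>R\<in>algs A. \<forall>x\<in>carrier (sections B R). \<phi> R x = aeval R N b (\<beta> R x)"
    using b(2) \<psi> coord_nil by metis
  thus thesis using that b(1) by blast
qed

lemma aeval_shift:
  assumes "R \<in> algs A" "b \<in> UNIV \<rightarrow> carrier A" "t \<in> alg_carrier R" "k \<le> N" "\<And>i. i < k \<Longrightarrow> b i = \<zero>\<^bsub>A\<^esub>"
  shows "aeval R N b t = t [^]\<^bsub>fst R\<^esub> k \<otimes>\<^bsub>fst R\<^esub> aeval R (N - k) (\<lambda>i. b (i + k)) t"
proof -
  have "snd R (b i) = \<zero>\<^bsub>fst R\<^esub>" if "i < k" for i
    using assms(5)[OF that] ring_hom_zero'[OF cring_base algsD(1,2)[OF assms(1)]] by simp
  from cring.peval_shift[OF algsD(1)[OF assms(1)] algsD(5)[OF assms(1,2)] assms(3,4) this]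
  show ?thesis .
qed

lemma shift_natural:
  assumes "b \<in> UNIV \<rightarrow> carrier A"
  shows "(\<lambda>i. b (i + k)) \<in> UNIV \<rightarrow> carrier A"
  using assms by auto

text \<open>Vanishing on the unit section kills the constant coefficient, so a factor
  \<open>\<beta>\<close> splits off: the ideal of the section is principal, generated by the
  coordinate.\<close>

lemma ideal_divisible:
  assumes \<phi>: "\<phi> \<in> I"
  obtains \<psi> where "\<psi> \<in> carrier F"
    "\<forall>R\<in>algs A. \<forall>x\<in>carrier (sections B R). \<phi> R x = \<beta> R x \<otimes>\<^bsub>fst R\<^esub> \<psi> R x"
proof -
  have \<phi>F: "\<phi> \<in> carrier F" and \<phi>0: "\<phi> (self_alg A) \<one>\<^bsub>sections B (self_alg A)\<^esub> = \<zero>\<^bsub>A\<^esub>"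
    using \<phi> by (simp_all add: section_ideal_def)
  obtain b where b: "b \<in> UNIV \<rightarrow> carrier A"
    "\<forall>R\<in>algs A. \<forall>x\<in>carrier (sections B R). \<phi> R x = aeval R N b (\<beta> R x)"
    using fun_expansion[OF \<phi>F] .
  interpret A: cring A by (rule cring_base)
  note S = self_alg_in_algs[OF cring_base]
  have b0: "b 0 = \<zero>\<^bsub>A\<^esub>"
  proof -
    have "b i \<in> carrier A" for i using b(1) by auto
    hence sb: "(\<lambda>i. snd (self_alg A) (b i)) = b" by simp
    have "\<zero>\<^bsub>A\<^esub> = peval A N b \<zero>\<^bsub>A\<^esub>" using b(2) S one_closed[OF S] one_coord[OF S] \<phi>0 sb by simp
    also have "\<dots> = peval A (Suc 0) b \<zero>\<^bsub>A\<^esub>"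
      by (rule A.peval_mono[OF b(1)]) (use N in auto)
    also have "\<dots> = b 0" by (rule A.peval_1[OF b(1)]) simp
    finally show ?thesis by simp
  qed
  let ?g = "\<lambda>R x. aeval R (N - 1) (\<lambda>i. b (i + 1)) (\<beta> R x)"
  have "mk_fun A B ?g \<in> carrier F"
  proof (rule mk_fun_in_fun_ring)
    fix R x assume Rx: "R \<in> algs A" "x \<in> carrier (sections B R)"
    show "?g R x \<in> alg_carrier R"
      by (rule aeval_closed[OF Rx(1) shift_natural[OF b(1)] coord_closed[OF Rx]])
    fix T f assume T: "T \<in> algs A" and f: "f \<in> alg_hom A R T"
    show "transition B R T f x \<in> carrier (sections B T)" by (rule trans_closed[OF Rx(1) T f Rx(2)])
    show "?g T (transition B R T f x) = f (?g R x)"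
      using aeval_hom[OF Rx(1) T f shift_natural[OF b(1), of 1] coord_closed[OF Rx], of "N - 1"] trans_coord[OF Rx(1) T f Rx(2)] by simp
  qed
  moreover have "\<phi> R x = \<beta> R x \<otimes>\<^bsub>fst R\<^esub> mk_fun A B ?g R x" if "R \<in> algs A" "x \<in> carrier (sections B R)" for R x
  proof -
    interpret R: cring "fst R" using algsD(1)[OF that(1)] .
    show ?thesis
      using aeval_shift[OF that(1) b(1) coord_closed[OF that], of 1] b0 b(2) that N coord_closed[OF that] by simp
  qed
  ultimately show thesis using that by blast
qed

text \<open>The cofactor may depend on the section; this is enough for the application, which takes
  place at the generic point only.\<close>

lemma ideal_power_divisible:
  assumes "\<phi> \<in> ideal_power F I k" "R \<in> algs A" "x \<in> carrier (sections B R)"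
  shows "\<exists>s\<in>alg_carrier R. \<phi> R x = \<beta> R x [^]\<^bsub>fst R\<^esub> k \<otimes>\<^bsub>fst R\<^esub> s"
  using assms(1)
proof (induction k arbitrary: \<phi>)
  case 0
  interpret R: cring "fst R" using algsD(1)[OF assms(2)] .
  have "\<phi> R x \<in> alg_carrier R" using 0 fun_ringD(1)[OF _ assms(2,3)] by simp
  thus ?case by auto
next
  case (Suc k)
  interpret R: cring "fst R" using algsD(1)[OF assms(2)] .
  note [simp] = coord_closed[OF assms(2,3)]
  from Suc.prems have "\<phi> \<in> ideal_prod F (ideal_power F I k) I" by simp
  thus ?case
  proof (induction rule: ideal_prod.induct)
    case (prod i j)
    obtain s where s: "s \<in> alg_carrier R" "i R x = \<beta> R x [^]\<^bsub>fst R\<^esub> k \<otimes>\<^bsub>fst R\<^esub> s"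
      using Suc.IH[OF prod(1)] by blast
    obtain \<psi> where \<psi>: "\<psi> \<in> carrier F" "\<forall>R\<in>algs A. \<forall>x\<in>carrier (sections B R). j R x = \<beta> R x \<otimes>\<^bsub>fst R\<^esub> \<psi> R x"
      using ideal_divisible[OF prod(2)] .
    have r: "\<psi> R x \<in> alg_carrier R" by (rule fun_ringD(1)[OF \<psi>(1) assms(2,3)])
    have "(i \<otimes>\<^bsub>F\<^esub> j) R x = \<beta> R x [^]\<^bsub>fst R\<^esub> Suc k \<otimes>\<^bsub>fst R\<^esub> (s \<otimes>\<^bsub>fst R\<^esub> \<psi> R x)"
      using s r \<psi>(2) assms(2,3) by (simp add: fun_ring_simps R.m_ac)
    thus ?case using s r by blast
  next
    case (sum u v)
    then obtain s r where s: "s \<in> alg_carrier R" "u R x = \<beta> R x [^]\<^bsub>fst R\<^esub> Suc k \<otimes>\<^bsub>fst R\<^esub> s"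
      and r: "r \<in> alg_carrier R" "v R x = \<beta> R x [^]\<^bsub>fst R\<^esub> Suc k \<otimes>\<^bsub>fst R\<^esub> r" by blast
    have "(u \<oplus>\<^bsub>F\<^esub> v) R x = \<beta> R x [^]\<^bsub>fst R\<^esub> Suc k \<otimes>\<^bsub>fst R\<^esub> (s \<oplus>\<^bsub>fst R\<^esub> r)"
      using s r assms(2,3) by (simp add: fun_ring_simps R.r_distr del: R.nat_pow_Suc)
    thus ?case using s r by blast
  qed
qed

lemma multiple_in_ideal_power:
  assumes "\<psi> \<in> carrier F"
  shows "mk_fun A B (\<lambda>R x. \<beta> R x [^]\<^bsub>fst R\<^esub> k \<otimes>\<^bsub>fst R\<^esub> \<psi> R x) \<in> ideal_power F I k"
proof (induction k)
  case 0
  have "mk_fun A B (\<lambda>R x. \<beta> R x [^]\<^bsub>fst R\<^esub> (0::nat) \<otimes>\<^bsub>fst R\<^esub> \<psi> R x) = mk_fun A B \<psi>"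
  proof (rule mk_fun_cong)
    fix R x assume Rx: "R \<in> algs A" "x \<in> carrier (sections B R)"
    interpret R: cring "fst R" using algsD(1)[OF Rx(1)] .
    show "\<beta> R x [^]\<^bsub>fst R\<^esub> (0::nat) \<otimes>\<^bsub>fst R\<^esub> \<psi> R x = \<psi> R x" using fun_ringD(1)[OF assms Rx] by simp
  qed
  thus ?case using fun_ringD(3)[OF assms] assms by simp
next
  case (Suc k)
  let ?m = "mk_fun A B (\<lambda>R x. \<beta> R x [^]\<^bsub>fst R\<^esub> k \<otimes>\<^bsub>fst R\<^esub> \<psi> R x)"
  have "mk_fun A B (\<lambda>R x. \<beta> R x [^]\<^bsub>fst R\<^esub> Suc k \<otimes>\<^bsub>fst R\<^esub> \<psi> R x) = ?m \<otimes>\<^bsub>F\<^esub> mk_fun A B \<beta>"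
    unfolding fun_ring_simps
  proof (rule mk_fun_cong)
    fix R x assume Rx: "R \<in> algs A" "x \<in> carrier (sections B R)"
    interpret R: cring "fst R" using algsD(1)[OF Rx(1)] .
    show "\<beta> R x [^]\<^bsub>fst R\<^esub> Suc k \<otimes>\<^bsub>fst R\<^esub> \<psi> R x = ?m R x \<otimes>\<^bsub>fst R\<^esub> mk_fun A B \<beta> R x"
      using fun_ringD(1)[OF assms Rx] coord_closed[OF Rx] Rx by (simp add: R.m_ac)
  qed
  thus ?case using ideal_prod.prod[OF Suc coord_in_ideal, of F] by simp
qed

text \<open>The coordinate generates the ideal, so the condition says that \<open>[p]\<close> is
  divisible by the power \<open>p^h\<close> of the coordinate. At the generic point such
  divisibility means that the coefficients below \<open>p^h\<close> vanish; conversely, vanishing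
  coefficients give a global cofactor.\<close>

lemma height_ge_iff:
  assumes q: "p ^ h \<le> N"
  shows "height_ge A p h B \<longleftrightarrow> (\<forall>i<p ^ h. a i = \<zero>\<^bsub>A\<^esub>)"
proof
  define q where "q = p ^ h"
  have qN: "q \<le> N" using q by (simp add: q_def)
  {
    assume ht: "height_ge A p h B"
    obtain P c Z where t: "is_trunc A N P c Z" using ex_trunc[OF inf cring_base] by blast
    note R = trunc_alg[OF t] and T = is_truncD[OF t]
    interpret A: cring A by (rule cring_base)
    interpret P: cring P by (rule T)
    obtain x where x: "x \<in> carrier (sections B (P, c))" "\<beta> (P, c) x = Z" using ex_point[OF R] by blast
    have "mult_pullback A p B (mk_fun A B \<beta>) \<in> ideal_power F I q"
      using ht coord_in_ideal by (auto simp: height_ge_def q_def)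
    from ideal_power_divisible[OF this R(1) x(1)] obtain s where s: "s \<in> carrier P"
      "mult_pullback A p B (mk_fun A B \<beta>) (P, c) x = Z [^]\<^bsub>P\<^esub> q \<otimes>\<^bsub>P\<^esub> s" using x(2) by auto
    moreover have "mult_pullback A p B (mk_fun A B \<beta>) (P, c) x = aeval (P, c) N a Z"
      using R(1) x pow_closed[OF R(1) x(1)] pow_coord[OF R(1) x(1)] by (simp add: mult_pullback_def)
    ultimately have e: "peval P N (\<lambda>i. c (a i)) Z = Z [^]\<^bsub>P\<^esub> q \<otimes>\<^bsub>P\<^esub> s" by simp
    \<comment> \<open>Multiplication by \<open>Z^(N - q)\<close> pushes every multiple of
      \<open>Z^q\<close> up to degree \<open>N\<close>, where it vanishes, and moves the
      coefficients of \<open>a\<close> by \<open>m\<close>.\<close>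
    define m where "m = N - q"
    define b where "b j = (if j < m then \<zero>\<^bsub>A\<^esub> else a (j - m))" for j
    have b: "b \<in> UNIV \<rightarrow> carrier A" using coeffs by (auto simp: b_def)
    have "peval P N (\<lambda>i. c (b i)) Z = peval P (N + m) (\<lambda>i. c (b i)) Z"
      by (rule P.peval_mono[OF T(7)[OF b] T(5,6), symmetric]) simp
    also have "\<dots> = Z [^]\<^bsub>P\<^esub> m \<otimes>\<^bsub>P\<^esub> peval P N (\<lambda>i. c (a i)) Z"
      using P.peval_shift[OF T(7)[OF b] T(5), of m "N + m"] ring_hom_zero'[OF T(1-3)]
      by (simp add: b_def)
    also have "\<dots> = Z [^]\<^bsub>P\<^esub> (m + q) \<otimes>\<^bsub>P\<^esub> s"
      using s(1) T(5) unfolding e by (simp add: P.nat_pow_mult[symmetric] P.m_assoc)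
    also have "\<dots> = \<zero>\<^bsub>P\<^esub>" using qN T(6) s(1) by (simp add: m_def)
    finally have b0: "b j = \<zero>\<^bsub>A\<^esub>" if "j < N" for j using trunc_coeff_zero[OF t b _ that] by simp
    show "\<forall>i<p ^ h. a i = \<zero>\<^bsub>A\<^esub>"
    proof (intro allI impI)
      fix i assume "i < p ^ h"
      hence "i + m < N" using qN by (simp add: m_def q_def)
      from b0[OF this] show "a i = \<zero>\<^bsub>A\<^esub>" by (simp add: b_def)
    qed
  next
    assume a0: "\<forall>i<p ^ h. a i = \<zero>\<^bsub>A\<^esub>"
    show "height_ge A p h B"
      unfolding height_ge_def
    proof (intro subsetI, elim imageE)
      fix \<theta> \<phi> assume \<theta>: "\<theta> = mult_pullback A p B \<phi>" and \<phi>: "\<phi> \<in> I"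
      \<comment> \<open>Pulling back \<open>\<phi> = \<beta> \<psi>\<close> gives the series of
        \<open>[p]\<close> times the pullback of \<open>\<psi>\<close>, and the series supplies
        \<open>q\<close> factors \<open>\<beta>\<close>.\<close>
      obtain \<psi> where \<psi>: "\<psi> \<in> carrier F" "\<forall>R\<in>algs A. \<forall>x\<in>carrier (sections B R). \<phi> R x = \<beta> R x \<otimes>\<^bsub>fst R\<^esub> \<psi> R x"
        using ideal_divisible[OF \<phi>] .
      let ?r = "\<lambda>R x. aeval R (N - q) (\<lambda>i. a (i + q)) (\<beta> R x)"
      let ?g = "\<lambda>R x. ?r R x \<otimes>\<^bsub>fst R\<^esub> \<psi> R (x [^]\<^bsub>sections B R\<^esub> p)"
      have rc: "?r R x \<in> alg_carrier R" if "R \<in> algs A" "x \<in> carrier (sections B R)" for R x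
        by (rule aeval_closed[OF that(1) shift_natural[OF coeffs] coord_closed[OF that]])
      have \<psi>c: "\<psi> R (x [^]\<^bsub>sections B R\<^esub> p) \<in> alg_carrier R" if "R \<in> algs A" "x \<in> carrier (sections B R)" for R x
        by (rule fun_ringD(1)[OF \<psi>(1) that(1) pow_closed[OF that]])
      have g: "mk_fun A B ?g \<in> carrier F"
      proof (rule mk_fun_in_fun_ring)
        fix R x assume Rx: "R \<in> algs A" "x \<in> carrier (sections B R)"
        interpret R: cring "fst R" using algsD(1)[OF Rx(1)] .
        show "?g R x \<in> alg_carrier R" using rc[OF Rx] \<psi>c[OF Rx] by simp
        fix T f assume T: "T \<in> algs A" and f: "f \<in> alg_hom A R T"
        show "transition B R T f x \<in> carrier (sections B T)" by (rule trans_closed[OF Rx(1) T f Rx(2)])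
        have "?r T (transition B R T f x) = f (?r R x)"
          using aeval_hom[OF Rx(1) T f shift_natural[OF coeffs] coord_closed[OF Rx]] trans_coord[OF Rx(1) T f Rx(2)] by simp
        moreover have "\<psi> T (transition B R T f x [^]\<^bsub>sections B T\<^esub> p) = f (\<psi> R (x [^]\<^bsub>sections B R\<^esub> p))"
          using fun_ringD(2)[OF \<psi>(1) Rx(1) T f pow_closed[OF Rx]] trans_pow[OF Rx(1) T f Rx(2)] by simp
        ultimately show "?g T (transition B R T f x) = f (?g R x)"
          using ring_hom_mult[OF alg_homD(1)[OF f] rc[OF Rx] \<psi>c[OF Rx]] by simp
      qed
      have "\<theta> = mk_fun A B (\<lambda>R x. \<beta> R x [^]\<^bsub>fst R\<^esub> q \<otimes>\<^bsub>fst R\<^esub> mk_fun A B ?g R x)"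
        unfolding \<theta> mult_pullback_def mk_fun_def[symmetric]
      proof (rule mk_fun_cong)
        fix R x assume Rx: "R \<in> algs A" "x \<in> carrier (sections B R)"
        interpret R: cring "fst R" using algsD(1)[OF Rx(1)] .
        have "\<phi> R (x [^]\<^bsub>sections B R\<^esub> p) = aeval R N a (\<beta> R x) \<otimes>\<^bsub>fst R\<^esub> \<psi> R (x [^]\<^bsub>sections B R\<^esub> p)"
          using \<psi>(2) Rx(1) pow_closed[OF Rx] pow_coord[OF Rx] by simp
        also have "aeval R N a (\<beta> R x) = \<beta> R x [^]\<^bsub>fst R\<^esub> q \<otimes>\<^bsub>fst R\<^esub> ?r R x"
          by (rule aeval_shift[OF Rx(1) coeffs coord_closed[OF Rx] qN]) (use a0 q_def in simp)
        finally show "\<phi> R (x [^]\<^bsub>sections B R\<^esub> p) = \<beta> R x [^]\<^bsub>fst R\<^esub> q \<otimes>\<^bsub>fst R\<^esub> mk_fun A B ?g R x"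
          using rc[OF Rx] \<psi>c[OF Rx] coord_closed[OF Rx] Rx by (simp add: R.m_assoc)
      qed
      thus "\<theta> \<in> ideal_power F I (p ^ h)" using multiple_in_ideal_power[OF g, of q] by (simp add: q_def)
    qed
  }
qed

lemma base_change_bud_coordinate:
  assumes "cring A'" "f \<in> ring_hom A A'"
  shows "bud_coordinate A' N (base_change A f B) (\<lambda>R. \<beta> (restrict_scalars A f R)) p (\<lambda>i. f (a i))"
proof -
  note rs = restrict_scalars_in_algs[OF cring_base _ assms(2)]
  note rh = restrict_scalars_alg_hom[OF _ assms(2)]
  show ?thesis
  proof (rule bud_coordinate.intro)
    fix R assume R: "R \<in> algs A'"
    show "bij_betw (\<beta> (restrict_scalars A f R)) (carrier (sections (base_change A f B) R)) (nil_le N R)"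
      using bij[OF rs[OF R]] by (simp add: base_change_def)
    fix x assume x: "x \<in> carrier (sections (base_change A f B) R)"
    have x': "x \<in> carrier (sections B (restrict_scalars A f R))" using x by (simp add: base_change_def)
    show "\<beta> (restrict_scalars A f R) (x [^]\<^bsub>sections (base_change A f B) R\<^esub> p)
        = aeval R N (\<lambda>i. f (a i)) (\<beta> (restrict_scalars A f R) x)"
      using pow_coord[OF rs[OF R] x'] aeval_restrict_scalars[OF coeffs, of f R N] by (simp add: base_change_def)
  next
    show "(\<lambda>i. f (a i)) \<in> UNIV \<rightarrow> carrier A'" using coeffs ring_hom_closed[OF assms(2)] by auto
  qed (use inf N assms(1) in \<open>auto simp: base_change_def intro!: one_closed one_coord trans_closed trans_coord pow_closed rs rh
      simp: one_coord[OF rs] trans_coord[OF rs rs rh]\<close>)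
qed

end

section \<open>Buds of a formal Lie group and their height\<close>

lemma nat_pow_carrier_update: "x [^]\<^bsub>M\<lparr>carrier := H\<rparr>\<^esub> (n::nat) = x [^]\<^bsub>M\<^esub> n"
  by (simp add: nat_pow_def)

context coordinate_group
begin

text \<open>The \<open>n\<close>-bud is the locus where the power \<open>n + 1\<close> of the
  coordinate vanishes, hence the shift in the truncation. It is stable under \<open>[p]\<close>
  because that series has no constant term.\<close>

lemma bud_bud_coordinate:
  assumes a: "represents A (law.mult_by p) a"
  shows "bud_coordinate A (n + 1) (bud A n G) \<eta> p a"
proof (rule bud_coordinate.intro)
  have bc: "carrier (sections (bud A n G) R) = {x \<in> carrier (sections G R). \<eta> R x \<in> nil_le (n + 1) R}"
    if "R \<in> algs A" for R
    using infinitesimal_coord[OF that] by (simp add: bud_def)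
  note ac = representsD(1)[OF a]
  have bt: "transition (bud A n G) = transition G" by (simp add: bud_def)
  fix R assume R: "R \<in> algs A"
  interpret R: cring "fst R" using algsD(1)[OF R] .
  interpret GR: comm_group "sections G R" by (rule group_sections[OF R])
  have b1: "\<one>\<^bsub>sections (bud A n G) R\<^esub> = \<one>\<^bsub>sections G R\<^esub>" by (simp add: bud_def)
  show "bij_betw (\<eta> R) (carrier (sections (bud A n G) R)) (nil_le (n + 1) R)"
    unfolding bij_betw_def
  proof (intro conjI equalityI subsetI)
    show "inj_on (\<eta> R) (carrier (sections (bud A n G) R))"
      using coord_inj[OF R] bc[OF R] by (auto intro!: inj_onI)
    fix t
    show "t \<in> nil_le (n + 1) R" if "t \<in> \<eta> R ` carrier (sections (bud A n G) R)"
      using that bc[OF R] by auto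
    show "t \<in> \<eta> R ` carrier (sections (bud A n G) R)" if t: "t \<in> nil_le (n + 1) R"
    proof (rule image_eqI)
      show "t = \<eta> R (pt R t)" using coord_pt[OF R nil_le_Spf[OF t]] by simp
      thus "pt R t \<in> carrier (sections (bud A n G) R)"
        unfolding bc[OF R] using pt_closed[OF R nil_le_Spf[OF t]] t by simp
    qed
  qed
  show "\<one>\<^bsub>sections (bud A n G) R\<^esub> \<in> carrier (sections (bud A n G) R)"
    using coord_one[OF R] zero_nil_le(1)[OF R, of n] by (simp add: b1 bc[OF R])
  show "\<eta> R \<one>\<^bsub>sections (bud A n G) R\<^esub> = \<zero>\<^bsub>fst R\<^esub>"
    using coord_one[OF R] by (simp add: b1)
  {
    fix T f x
    assume T: "T \<in> algs A" and f: "f \<in> alg_hom A R T" and x: "x \<in> carrier (sections (bud A n G) R)"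
    have x': "x \<in> carrier (sections G R)" "\<eta> R x \<in> nil_le (n + 1) R" using x bc[OF R] by auto
    show "\<eta> T (transition (bud A n G) R T f x) = f (\<eta> R x)"
      using coord_natural[OF R T f x'(1)] by (simp add: bt)
    show "transition (bud A n G) R T f x \<in> carrier (sections (bud A n G) T)"
      using transition_closed[OF R T f x'(1)] coord_natural[OF R T f x'(1)] nil_le_hom[OF R T f x'(2)]
      by (simp add: bt bc[OF T])
  }
  fix x assume x: "x \<in> carrier (sections (bud A n G) R)"
  have x': "x \<in> carrier (sections G R)" "\<eta> R x \<in> nil_le (n + 1) R" using x bc[OF R] by auto
  have pw: "x [^]\<^bsub>sections (bud A n G) R\<^esub> p = x [^]\<^bsub>sections G R\<^esub> p"
    by (simp add: bud_def nat_pow_carrier_update)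
  show e: "\<eta> R (x [^]\<^bsub>sections (bud A n G) R\<^esub> p) = aeval R (n + 1) a (\<eta> R x)"
    using coord_pow[OF R x'(1), of p] representsD(2)[OF a R x'(2)] by (simp add: pw)
  have "aeval R (n + 1) a (\<eta> R x) \<in> nil_le (n + 1) R"
    by (rule aeval_nil_le[OF cring_base R ac law.mult_by_linear_coeff(1)[OF a] x'(2)])
  thus "x [^]\<^bsub>sections (bud A n G) R\<^esub> p \<in> carrier (sections (bud A n G) R)"
    using e x'(1) by (simp add: pw bc[OF R])
qed (use inf cring_base representsD(1)[OF a] in auto)

text \<open>The bud of order \<open>p^(h + 1)\<close> is truncated at \<open>p^(h + 1) + 1\<close>,
  late enough to test height \<open>h\<close> and height \<open>h + 1\<close>. Lying in the open
  complement means that the coefficients below \<open>p^(h + 1)\<close> have no common zero over a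
  nonzero algebra.\<close>

lemma has_height_iff:
  assumes a: "represents A (law.mult_by p) a" and p: "0 < p"
  shows "has_height A p h G \<longleftrightarrow> (\<forall>i<p ^ h. a i = \<zero>\<^bsub>A\<^esub>) \<and>
    (\<forall>R\<in>algs A. \<one>\<^bsub>fst R\<^esub> \<noteq> \<zero>\<^bsub>fst R\<^esub> \<longrightarrow> (\<exists>i<p ^ (h + 1). snd R (a i) \<noteq> \<zero>\<^bsub>fst R\<^esub>))"
proof -
  interpret B: bud_coordinate A "p ^ (h + 1) + 1" "bud A (p ^ (h + 1)) G" \<eta> p a
    by (rule bud_bud_coordinate[OF a])
  have le: "p ^ h \<le> p ^ (h + 1) + 1" "p ^ (h + 1) \<le> p ^ (h + 1) + 1"
    using p by (simp_all add: power_increasing le_SucI)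
  have "height_ge (fst R) p (h + 1) (base_change A (snd R) (bud A (p ^ (h + 1)) G))
      \<longleftrightarrow> (\<forall>i<p ^ (h + 1). snd R (a i) = \<zero>\<^bsub>fst R\<^esub>)" if "R \<in> algs A" for R
    by (rule bud_coordinate.height_ge_iff[OF B.base_change_bud_coordinate[OF algsD(1,2)[OF that]] le(2)])
  thus ?thesis
    unfolding has_height_def bud_has_height_def using B.height_ge_iff[OF le(1)] by auto
qed

end

section \<open>Valuation rings\<close>

definition law_iso ::
  "'u ring \<Rightarrow> ('u alg \<Rightarrow> 'u \<Rightarrow> 'u \<Rightarrow> 'u) \<Rightarrow> ('u alg \<Rightarrow> 'u \<Rightarrow> 'u \<Rightarrow> 'u) \<Rightarrow> ('u alg \<Rightarrow> 'u \<Rightarrow> 'u) \<Rightarrow> bool" where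
  "law_iso A mul mul' f \<longleftrightarrow>
     (\<forall>R\<in>algs A. bij_betw (f R) (Spf_power_series R) (Spf_power_series R)) \<and>
     (\<forall>R\<in>algs A. \<forall>x\<in>Spf_power_series R. \<forall>y\<in>Spf_power_series R. f R (mul R x y) = mul' R (f R x) (f R y)) \<and>
     (\<forall>R\<in>algs A. \<forall>T\<in>algs A. \<forall>g\<in>alg_hom A R T. \<forall>x\<in>Spf_power_series R. f T (g x) = g (f R x))"

lemma law_isoI:
  assumes "\<And>R. R \<in> algs A \<Longrightarrow> bij_betw (f R) (Spf_power_series R) (Spf_power_series R)"
    "\<And>R x y. R \<in> algs A \<Longrightarrow> x \<in> Spf_power_series R \<Longrightarrow> y \<in> Spf_power_series R \<Longrightarrow>
       f R (mul R x y) = mul' R (f R x) (f R y)"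
    "\<And>R T g x. R \<in> algs A \<Longrightarrow> T \<in> algs A \<Longrightarrow> g \<in> alg_hom A R T \<Longrightarrow> x \<in> Spf_power_series R \<Longrightarrow>
       f T (g x) = g (f R x)"
  shows "law_iso A mul mul' f"
  unfolding law_iso_def using assms by simp

lemma law_isoD:
  assumes "law_iso A mul mul' f" "R \<in> algs A"
  shows "bij_betw (f R) (Spf_power_series R) (Spf_power_series R)"
    "x \<in> Spf_power_series R \<Longrightarrow> y \<in> Spf_power_series R \<Longrightarrow> f R (mul R x y) = mul' R (f R x) (f R y)"
    "T \<in> algs A \<Longrightarrow> g \<in> alg_hom A R T \<Longrightarrow> x \<in> Spf_power_series R \<Longrightarrow> f T (g x) = g (f R x)"
  using assms unfolding law_iso_def by simp_all

lemma law_iso_closed: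
  assumes "law_iso A mul mul' f" "R \<in> algs A" "x \<in> Spf_power_series R"
  shows "f R x \<in> Spf_power_series R"
  by (rule bij_betw_apply[OF law_isoD(1)[OF assms(1,2)] assms(3)])

lemma law_iso_expansion:
  assumes "formal_group_law A mul" "law_iso A mul mul' f"
  obtains a where "represents A f a"
proof -
  interpret formal_group_law A mul by fact
  have "natural_on A Spf_power_series f"
    by (rule natural_onI) (simp_all add: law_isoD(3)[OF assms(2)] Spf_closed[OF law_iso_closed[OF assms(2)]])
  thus thesis using natural_expansion[OF inf cring_base] that by blast
qed

lemma law_iso_zero:
  assumes "formal_group_law A mul" "formal_group_law A mul'" "law_iso A mul mul' f" "R \<in> algs A"
  shows "f R \<zero>\<^bsub>fst R\<^esub> = \<zero>\<^bsub>fst R\<^esub>"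
proof -
  interpret G: formal_group_law A mul by fact
  interpret H: formal_group_law A mul' by fact
  interpret H: comm_group "pts mul' R" by (rule H.group_pts[OF assms(4)])
  note z = zero_nil_le(2)[OF assms(4)]
  have c: "f R \<zero>\<^bsub>fst R\<^esub> \<in> Spf_power_series R" by (rule law_iso_closed[OF assms(3,4) z])
  have "mul' R (f R \<zero>\<^bsub>fst R\<^esub>) (f R \<zero>\<^bsub>fst R\<^esub>) = f R \<zero>\<^bsub>fst R\<^esub>"
    using law_isoD(2)[OF assms(3,4) z z] G.mul_zero(1)[OF assms(4) z] by simp
  thus ?thesis using H.l_cancel_one[of "f R \<zero>\<^bsub>fst R\<^esub>" "f R \<zero>\<^bsub>fst R\<^esub>"] c by simp
qed

lemma law_iso_mult_by:
  assumes "formal_group_law A mul" "formal_group_law A mul'" "law_iso A mul mul' f" "R \<in> algs A"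
    "x \<in> Spf_power_series R"
  shows "f R (formal_group_law.mult_by mul n R x) = formal_group_law.mult_by mul' n R (f R x)"
proof -
  interpret G: formal_group_law A mul by fact
  interpret H: formal_group_law A mul' by fact
  show ?thesis
  proof (induction n)
    case 0
    show ?case using law_iso_zero[OF assms(1-4)] by (simp add: G.mult_by_0 H.mult_by_0)
  next
    case (Suc n)
    thus ?case using law_isoD(2)[OF assms(3,4) G.mult_by_closed[OF assms(4,5)] assms(5)]
      by (simp add: G.mult_by_Suc H.mult_by_Suc)
  qed
qed

text \<open>Integrality must also be shown for the inverse series, so the inverse has to be an
  isomorphism of laws in its own right.\<close>

lemma law_iso_inverse:
  assumes "formal_group_law A mul" "law_iso A mul mul' f"
  shows "law_iso A mul' mul (\<lambda>R. inv_into (Spf_power_series R) (f R))"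
proof (rule law_isoI)
  interpret G: formal_group_law A mul by fact
  fix R assume R: "R \<in> algs A"
  let ?i = "\<lambda>R. inv_into (Spf_power_series R) (f R)"
  note b = law_isoD(1)[OF assms(2)]
  have fi: "f R (?i R x) = x" "?i R x \<in> Spf_power_series R" if "R \<in> algs A" "x \<in> Spf_power_series R" for R x
    using b[OF that(1)] that(2) by (auto simp: bij_betw_def f_inv_into_f inv_into_into)
  have unique: "?i R x = y" if "R \<in> algs A" "y \<in> Spf_power_series R" "f R y = x" for R x y
    using bij_betw_inv_into_left[OF b[OF that(1)] that(2)] that(3) by simp
  show "bij_betw (?i R) (Spf_power_series R) (Spf_power_series R)"
    by (rule bij_betw_inv_into[OF b[OF R]])
  show "?i R (mul' R x y) = mul R (?i R x) (?i R y)"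
    if x: "x \<in> Spf_power_series R" and y: "y \<in> Spf_power_series R" for x y
    by (rule unique[OF R G.mul_closed[OF R fi(2)[OF R x] fi(2)[OF R y]]])
      (simp add: law_isoD(2)[OF assms(2) R] fi R x y)
  show "?i T (g x) = g (?i R x)"
    if T: "T \<in> algs A" and g: "g \<in> alg_hom A R T" and x: "x \<in> Spf_power_series R" for T g x
    by (rule unique[OF T Spf_hom[OF R T g fi(2)[OF R x]]])
      (simp add: law_isoD(3)[OF assms(2) R T g] fi R x)
qed

section \<open>A valuation ring inside its fraction field\<close>

locale valuation_embedding =
  fixes \<O> K :: "'u ring" and \<iota> :: "'u \<Rightarrow> 'u"
  assumes inf: "infinite (UNIV :: 'u set)" and valuation: "is_valuation_ring_of \<O> K \<iota>"
begin

lemma domain_base: "domain \<O>" and field_frac: "field K" and emb: "\<iota> \<in> ring_hom \<O> K"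
  and emb_inj: "inj_on \<iota> (carrier \<O>)"
  using valuation by (simp_all add: is_valuation_ring_of_def is_fraction_field_def)

sublocale O: domain \<O> by (rule domain_base)
sublocale K: field K by (rule field_frac)
sublocale emb: ring_hom_cring \<O> K \<iota>
  by (intro ring_hom_cring.intro ring_hom_cring_axioms.intro O.is_cring K.is_cring emb)

lemma emb_eq_iff: "a \<in> carrier \<O> \<Longrightarrow> b \<in> carrier \<O> \<Longrightarrow> \<iota> a = \<iota> b \<longleftrightarrow> a = b"
  using emb_inj by (auto dest: inj_onD)

lemma inverse_integral:
  assumes "x \<in> carrier K" "x \<notin> \<iota> ` carrier \<O>"
  obtains r where "r \<in> carrier \<O>" "x \<otimes>\<^bsub>K\<^esub> \<iota> r = \<one>\<^bsub>K\<^esub>"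
proof -
  have x0: "x \<noteq> \<zero>\<^bsub>K\<^esub>" using assms(2) emb.hom_zero O.zero_closed by (metis imageI)
  hence "inv\<^bsub>K\<^esub> x \<in> \<iota> ` carrier \<O>"
    using valuation assms unfolding is_valuation_ring_of_def by blast
  then obtain r where r: "r \<in> carrier \<O>" "inv\<^bsub>K\<^esub> x = \<iota> r" by blast
  have "x \<in> Units K" using x0 assms(1) K.field_Units by simp
  hence "x \<otimes>\<^bsub>K\<^esub> \<iota> r = \<one>\<^bsub>K\<^esub>" using r(2) K.Units_r_inv by metis
  thus thesis using that r(1) by blast
qed

lemma dvd_total:
  assumes a: "a \<in> carrier \<O>" and b: "b \<in> carrier \<O>"
  shows "\<exists>c\<in>carrier \<O>. a = b \<otimes>\<^bsub>\<O>\<^esub> c \<or> b = a \<otimes>\<^bsub>\<O>\<^esub> c"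
proof (cases "b = \<zero>\<^bsub>\<O>\<^esub>")
  case True
  thus ?thesis using a by (intro bexI[of _ "\<zero>\<^bsub>\<O>\<^esub>"]) auto
next
  case False
  hence "\<iota> b \<noteq> \<zero>\<^bsub>K\<^esub>" using emb_eq_iff[OF b O.zero_closed] by simp
  hence u: "\<iota> b \<in> Units K" using b K.field_Units by simp
  define x where "x = \<iota> a \<otimes>\<^bsub>K\<^esub> inv\<^bsub>K\<^esub> (\<iota> b)"
  have x: "x \<in> carrier K" using a u by (simp add: x_def)
  have xb: "x \<otimes>\<^bsub>K\<^esub> \<iota> b = \<iota> a" using a b u by (simp add: x_def K.m_assoc)
  show ?thesis
  proof (cases "x \<in> \<iota> ` carrier \<O>")
    case True
    then obtain c where c: "c \<in> carrier \<O>" "x = \<iota> c" by blast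
    have "\<iota> a = \<iota> (b \<otimes>\<^bsub>\<O>\<^esub> c)" using xb c b by (simp add: K.m_comm)
    hence "a = b \<otimes>\<^bsub>\<O>\<^esub> c" using emb_eq_iff[of a "b \<otimes>\<^bsub>\<O>\<^esub> c"] a b c by simp
    thus ?thesis using c by blast
  next
    case False
    obtain r where r: "r \<in> carrier \<O>" "x \<otimes>\<^bsub>K\<^esub> \<iota> r = \<one>\<^bsub>K\<^esub>" using inverse_integral[OF x False] .
    have "\<iota> (a \<otimes>\<^bsub>\<O>\<^esub> r) = (x \<otimes>\<^bsub>K\<^esub> \<iota> r) \<otimes>\<^bsub>K\<^esub> \<iota> b"
      using a b r(1) x by (simp add: xb[symmetric] K.m_ac)
    hence "\<iota> b = \<iota> (a \<otimes>\<^bsub>\<O>\<^esub> r)" using r(2) b by simp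
    hence "b = a \<otimes>\<^bsub>\<O>\<^esub> r" using emb_eq_iff[of b "a \<otimes>\<^bsub>\<O>\<^esub> r"] a b r by simp
    thus ?thesis using r by blast
  qed
qed

text \<open>Divisibility is total, so a sum of two nonunits is a multiple of one of them. The
  nonunits thus form an ideal, which cannot contain generators of the unit ideal.\<close>

lemma unit_in_unit_ideal:
  assumes F: "F \<subseteq> carrier \<O>" "genideal \<O> F = carrier \<O>"
  obtains f where "f \<in> F" "f \<in> Units \<O>"
proof -
  define J where "J = carrier \<O> - Units \<O>"
  have mem: "x \<otimes>\<^bsub>\<O>\<^esub> a \<in> J" if "a \<in> J" "x \<in> carrier \<O>" for a x
  proof -
    have "a \<in> Units \<O>" if "x \<otimes>\<^bsub>\<O>\<^esub> a \<in> Units \<O>"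
      using O.prod_unit_r[of x a] O.unit_factor[of a x] \<open>a \<in> J\<close> \<open>x \<in> carrier \<O>\<close> that
      by (simp add: J_def O.m_comm)
    thus ?thesis using that by (auto simp: J_def)
  qed
  have "ideal J \<O>"
  proof (rule idealI)
    show "ring \<O>" by (rule O.ring_axioms)
    show "subgroup J (add_monoid \<O>)"
    proof (rule O.add.subgroupI)
      show "J \<subseteq> carrier \<O>" by (auto simp: J_def)
      have "\<zero>\<^bsub>\<O>\<^esub> \<in> J" using O.zero_not_one by (auto simp: J_def Units_def)
      thus "J \<noteq> {}" by blast
      fix a assume a: "a \<in> J"
      have ac: "a \<in> carrier \<O>" using a by (simp add: J_def)
      show "\<ominus>\<^bsub>\<O>\<^esub> a \<in> J" using mem[OF a, of "\<ominus>\<^bsub>\<O>\<^esub> \<one>\<^bsub>\<O>\<^esub>"] ac by (simp add: O.l_minus)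
      fix b assume b: "b \<in> J"
      have bc: "b \<in> carrier \<O>" using b by (simp add: J_def)
      obtain c where c: "c \<in> carrier \<O>" "a = b \<otimes>\<^bsub>\<O>\<^esub> c \<or> b = a \<otimes>\<^bsub>\<O>\<^esub> c" using dvd_total[OF ac bc] by blast
      from c(2) show "a \<oplus>\<^bsub>\<O>\<^esub> b \<in> J"
      proof
        assume "a = b \<otimes>\<^bsub>\<O>\<^esub> c"
        hence "a \<oplus>\<^bsub>\<O>\<^esub> b = (c \<oplus>\<^bsub>\<O>\<^esub> \<one>\<^bsub>\<O>\<^esub>) \<otimes>\<^bsub>\<O>\<^esub> b" using bc c(1) by (simp add: O.l_distr O.r_distr O.m_comm)
        thus ?thesis using mem[OF b] c(1) by simp
      next
        assume "b = a \<otimes>\<^bsub>\<O>\<^esub> c"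
        hence "a \<oplus>\<^bsub>\<O>\<^esub> b = (\<one>\<^bsub>\<O>\<^esub> \<oplus>\<^bsub>\<O>\<^esub> c) \<otimes>\<^bsub>\<O>\<^esub> a" using ac c(1) by (simp add: O.l_distr O.r_distr O.m_comm)
        thus ?thesis using mem[OF a] c(1) by simp
      qed
    qed
    show "x \<otimes>\<^bsub>\<O>\<^esub> a \<in> J" if "a \<in> J" "x \<in> carrier \<O>" for a x by (rule mem[OF that])
    show "a \<otimes>\<^bsub>\<O>\<^esub> x \<in> J" if "a \<in> J" "x \<in> carrier \<O>" for a x
      using mem[OF that] that O.m_comm[of a x] by (simp add: J_def)
  qed
  have "\<not> F \<subseteq> J"
  proof
    assume "F \<subseteq> J"
    hence "genideal \<O> F \<subseteq> J" by (rule O.genideal_minimal[OF \<open>ideal J \<O>\<close>])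
    thus False using F(2) O.one_closed O.Units_one_closed unfolding J_def by blast
  qed
  then obtain f where "f \<in> F" "f \<notin> J" by blast
  thus thesis using that F(1) by (auto simp: J_def)
qed

text \<open>Among the elements whose principal opens cover the spectrum there is a unit
  \<open>f\<close>; then \<open>D(f)\<close> is everything and the coordinate on it is
  global.\<close>

lemma ex_coordinate:
  assumes "formal_Lie_group \<O> G"
  obtains \<eta> where "coordinate_group \<O> G \<eta>"
proof -
  from assms have pre: "comm_group_presheaf \<O> G" and sh: "fppf_sheaf \<O> G"
    and "\<exists>F. finite F \<and> F \<subseteq> carrier \<O> \<and> genideal \<O> F = carrier \<O> \<and>
        (\<forall>f\<in>F. \<exists>\<eta>.
           (\<forall>R\<in>algs_over_D \<O> f.
              bij_betw (\<eta> R) (carrier (sections G R)) (Spf_power_series R) \<and>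
              \<eta> R \<one>\<^bsub>sections G R\<^esub> = \<zero>\<^bsub>fst R\<^esub>) \<and>
           (\<forall>R\<in>algs_over_D \<O> f. \<forall>T\<in>algs_over_D \<O> f. \<forall>g\<in>alg_hom \<O> R T.
              \<forall>x\<in>carrier (sections G R). \<eta> T (transition G R T g x) = g (\<eta> R x)))"
    unfolding formal_Lie_group_def formal_Lie_variety_def by simp_all
  then obtain F where F: "F \<subseteq> carrier \<O>" "genideal \<O> F = carrier \<O>" and
    loc: "\<forall>f\<in>F. \<exists>\<eta>.
           (\<forall>R\<in>algs_over_D \<O> f.
              bij_betw (\<eta> R) (carrier (sections G R)) (Spf_power_series R) \<and>
              \<eta> R \<one>\<^bsub>sections G R\<^esub> = \<zero>\<^bsub>fst R\<^esub>) \<and>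
           (\<forall>R\<in>algs_over_D \<O> f. \<forall>T\<in>algs_over_D \<O> f. \<forall>g\<in>alg_hom \<O> R T.
              \<forall>x\<in>carrier (sections G R). \<eta> T (transition G R T g x) = g (\<eta> R x))"
    by (elim exE conjE)
  obtain f where f: "f \<in> F" "f \<in> Units \<O>" using unit_in_unit_ideal[OF F] .
  have "algs_over_D \<O> f = algs \<O>"
  proof -
    have "snd R f \<in> Units (fst R)" if R: "R \<in> algs \<O>" for R
    proof -
      interpret R: cring "fst R" using algsD(1)[OF R] .
      interpret r: ring_hom_cring \<O> "fst R" "snd R"
        by (intro ring_hom_cring.intro ring_hom_cring_axioms.intro O.is_cring R.is_cring algsD(2)[OF R])
      obtain g where g: "g \<in> carrier \<O>" "f \<otimes>\<^bsub>\<O>\<^esub> g = \<one>\<^bsub>\<O>\<^esub>" "f \<in> carrier \<O>"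
        using f(2) O.Units_r_inv_ex O.Units_closed by blast
      hence "snd R f \<otimes>\<^bsub>fst R\<^esub> snd R g = \<one>\<^bsub>fst R\<^esub>" using r.hom_mult[of f g] r.hom_one by simp
      thus ?thesis using g R.m_comm[of "snd R f" "snd R g"] by (auto simp: Units_def)
    qed
    thus ?thesis by (auto simp: algs_over_D_def)
  qed
  with bspec[OF loc f(1)] have "\<exists>\<eta>. global_coordinate \<O> G \<eta>"
    unfolding global_coordinate_def by simp
  then obtain \<eta> where "global_coordinate \<O> G \<eta>" by blast
  hence "coordinate_group \<O> G \<eta>"
    by (intro coordinate_group.intro inf O.is_cring pre sh)
  thus thesis by (rule that)
qed

end

section \<open>The series of multiplication by p at height h\<close>

lemma mult_by_base_change_law:
  assumes "formal_group_law A mul" "formal_group_law B (base_change_law A f mul)"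
  shows "formal_group_law.mult_by (base_change_law A f mul) n R
    = formal_group_law.mult_by mul n (restrict_scalars A f R)"
  by (intro ext) (simp only: formal_group_law.mult_by_def[OF assms(1)] formal_group_law.mult_by_def[OF assms(2)]
      pts_base_change_law)

text \<open>The linear coefficient of \<open>[p]\<close> is \<open>p\<close> itself, and
  \<open>1 < p^h\<close> because \<open>h \<ge> 1\<close>, so it vanishes with all coefficients
  below \<open>p^h\<close>. Characteristic \<open>p\<close> then permits the use of
  \<open>mult_by_sparse\<close>, over \<open>A\<close> and also over the quotient by the coefficient
  at \<open>p^h\<close>.\<close>

lemma (in coordinate_group) height_expansion:
  assumes p: "Factorial_Ring.prime p" and h: "1 \<le> h" and ht: "has_height A p h G"
    and a: "represents A (law.mult_by p) a"
  shows "add_pow A p \<one>\<^bsub>A\<^esub> = \<zero>\<^bsub>A\<^esub>" "\<And>i. \<not> p ^ h dvd i \<Longrightarrow> a i = \<zero>\<^bsub>A\<^esub>" "a (p ^ h) \<in> Units A"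
proof -
  note p1 = prime_gt_1_nat[OF p] prime_gt_0_nat[OF p]
  note ac = representsD(1)[OF a]
  note a01 = law.mult_by_linear_coeff[OF a]
  interpret A: cring A by (rule cring_base)
  have low: "a i = \<zero>\<^bsub>A\<^esub>" if "i < p ^ h" for i
    using has_height_iff[OF a p1(2)] ht that by blast
  have ex: "\<exists>i<p ^ (h + 1). snd R (a i) \<noteq> \<zero>\<^bsub>fst R\<^esub>" if "R \<in> algs A" "\<one>\<^bsub>fst R\<^esub> \<noteq> \<zero>\<^bsub>fst R\<^esub>" for R
    using has_height_iff[OF a p1(2)] ht that by blast
  have "1 < p ^ h" using one_less_power[OF p1(1), of h] h by simp
  thus char: "add_pow A p \<one>\<^bsub>A\<^esub> = \<zero>\<^bsub>A\<^esub>" using low[of 1] a01(2) by simp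
  have "a (p ^ k) = \<zero>\<^bsub>A\<^esub>" if "k < h" for k
    by (rule low) (use that p1(1) in \<open>simp add: power_strict_increasing\<close>)
  from law.mult_by_sparse[OF p char a this]
  show sparse: "\<And>i. \<not> p ^ h dvd i \<Longrightarrow> a i = \<zero>\<^bsub>A\<^esub>" by blast
  show "a (p ^ h) \<in> Units A"
  proof (rule ccontr)
    assume nu: "a (p ^ h) \<notin> Units A"
    define t where "t = a (p ^ h)"
    have t: "t \<in> carrier A" using ac by (auto simp: t_def)
    obtain Q :: "'u ring" and q where Q: "cring Q" "q \<in> ring_hom A Q" "q \<in> extensional (carrier A)"
      "q ` carrier A = carrier Q" "\<forall>r\<in>carrier A. q r = \<zero>\<^bsub>Q\<^esub> \<longleftrightarrow> r \<in> PIdl\<^bsub>A\<^esub> t"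
      using ex_quotient[OF A.is_cring A.cgenideal_ideal[OF t]] .
    have Qa: "(Q, q) \<in> algs A" using Q by (intro algsI)
    have "\<one>\<^bsub>A\<^esub> \<notin> PIdl\<^bsub>A\<^esub> t"
    proof
      assume "\<one>\<^bsub>A\<^esub> \<in> PIdl\<^bsub>A\<^esub> t"
      then obtain r where "r \<in> carrier A" "\<one>\<^bsub>A\<^esub> = r \<otimes>\<^bsub>A\<^esub> t" by (auto simp: cgenideal_def)
      hence "t \<in> Units A" using t A.m_comm[of r t] by (auto simp: Units_def)
      thus False using nu by (simp add: t_def)
    qed
    hence "\<one>\<^bsub>Q\<^esub> \<noteq> \<zero>\<^bsub>Q\<^esub>" using Q(5) ring_hom_one[OF Q(2)] A.one_closed by metis
    then obtain i where i: "i < p ^ (h + 1)" "q (a i) \<noteq> \<zero>\<^bsub>Q\<^esub>" using ex[OF Qa] by auto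
    interpret Q: formal_group_law Q "base_change_law A q (coord_law G \<eta>)"
      by (rule law.base_change[OF Q(1,2)])
    have q0: "q \<zero>\<^bsub>A\<^esub> = \<zero>\<^bsub>Q\<^esub>" by (rule ring_hom_zero'[OF A.is_cring Q(1,2)])
    have rep: "represents Q (Q.mult_by p) (\<lambda>i. q (a i))"
      using represents_restrict_scalars[OF A.is_cring Q(2) a]
      unfolding mult_by_base_change_law[OF law.formal_group_law_axioms Q.formal_group_law_axioms, abs_def] .
    \<comment> \<open>Over \<open>Q\<close> the coefficients at \<open>p^0, ..., p^h\<close> all
      vanish, so only multiples of \<open>p^(h + 1)\<close> can carry a nonzero coefficient. The
      index \<open>i\<close> supplied by exactness of the height is smaller and not
      \<open>0\<close>.\<close>
    have "\<not> p ^ (h + 1) dvd i"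
    proof
      assume "p ^ (h + 1) dvd i"
      hence "i = 0" using i(1) by (auto dest: dvd_imp_le)
      thus False using i(2) a01(1) q0 by simp
    qed
    moreover have "q (a (p ^ k)) = \<zero>\<^bsub>Q\<^esub>" if "k < h + 1" for k
    proof (cases "k = h")
      case True
      thus ?thesis using Q(5) t A.cgenideal_self[OF t] by (simp add: t_def)
    next
      case False
      hence "p ^ k < p ^ h" using that p1(1) by (simp add: power_strict_increasing)
      thus ?thesis using low q0 by simp
    qed
    ultimately show False
      using Q.mult_by_sparse[OF p ring_hom_char[OF A.is_cring Q(1,2) char] rep] i(2) by blast
  qed
qed

section \<open>Integrality of the coefficients\<close>

text \<open>Comparison of the coefficients of \<open>T\<^sup>q\<^sup>n\<close> in \<open>f([p](T)) = [p]'(f(T))\<close>, where \<open>[p]\<close> and \<open>[p]'\<close> are series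
  in \<open>T\<^sup>q\<close>. Everything that only involves \<open>f\<^sub>0, \<dots>, f\<^sub>n\<^sub>-\<^sub>1\<close> lies in the image of the truncated polynomial
  ring over \<open>\<O>\<close>.\<close>

lemma (in valuation_embedding) coefficient_relation:
  assumes p: "Factorial_Ring.prime p" "add_pow K p \<one>\<^bsub>K\<^esub> = \<zero>\<^bsub>K\<^esub>" and q: "q = p ^ h" and n: "0 < n"
    and a: "a \<in> UNIV \<rightarrow> carrier \<O>" "\<And>i. \<not> q dvd i \<Longrightarrow> a i = \<zero>\<^bsub>\<O>\<^esub>" "a 0 = \<zero>\<^bsub>\<O>\<^esub>"
    and b: "b \<in> UNIV \<rightarrow> carrier \<O>" "\<And>i. \<not> q dvd i \<Longrightarrow> b i = \<zero>\<^bsub>\<O>\<^esub>"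
    and s: "s \<in> UNIV \<rightarrow> carrier K" "s 0 = \<zero>\<^bsub>K\<^esub>" "\<And>i. i < n \<Longrightarrow> s i \<in> \<iota> ` carrier \<O>"
    and t: "is_trunc K (q * n + 1) P c Z"
    and eq: "peval P (q * n + 1) (\<lambda>i. c (s i)) (peval P (q * n + 1) (\<lambda>i. c (\<iota> (a i))) Z)
      = peval P (q * n + 1) (\<lambda>i. c (\<iota> (b i))) (peval P (q * n + 1) (\<lambda>i. c (s i)) Z)"
  shows "s n \<otimes>\<^bsub>K\<^esub> \<iota> (a q) [^]\<^bsub>K\<^esub> n \<ominus>\<^bsub>K\<^esub> \<iota> (b q) \<otimes>\<^bsub>K\<^esub> s n [^]\<^bsub>K\<^esub> q \<in> \<iota> ` carrier \<O>"
proof -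
  \<comment> \<open>This order keeps \<open>Z^(q n)\<close> as the last nonzero power, the one whose
    coefficients are compared.\<close>
  define N where "N = q * n + 1"
  have p1: "1 < p" "0 < p" using prime_gt_1_nat[OF p(1)] prime_gt_0_nat[OF p(1)] .
  have q0: "0 < q" using p1 by (simp add: q)
  have qN: "q < N" using n by (cases n) (simp_all add: N_def)
  note t = t[folded N_def] and T = is_truncD[OF t[folded N_def]]
  interpret P: cring P by (rule T)
  obtain P0 c0 Z0 where t0: "is_trunc \<O> N P0 c0 Z0" using ex_trunc[OF inf O.is_cring] by blast
  note T0 = is_truncD[OF t0]
  interpret P0: cring P0 by (rule T0)
  obtain g where g: "g \<in> ring_hom P0 P" "\<And>r. r \<in> carrier \<O> \<Longrightarrow> g (c0 r) = c (\<iota> r)" "g Z0 = Z"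
    using trunc_map[OF t0 t emb] by metis
  \<comment> \<open>The elements with integral coefficients form a subring containing
    \<open>Z\<close>; terms lying in it may be dropped from the comparison.\<close>
  define M where "M = g ` carrier P0"
  have Mc: "y \<in> carrier P" if "y \<in> M" for y using that ring_hom_closed[OF g(1)] by (auto simp: M_def)
  have Madd: "x \<oplus>\<^bsub>P\<^esub> y \<in> M" if "x \<in> M" "y \<in> M" for x y
    using that ring_hom_add[OF g(1)] unfolding M_def by (metis (no_types, lifting) P0.a_closed imageE imageI)
  have Mmult: "x \<otimes>\<^bsub>P\<^esub> y \<in> M" if "x \<in> M" "y \<in> M" for x y
    using that ring_hom_mult[OF g(1)] unfolding M_def by (metis (no_types, lifting) P0.m_closed imageE imageI)
  have Mone: "\<one>\<^bsub>P\<^esub> \<in> M" using ring_hom_one[OF g(1)] unfolding M_def by (metis P0.one_closed imageI)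
  have Mzero: "\<zero>\<^bsub>P\<^esub> \<in> M" using ring_hom_zero'[OF T0(2) T(2) g(1)] unfolding M_def by (metis P0.zero_closed imageI)
  have Mpow: "x [^]\<^bsub>P\<^esub> (k::nat) \<in> M" if "x \<in> M" for x k
    by (induction k) (simp_all add: Mone Mmult that)
  have Mneg: "\<ominus>\<^bsub>P\<^esub> x \<in> M" if "x \<in> M" for x
  proof -
    obtain y where y: "y \<in> carrier P0" "x = g y" using \<open>x \<in> M\<close> by (auto simp: M_def)
    interpret g: ring_hom_cring P0 P g
      by (intro ring_hom_cring.intro ring_hom_cring_axioms.intro T0(2) T(2) g(1))
    have "\<ominus>\<^bsub>P\<^esub> x = g (\<ominus>\<^bsub>P0\<^esub> y)" using y by simp
    thus ?thesis unfolding M_def using P0.a_inv_closed[OF y(1)] by (metis imageI)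
  qed
  have Mconst: "c (\<iota> r) \<in> M" if "r \<in> carrier \<O>" for r
    unfolding M_def g(2)[OF that, symmetric] using ring_hom_closed[OF T0(3) that] by simp
  have MZ: "Z \<in> M" unfolding M_def g(3)[symmetric] using T0(5) by simp
  have Mpeval: "peval P m d y \<in> M"
    if "d \<in> UNIV \<rightarrow> carrier P" "\<And>i. i < m \<Longrightarrow> d i \<in> M" "y \<in> M" for m d y
    using that(2)
  proof (induction m)
    case (Suc m)
    show ?case unfolding P.peval_Suc[OF that(1) Mc[OF that(3)]]
      using Suc that(3) by (intro Madd Mmult Mpow) auto
  qed (simp add: Mzero)
  have si: "s i \<in> carrier K" for i using s(1) by auto
  have ai: "a i \<in> carrier \<O>" and bi: "b i \<in> carrier \<O>" for i using a(1) b(1) by auto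
  have cc [simp]: "c x \<in> carrier P" if "x \<in> carrier K" for x using ring_hom_closed[OF T(3) that] .
  have Zc [simp]: "Z \<in> carrier P" by (rule T(5))
  have cs: "(\<lambda>i. c (s i)) \<in> UNIV \<rightarrow> carrier P" by (rule T(7)[OF s(1)])
  have ca: "(\<lambda>i. c (\<iota> (a i))) \<in> UNIV \<rightarrow> carrier P" using ai by simp
  have cb: "(\<lambda>i. c (\<iota> (b i))) \<in> UNIV \<rightarrow> carrier P" using bi by simp
  have c0z: "c \<zero>\<^bsub>K\<^esub> = \<zero>\<^bsub>P\<^esub>" by (rule ring_hom_zero'[OF T(1-3)])
  have sM: "c (s i) \<in> M" if "i < n" for i
    using s(3)[OF that] Mconst by auto
  have Zbig: "Z [^]\<^bsub>P\<^esub> m = \<zero>\<^bsub>P\<^esub>" if "q * n < m" for m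
    by (rule P.nat_pow_zero_mono[OF Zc T(6)]) (use that in \<open>simp add: N_def\<close>)

  define u where "u = peval P N (\<lambda>i. c (\<iota> (a i))) Z"
  define r where "r = peval P (N - q) (\<lambda>i. c (\<iota> (a (i + q)))) Z"
  have alow: "a i = \<zero>\<^bsub>\<O>\<^esub>" if "i < q" for i
    using a(2)[of i] a(3) that nat_dvd_not_less[of i q] by (cases "i = 0") auto
  have u: "u = Z [^]\<^bsub>P\<^esub> q \<otimes>\<^bsub>P\<^esub> r"
    unfolding u_def r_def by (rule P.peval_shift[OF ca Zc]) (use qN alow c0z in auto)
  have ca': "(\<lambda>i. c (\<iota> (a (i + q)))) \<in> UNIV \<rightarrow> carrier P" using ai by simp
  have rc [simp]: "r \<in> carrier P" unfolding r_def by (rule P.peval_closed[OF ca' Zc])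
  have uM: "u \<in> M" unfolding u_def by (rule Mpeval[OF ca _ MZ]) (simp add: Mconst ai)
  note uc [simp] = Mc[OF uM]
  define r1 where "r1 = peval P (N - q - 1) (\<lambda>i. c (\<iota> (a (i + 1 + q)))) Z"
  have ca'': "(\<lambda>i. c (\<iota> (a (i + 1 + q)))) \<in> UNIV \<rightarrow> carrier P" using ai by simp
  have r1c [simp]: "r1 \<in> carrier P" unfolding r1_def by (rule P.peval_closed[OF ca'' Zc])
  have r: "r = c (\<iota> (a q)) \<oplus>\<^bsub>P\<^esub> Z \<otimes>\<^bsub>P\<^esub> r1"
  proof -
    let ?d = "\<lambda>i. if i = 0 then \<zero>\<^bsub>P\<^esub> else c (\<iota> (a (i + q)))"
    let ?e = "\<lambda>i. if i = 0 then c (\<iota> (a q)) else \<zero>\<^bsub>P\<^esub>"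
    have d: "?d \<in> UNIV \<rightarrow> carrier P" and e: "?e \<in> (UNIV :: nat set) \<rightarrow> carrier P" using ai by auto
    have "(\<lambda>i. ?e i \<oplus>\<^bsub>P\<^esub> ?d i) = (\<lambda>i. c (\<iota> (a (i + q))))" using ai by auto
    hence "r = peval P (N - q) ?e Z \<oplus>\<^bsub>P\<^esub> peval P (N - q) ?d Z"
      using P.peval_add[OF e d Zc, of "N - q"] by (simp add: r_def)
    also have "peval P (N - q) ?e Z = c (\<iota> (a q))"
      using P.peval_single[of "c (\<iota> (a q))" Z 0 "N - q"] ai qN by simp
    also have "peval P (N - q) ?d Z = Z [^]\<^bsub>P\<^esub> (1::nat) \<otimes>\<^bsub>P\<^esub> peval P (N - q - 1) (\<lambda>i. ?d (i + 1)) Z"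
      by (rule P.peval_shift[OF d Zc]) (use qN in auto)
    finally show ?thesis by (simp add: r1_def)
  qed
  \<comment> \<open>The product of \<open>Z^(q n)\<close> and \<open>Z\<close> vanishes, so next to
    \<open>Z^(q n)\<close> only the constant coefficient of \<open>r\<close> survives.\<close>
  have Zr: "Z [^]\<^bsub>P\<^esub> (q * n) \<otimes>\<^bsub>P\<^esub> r [^]\<^bsub>P\<^esub> k = c (\<iota> (a q) [^]\<^bsub>K\<^esub> k) \<otimes>\<^bsub>P\<^esub> Z [^]\<^bsub>P\<^esub> (q * n)" for k :: nat
  proof (induction k)
    case 0
    show ?case using ring_hom_one[OF T(3)] by simp
  next
    case (Suc k)
    let ?z = "Z [^]\<^bsub>P\<^esub> (q * n)"
    have "?z \<otimes>\<^bsub>P\<^esub> Z = \<zero>\<^bsub>P\<^esub>" using Zbig[of "Suc (q * n)"] by simp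
    hence zz: "?z \<otimes>\<^bsub>P\<^esub> (Z \<otimes>\<^bsub>P\<^esub> r1) = \<zero>\<^bsub>P\<^esub>" by (simp add: P.m_assoc[symmetric])
    have zr: "?z \<otimes>\<^bsub>P\<^esub> r = ?z \<otimes>\<^bsub>P\<^esub> c (\<iota> (a q))"
      unfolding r using zz ai by (simp add: P.r_distr)
    have "?z \<otimes>\<^bsub>P\<^esub> r [^]\<^bsub>P\<^esub> Suc k = (?z \<otimes>\<^bsub>P\<^esub> r [^]\<^bsub>P\<^esub> k) \<otimes>\<^bsub>P\<^esub> r" by (simp add: P.m_assoc)
    also have "\<dots> = c (\<iota> (a q) [^]\<^bsub>K\<^esub> k) \<otimes>\<^bsub>P\<^esub> (?z \<otimes>\<^bsub>P\<^esub> r)"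
      unfolding Suc using ai by (simp add: P.m_assoc)
    also have "\<dots> = c (\<iota> (a q) [^]\<^bsub>K\<^esub> Suc k) \<otimes>\<^bsub>P\<^esub> ?z"
      unfolding zr using ai by (simp add: ring_hom_mult[OF T(3)] P.m_ac)
    finally show ?case .
  qed
  have upow: "u [^]\<^bsub>P\<^esub> m = Z [^]\<^bsub>P\<^esub> (q * m) \<otimes>\<^bsub>P\<^esub> r [^]\<^bsub>P\<^esub> m" for m :: nat
    unfolding u by (simp add: P.nat_pow_distrib P.nat_pow_pow)
  \<comment> \<open>As \<open>u\<close> is divisible by \<open>Z^q\<close>, the value of
    \<open>s\<close> at \<open>u\<close> ends with the term of index \<open>n\<close>.\<close>
  have un1: "u [^]\<^bsub>P\<^esub> (Suc n) = \<zero>\<^bsub>P\<^esub>"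
    unfolding upow using Zbig[of "q * Suc n"] q0 by (simp del: P.nat_pow_Suc)
  have nN: "Suc n \<le> N" using q0 by (simp add: N_def)
  have L: "peval P N (\<lambda>i. c (s i)) u = c (s n \<otimes>\<^bsub>K\<^esub> \<iota> (a q) [^]\<^bsub>K\<^esub> n) \<otimes>\<^bsub>P\<^esub> Z [^]\<^bsub>P\<^esub> (q * n)
      \<oplus>\<^bsub>P\<^esub> peval P n (\<lambda>i. c (s i)) u"
  proof -
    have "peval P N (\<lambda>i. c (s i)) u = peval P (Suc n) (\<lambda>i. c (s i)) u"
      by (rule P.peval_mono[OF cs uc un1 nN])
    also have "\<dots> = c (s n) \<otimes>\<^bsub>P\<^esub> u [^]\<^bsub>P\<^esub> n \<oplus>\<^bsub>P\<^esub> peval P n (\<lambda>i. c (s i)) u"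
      by (rule P.peval_Suc[OF cs uc])
    also have "c (s n) \<otimes>\<^bsub>P\<^esub> u [^]\<^bsub>P\<^esub> n = c (s n) \<otimes>\<^bsub>P\<^esub> (c (\<iota> (a q) [^]\<^bsub>K\<^esub> n) \<otimes>\<^bsub>P\<^esub> Z [^]\<^bsub>P\<^esub> (q * n))"
      unfolding upow Zr ..
    also have "\<dots> = c (s n \<otimes>\<^bsub>K\<^esub> \<iota> (a q) [^]\<^bsub>K\<^esub> n) \<otimes>\<^bsub>P\<^esub> Z [^]\<^bsub>P\<^esub> (q * n)"
      using si ai by (simp add: ring_hom_mult[OF T(3)] P.m_assoc)
    finally show ?thesis .
  qed

  define v where "v = peval P N (\<lambda>i. c (s i)) Z"
  have vc [simp]: "v \<in> carrier P" unfolding v_def by (rule P.peval_closed[OF cs Zc])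
  have charP: "add_pow P p \<one>\<^bsub>P\<^esub> = \<zero>\<^bsub>P\<^esub>" by (rule ring_hom_char[OF T(1-3) p(2)])
  define sq where "sq i = c (s i) [^]\<^bsub>P\<^esub> q" for i
  have sq: "sq \<in> UNIV \<rightarrow> carrier P" using si by (simp add: sq_def)
  have sq0: "sq 0 = \<zero>\<^bsub>P\<^esub>" using s(2) c0z q0 by (simp add: sq_def P.nat_pow_zero)
  define w where "w = peval P n sq (Z [^]\<^bsub>P\<^esub> q)"
  \<comment> \<open>The summand of \<open>v^q\<close> that contains \<open>s n\<close>. It sits in
    the top degree and is annihilated by every positive power of \<open>Z\<close>.\<close>
  define E where "E = c (s n [^]\<^bsub>K\<^esub> q) \<otimes>\<^bsub>P\<^esub> Z [^]\<^bsub>P\<^esub> (q * n)"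
  have Ec [simp]: "E \<in> carrier P" using si by (simp add: E_def)
  have wM: "w \<in> M" unfolding w_def by (rule Mpeval[OF sq _ Mpow[OF MZ]]) (simp add: sq_def Mpow sM)
  note wc [simp] = Mc[OF wM]
  have Zqn: "(Z [^]\<^bsub>P\<^esub> q) [^]\<^bsub>P\<^esub> (Suc n) = \<zero>\<^bsub>P\<^esub>"
    unfolding P.nat_pow_pow[OF Zc] by (rule Zbig) (use q0 in simp)
  have vq: "v [^]\<^bsub>P\<^esub> q = E \<oplus>\<^bsub>P\<^esub> w"
  proof -
    have "v [^]\<^bsub>P\<^esub> q = peval P N sq (Z [^]\<^bsub>P\<^esub> q)"
      unfolding v_def sq_def q by (rule P.frobenius_peval[OF p(1) charP cs Zc])
    also have "\<dots> = peval P (Suc n) sq (Z [^]\<^bsub>P\<^esub> q)"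
      by (rule P.peval_mono[OF sq _ Zqn nN]) simp
    also have "\<dots> = sq n \<otimes>\<^bsub>P\<^esub> (Z [^]\<^bsub>P\<^esub> q) [^]\<^bsub>P\<^esub> n \<oplus>\<^bsub>P\<^esub> w"
      unfolding w_def by (rule P.peval_Suc[OF sq]) simp
    also have "sq n = c (s n [^]\<^bsub>K\<^esub> q)"
      unfolding sq_def by (rule ring_hom_nat_pow[OF T(1-3) si, symmetric])
    finally show ?thesis by (simp add: E_def P.nat_pow_pow)
  qed
  have ZE: "E \<otimes>\<^bsub>P\<^esub> Z [^]\<^bsub>P\<^esub> m = \<zero>\<^bsub>P\<^esub>" if "0 < m" for m :: nat
  proof -
    have "E \<otimes>\<^bsub>P\<^esub> Z [^]\<^bsub>P\<^esub> m = c (s n [^]\<^bsub>K\<^esub> q) \<otimes>\<^bsub>P\<^esub> Z [^]\<^bsub>P\<^esub> (q * n + m)"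
      using si by (simp add: E_def P.m_assoc P.nat_pow_mult)
    thus ?thesis using Zbig[of "q * n + m"] that si by simp
  qed
  have EE: "E \<otimes>\<^bsub>P\<^esub> E = \<zero>\<^bsub>P\<^esub>"
  proof -
    have "E \<otimes>\<^bsub>P\<^esub> E = c (s n [^]\<^bsub>K\<^esub> q) \<otimes>\<^bsub>P\<^esub> (E \<otimes>\<^bsub>P\<^esub> Z [^]\<^bsub>P\<^esub> (q * n))"
      using si Ec by (subst (2) E_def) (simp add: P.m_lcomm)
    thus ?thesis using ZE[of "q * n"] q0 n si by simp
  qed
  have Ew: "E \<otimes>\<^bsub>P\<^esub> w = \<zero>\<^bsub>P\<^esub>"
  proof -
    have "w = (Z [^]\<^bsub>P\<^esub> q) [^]\<^bsub>P\<^esub> (1::nat) \<otimes>\<^bsub>P\<^esub> peval P (n - 1) (\<lambda>i. sq (i + 1)) (Z [^]\<^bsub>P\<^esub> q)"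
      unfolding w_def by (rule P.peval_shift[OF sq]) (use n sq0 in auto)
    moreover have "(\<lambda>i. sq (i + 1)) \<in> UNIV \<rightarrow> carrier P" using sq by auto
    hence "peval P (n - 1) (\<lambda>i. sq (i + 1)) (Z [^]\<^bsub>P\<^esub> q) \<in> carrier P" by (rule P.peval_closed) simp
    ultimately show ?thesis using ZE[OF q0] by (simp add: P.m_assoc[symmetric])
  qed
  \<comment> \<open>\<open>E\<close> annihilates both itself and \<open>w\<close>, so in the
    \<open>j\<close>-th power of \<open>E + w\<close> it survives only for
    \<open>j = 1\<close>.\<close>
  have vpow: "v [^]\<^bsub>P\<^esub> (q * j) = (if j = 1 then E else \<zero>\<^bsub>P\<^esub>) \<oplus>\<^bsub>P\<^esub> w [^]\<^bsub>P\<^esub> j" for j :: nat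
  proof (induction j)
    case (Suc j)
    have wj: "E \<otimes>\<^bsub>P\<^esub> w [^]\<^bsub>P\<^esub> j = (if j = 0 then E else \<zero>\<^bsub>P\<^esub>)"
      using Ew by (cases j) (simp_all add: P.m_lcomm[of E] P.m_comm[of _ w] P.m_assoc[symmetric])
    have "v [^]\<^bsub>P\<^esub> (q * Suc j) = v [^]\<^bsub>P\<^esub> q \<otimes>\<^bsub>P\<^esub> v [^]\<^bsub>P\<^esub> (q * j)"
      by (simp add: P.nat_pow_mult)
    also have "\<dots> = (E \<oplus>\<^bsub>P\<^esub> w) \<otimes>\<^bsub>P\<^esub> ((if j = 1 then E else \<zero>\<^bsub>P\<^esub>) \<oplus>\<^bsub>P\<^esub> w [^]\<^bsub>P\<^esub> j)"
      unfolding vq Suc ..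
    also have "\<dots> = (if j = 0 then E else \<zero>\<^bsub>P\<^esub>) \<oplus>\<^bsub>P\<^esub> w [^]\<^bsub>P\<^esub> Suc j"
      using wj EE Ew by (auto simp: P.l_distr P.r_distr P.m_comm)
    finally show ?case by simp
  qed simp
  \<comment> \<open>Apart from the one term at index \<open>q\<close>, everything that the series
    \<open>b\<close> contributes is integral.\<close>
  have Rm: "\<exists>y\<in>M. peval P m (\<lambda>i. c (\<iota> (b i))) v = (if q < m then c (\<iota> (b q)) \<otimes>\<^bsub>P\<^esub> E else \<zero>\<^bsub>P\<^esub>) \<oplus>\<^bsub>P\<^esub> y" for m
  proof (induction m)
    case 0
    show ?case using Mzero by (intro bexI[of _ "\<zero>\<^bsub>P\<^esub>"]) auto
  next
    case (Suc m)
    then obtain y where y: "y \<in> M" "peval P m (\<lambda>i. c (\<iota> (b i))) v = (if q < m then c (\<iota> (b q)) \<otimes>\<^bsub>P\<^esub> E else \<zero>\<^bsub>P\<^esub>) \<oplus>\<^bsub>P\<^esub> y"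
      by blast
    note yc [simp] = Mc[OF y(1)]
    have step: "peval P (Suc m) (\<lambda>i. c (\<iota> (b i))) v = c (\<iota> (b m)) \<otimes>\<^bsub>P\<^esub> v [^]\<^bsub>P\<^esub> m \<oplus>\<^bsub>P\<^esub> peval P m (\<lambda>i. c (\<iota> (b i))) v"
      by (rule P.peval_Suc[OF cb vc])
    have bE [simp]: "c (\<iota> (b i)) \<otimes>\<^bsub>P\<^esub> E \<in> carrier P" for i using bi by simp
    show ?case
    proof (cases "q dvd m")
      case False
      hence "b m = \<zero>\<^bsub>\<O>\<^esub>" "m \<noteq> q" using b(2) by auto
      thus ?thesis using y unfolding step by (intro bexI[of _ y]) (auto simp: c0z less_Suc_eq)
    next
      case True
      then obtain j where j: "m = q * j" by blast
      have jq: "j = 1 \<longleftrightarrow> m = q" using q0 by (auto simp: j)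
      let ?y = "c (\<iota> (b m)) \<otimes>\<^bsub>P\<^esub> w [^]\<^bsub>P\<^esub> j"
      have yM: "?y \<in> M" by (intro Mmult Mpow Mconst wM bi)
      note [simp] = Mc[OF yM]
      have "c (\<iota> (b m)) \<otimes>\<^bsub>P\<^esub> v [^]\<^bsub>P\<^esub> m = (if m = q then c (\<iota> (b q)) \<otimes>\<^bsub>P\<^esub> E else \<zero>\<^bsub>P\<^esub>) \<oplus>\<^bsub>P\<^esub> ?y"
        using vpow[of j] bi jq by (auto simp: j[symmetric] P.r_distr)
      hence "peval P (Suc m) (\<lambda>i. c (\<iota> (b i))) v = (if q < Suc m then c (\<iota> (b q)) \<otimes>\<^bsub>P\<^esub> E else \<zero>\<^bsub>P\<^esub>) \<oplus>\<^bsub>P\<^esub> (?y \<oplus>\<^bsub>P\<^esub> y)"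
        unfolding step y(2) by (auto simp: P.a_ac less_Suc_eq)
      thus ?thesis using Madd[OF yM y(1)] by blast
    qed
  qed
  obtain y2 where y2: "y2 \<in> M" "peval P N (\<lambda>i. c (\<iota> (b i))) v = c (\<iota> (b q)) \<otimes>\<^bsub>P\<^esub> E \<oplus>\<^bsub>P\<^esub> y2"
    using Rm[of N] qN by auto
  define y1 where "y1 = peval P n (\<lambda>i. c (s i)) u"
  have y1: "y1 \<in> M" unfolding y1_def by (rule Mpeval[OF cs sM uM])
  note [simp] = Mc[OF y1] Mc[OF y2(1)]
  define A where "A = s n \<otimes>\<^bsub>K\<^esub> \<iota> (a q) [^]\<^bsub>K\<^esub> n"
  define B where "B = \<iota> (b q) \<otimes>\<^bsub>K\<^esub> s n [^]\<^bsub>K\<^esub> q"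
  have AB: "A \<in> carrier K" "B \<in> carrier K" using si ai bi by (simp_all add: A_def B_def)
  let ?z = "Z [^]\<^bsub>P\<^esub> (q * n)"
  have bE: "c (\<iota> (b q)) \<otimes>\<^bsub>P\<^esub> E = c B \<otimes>\<^bsub>P\<^esub> ?z"
    using si bi by (simp add: E_def B_def ring_hom_mult[OF T(3)] P.m_assoc)
  have main: "c A \<otimes>\<^bsub>P\<^esub> ?z \<oplus>\<^bsub>P\<^esub> y1 = c B \<otimes>\<^bsub>P\<^esub> ?z \<oplus>\<^bsub>P\<^esub> y2"
    using eq[folded N_def, folded u_def v_def] L y2(2) bE by (simp add: A_def y1_def)
  interpret c: ring_hom_cring K P c
    by (intro ring_hom_cring.intro ring_hom_cring_axioms.intro T(1-3))
  have z: "c (A \<ominus>\<^bsub>K\<^esub> B) \<otimes>\<^bsub>P\<^esub> ?z = y2 \<oplus>\<^bsub>P\<^esub> \<ominus>\<^bsub>P\<^esub> y1"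
  proof -
    have "c (A \<ominus>\<^bsub>K\<^esub> B) \<otimes>\<^bsub>P\<^esub> ?z = (c A \<otimes>\<^bsub>P\<^esub> ?z \<oplus>\<^bsub>P\<^esub> y1) \<oplus>\<^bsub>P\<^esub> \<ominus>\<^bsub>P\<^esub> (c B \<otimes>\<^bsub>P\<^esub> ?z) \<oplus>\<^bsub>P\<^esub> \<ominus>\<^bsub>P\<^esub> y1"
    proof -
      have "c (A \<ominus>\<^bsub>K\<^esub> B) \<otimes>\<^bsub>P\<^esub> ?z = c A \<otimes>\<^bsub>P\<^esub> ?z \<oplus>\<^bsub>P\<^esub> \<ominus>\<^bsub>P\<^esub> (c B \<otimes>\<^bsub>P\<^esub> ?z)"
        using AB by (simp add: K.minus_eq P.l_distr P.l_minus)
      moreover have "x \<oplus>\<^bsub>P\<^esub> k = (x \<oplus>\<^bsub>P\<^esub> y) \<oplus>\<^bsub>P\<^esub> k \<oplus>\<^bsub>P\<^esub> \<ominus>\<^bsub>P\<^esub> y"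
        if "x \<in> carrier P" "k \<in> carrier P" "y \<in> carrier P" for x k y
        using that by (simp add: P.a_ac P.r_neg P.r_neg2)
      ultimately show ?thesis using AB by simp
    qed
    also have "\<dots> = y2 \<oplus>\<^bsub>P\<^esub> \<ominus>\<^bsub>P\<^esub> y1"
    proof -
      have "(x \<oplus>\<^bsub>P\<^esub> y) \<oplus>\<^bsub>P\<^esub> \<ominus>\<^bsub>P\<^esub> x = y" if "x \<in> carrier P" "y \<in> carrier P" for x y
        using that by (simp add: P.a_comm[of x y] P.a_assoc P.r_neg)
      thus ?thesis unfolding main using AB by simp
    qed
    finally show ?thesis .
  qed
  \<comment> \<open>The difference of the two sides without their top terms lies in
    \<open>M\<close>, so the coefficient of \<open>Z^(q n)\<close> in it comes from \<O>.\<close>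
  have "y2 \<oplus>\<^bsub>P\<^esub> \<ominus>\<^bsub>P\<^esub> y1 \<in> M" by (intro Madd Mneg y1 y2(1))
  then obtain y0 where y0: "y0 \<in> carrier P0" "g y0 = c (A \<ominus>\<^bsub>K\<^esub> B) \<otimes>\<^bsub>P\<^esub> ?z"
    using z by (auto simp: M_def)
  obtain d where d: "d \<in> UNIV \<rightarrow> carrier \<O>" "y0 = peval P0 N (\<lambda>i. c0 (d i)) Z0"
    using trunc_expand[OF t0 y0(1)] .
  have di: "d i \<in> carrier \<O>" for i using d(1) by auto
  hence "(\<lambda>i. g (c0 (d i))) = (\<lambda>i. c (\<iota> (d i)))" using g(2) by simp
  hence "g y0 = peval P N (\<lambda>i. c (\<iota> (d i))) Z"
    using ring_hom_peval[OF T0(2) T(2) g(1) T0(7)[OF d(1)] T0(5), of N] g(3) by (simp add: d(2))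
  hence "\<iota> (d (q * n)) = A \<ominus>\<^bsub>K\<^esub> B"
    using trunc_monomial_coeff[OF t, of "\<lambda>i. \<iota> (d i)" "q * n" "A \<ominus>\<^bsub>K\<^esub> B"] y0(2) di AB
    by (simp add: N_def K.minus_closed)
  thus ?thesis unfolding A_def B_def using di by (metis imageI)
qed

text \<open>Valuation rings are integrally closed, made explicit: if \<open>x\<close> is not
  integral, then \<open>1/x = \<iota> r\<close>, and multiplying the relation by the power
  \<open>q - 1\<close> of \<open>1/x\<close> expresses \<open>b x\<close> through
  \<open>a r^(q - 2)\<close> and \<open>d r^(q - 1)\<close>, where \<open>d\<close> is the integral
  value of the relation. Since \<open>b\<close> is a unit, \<open>x\<close> is integral after
  all.\<close>

lemma (in valuation_embedding) root_integral:
  assumes x: "x \<in> carrier K" and a: "a \<in> carrier \<O>" and b: "b \<in> Units \<O>" and q: "2 \<le> q"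
    and D: "x \<otimes>\<^bsub>K\<^esub> \<iota> a \<ominus>\<^bsub>K\<^esub> \<iota> b \<otimes>\<^bsub>K\<^esub> x [^]\<^bsub>K\<^esub> (q::nat) \<in> \<iota> ` carrier \<O>"
  shows "x \<in> \<iota> ` carrier \<O>"
proof (rule ccontr)
  assume "x \<notin> \<iota> ` carrier \<O>"
  then obtain r where r: "r \<in> carrier \<O>" "x \<otimes>\<^bsub>K\<^esub> \<iota> r = \<one>\<^bsub>K\<^esub>" using inverse_integral[OF x \<open>x \<notin> _\<close>] by blast
  define y where "y = \<iota> r"
  have y [simp]: "y \<in> carrier K" using r by (simp add: y_def)
  note x [simp]
  have bc: "b \<in> carrier \<O>" using b by (rule O.Units_closed)
  note ic [simp] = emb.hom_closed[OF a] emb.hom_closed[OF bc]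
  have xy: "x [^]\<^bsub>K\<^esub> m \<otimes>\<^bsub>K\<^esub> y [^]\<^bsub>K\<^esub> m = \<one>\<^bsub>K\<^esub>" for m :: nat
    using r(2) K.nat_pow_distrib[OF x y, of m] by (simp add: y_def)
  obtain d where d: "d \<in> carrier \<O>" "x \<otimes>\<^bsub>K\<^esub> \<iota> a \<ominus>\<^bsub>K\<^esub> \<iota> b \<otimes>\<^bsub>K\<^esub> x [^]\<^bsub>K\<^esub> q = \<iota> d" using D by auto
  define k where "k = q - 2"
  have qk: "q = Suc (Suc k)" using q by (simp add: k_def)
  have "\<iota> b \<otimes>\<^bsub>K\<^esub> x [^]\<^bsub>K\<^esub> q = x \<otimes>\<^bsub>K\<^esub> \<iota> a \<ominus>\<^bsub>K\<^esub> \<iota> d"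
  proof -
    have "v = u \<ominus>\<^bsub>K\<^esub> (u \<ominus>\<^bsub>K\<^esub> v)" if "u \<in> carrier K" "v \<in> carrier K" for u v
      using that by (simp add: K.minus_eq K.minus_add K.r_neg2)
    from this[of "x \<otimes>\<^bsub>K\<^esub> \<iota> a" "\<iota> b \<otimes>\<^bsub>K\<^esub> x [^]\<^bsub>K\<^esub> q"] d(2) show ?thesis by simp
  qed
  hence "(\<iota> b \<otimes>\<^bsub>K\<^esub> x [^]\<^bsub>K\<^esub> q) \<otimes>\<^bsub>K\<^esub> y [^]\<^bsub>K\<^esub> Suc k = (x \<otimes>\<^bsub>K\<^esub> \<iota> a \<ominus>\<^bsub>K\<^esub> \<iota> d) \<otimes>\<^bsub>K\<^esub> y [^]\<^bsub>K\<^esub> Suc k" by simp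
  moreover have "(\<iota> b \<otimes>\<^bsub>K\<^esub> x [^]\<^bsub>K\<^esub> q) \<otimes>\<^bsub>K\<^esub> y [^]\<^bsub>K\<^esub> Suc k = \<iota> b \<otimes>\<^bsub>K\<^esub> x"
  proof -
    have "x [^]\<^bsub>K\<^esub> q \<otimes>\<^bsub>K\<^esub> y [^]\<^bsub>K\<^esub> Suc k = x \<otimes>\<^bsub>K\<^esub> (x [^]\<^bsub>K\<^esub> Suc k \<otimes>\<^bsub>K\<^esub> y [^]\<^bsub>K\<^esub> Suc k)"
      unfolding qk by (simp add: K.m_ac)
    thus ?thesis unfolding xy by (simp add: K.m_assoc)
  qed
  moreover have "(x \<otimes>\<^bsub>K\<^esub> \<iota> a \<ominus>\<^bsub>K\<^esub> \<iota> d) \<otimes>\<^bsub>K\<^esub> y [^]\<^bsub>K\<^esub> Suc k = \<iota> (a \<otimes>\<^bsub>\<O>\<^esub> r [^]\<^bsub>\<O>\<^esub> k \<ominus>\<^bsub>\<O>\<^esub> d \<otimes>\<^bsub>\<O>\<^esub> r [^]\<^bsub>\<O>\<^esub> Suc k)"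
  proof -
    have "x \<otimes>\<^bsub>K\<^esub> \<iota> a \<otimes>\<^bsub>K\<^esub> y [^]\<^bsub>K\<^esub> Suc k = (x \<otimes>\<^bsub>K\<^esub> y) \<otimes>\<^bsub>K\<^esub> (\<iota> a \<otimes>\<^bsub>K\<^esub> y [^]\<^bsub>K\<^esub> k)" by (simp add: K.m_ac)
    hence "x \<otimes>\<^bsub>K\<^esub> \<iota> a \<otimes>\<^bsub>K\<^esub> y [^]\<^bsub>K\<^esub> Suc k = \<iota> a \<otimes>\<^bsub>K\<^esub> y [^]\<^bsub>K\<^esub> k" using r(2) by (simp add: y_def[symmetric])
    moreover have "y [^]\<^bsub>K\<^esub> m = \<iota> (r [^]\<^bsub>\<O>\<^esub> m)" for m :: nat using r(1) by (simp add: y_def)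
    ultimately show ?thesis using a d(1) r(1)
      by (simp add: y_def K.minus_eq O.minus_eq K.l_distr K.l_minus del: K.nat_pow_Suc O.nat_pow_Suc emb.hom_pow)
  qed
  ultimately have bx: "\<iota> b \<otimes>\<^bsub>K\<^esub> x = \<iota> (a \<otimes>\<^bsub>\<O>\<^esub> r [^]\<^bsub>\<O>\<^esub> k \<ominus>\<^bsub>\<O>\<^esub> d \<otimes>\<^bsub>\<O>\<^esub> r [^]\<^bsub>\<O>\<^esub> Suc k)" by simp
  define e where "e = a \<otimes>\<^bsub>\<O>\<^esub> r [^]\<^bsub>\<O>\<^esub> k \<ominus>\<^bsub>\<O>\<^esub> d \<otimes>\<^bsub>\<O>\<^esub> r [^]\<^bsub>\<O>\<^esub> Suc k"
  have e: "e \<in> carrier \<O>" unfolding e_def using a d(1) r(1) by (intro O.minus_closed) auto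
  have ib: "inv\<^bsub>\<O>\<^esub> b \<in> carrier \<O>" using b by simp
  have "\<iota> (inv\<^bsub>\<O>\<^esub> b) \<otimes>\<^bsub>K\<^esub> \<iota> b = \<one>\<^bsub>K\<^esub>"
    using emb.hom_mult[OF ib bc] O.Units_l_inv[OF b] by simp
  hence "x = \<iota> (inv\<^bsub>\<O>\<^esub> b) \<otimes>\<^bsub>K\<^esub> (\<iota> b \<otimes>\<^bsub>K\<^esub> x)"
    using emb.hom_closed[OF ib] by (simp add: K.m_assoc[symmetric])
  also have "\<dots> = \<iota> (inv\<^bsub>\<O>\<^esub> b \<otimes>\<^bsub>\<O>\<^esub> e)" using bx ib e by (simp add: e_def)
  finally have "x \<in> \<iota> ` carrier \<O>" using ib e by (metis O.m_closed imageI)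
  thus False using \<open>x \<notin> _\<close> by blast
qed

section \<open>Full faithfulness\<close>

lemma represents_natural:
  assumes "represents A \<phi> e" "R \<in> algs A" "T \<in> algs A" "g \<in> alg_hom A R T" "t \<in> Spf_power_series R"
  shows "\<phi> T (g t) = g (\<phi> R t)"
proof -
  obtain n where n: "t \<in> nil_le n R" using assms(5) by (rule SpfE)
  show ?thesis
    using representsD(2)[OF assms(1,2) n] representsD(2)[OF assms(1,3) nil_le_hom[OF assms(2-4) n]]
      aeval_hom[OF assms(2-4) representsD(1)[OF assms(1)] nil_leD(1)[OF n], of n] by simp
qed

lemma represents_Spf:
  assumes "cring A" "represents A \<phi> e" "e 0 = \<zero>\<^bsub>A\<^esub>" "R \<in> algs A" "t \<in> Spf_power_series R"
  shows "\<phi> R t \<in> Spf_power_series R"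
proof -
  obtain n where n: "t \<in> nil_le n R" using assms(5) by (rule SpfE)
  show ?thesis
    using aeval_nil_le[OF assms(1,4) representsD(1)[OF assms(2)] assms(3) n] representsD(2)[OF assms(2,4) n]
      nil_le_Spf by metis
qed

text \<open>The series is summed up to the least nilpotency exponent of the point; any other
  exponent gives the same value.\<close>

lemma ex_represents:
  assumes "e \<in> UNIV \<rightarrow> carrier A"
  shows "\<exists>\<phi>. represents A \<phi> e"
proof -
  define \<phi> where "\<phi> R t = aeval R (LEAST n. t \<in> nil_le n R) e t" for R t
  have "\<phi> R t = aeval R n e t" if R: "R \<in> algs A" and t: "t \<in> nil_le n R" for R n t
    unfolding \<phi>_def by (rule aeval_eq[OF R assms LeastI[of "\<lambda>n. t \<in> nil_le n R", OF t] t])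
  hence "represents A \<phi> e" using assms by (simp add: represents_def)
  thus ?thesis by blast
qed

section \<open>Descent of isomorphisms from the fraction field\<close>

context valuation_embedding
begin

lemma restrict_in_algs: "T \<in> algs K \<Longrightarrow> restrict_scalars \<O> \<iota> T \<in> algs \<O>"
  by (rule restrict_scalars_in_algs[OF O.is_cring _ emb])

text \<open>Strong induction on \<open>n\<close>, because the relation satisfied by
  \<open>s n\<close> presupposes that all earlier coefficients are integral.\<close>

lemma expansion_integral:
  assumes p: "Factorial_Ring.prime p" and h: "1 \<le> h"
    and G: "coordinate_group \<O> G \<eta>" "has_height \<O> p h G"
    and H: "coordinate_group \<O> H \<theta>" "has_height \<O> p h H"
    and f: "law_iso K (base_change_law \<O> \<iota> (coord_law G \<eta>)) (base_change_law \<O> \<iota> (coord_law H \<theta>)) f"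
    and s: "represents K f s"
  shows "s n \<in> \<iota> ` carrier \<O>"
proof -
  interpret G: coordinate_group \<O> G \<eta> by fact
  interpret H: coordinate_group \<O> H \<theta> by fact
  interpret GK: formal_group_law K "base_change_law \<O> \<iota> (coord_law G \<eta>)"
    by (rule G.law.base_change[OF K.is_cring emb])
  interpret HK: formal_group_law K "base_change_law \<O> \<iota> (coord_law H \<theta>)"
    by (rule H.law.base_change[OF K.is_cring emb])
  obtain a where a: "represents \<O> (G.law.mult_by p) a" using G.law.mult_by_expansion by blast
  obtain b where b: "represents \<O> (H.law.mult_by p) b" using H.law.mult_by_expansion by blast
  note ga = G.height_expansion[OF p h G(2) a] and gb = H.height_expansion[OF p h H(2) b]
  have aK: "represents K (GK.mult_by p) (\<lambda>i. \<iota> (a i))"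
    using represents_restrict_scalars[OF O.is_cring emb a]
    unfolding mult_by_base_change_law[OF G.law.formal_group_law_axioms GK.formal_group_law_axioms, abs_def] .
  have bK: "represents K (HK.mult_by p) (\<lambda>i. \<iota> (b i))"
    using represents_restrict_scalars[OF O.is_cring emb b]
    unfolding mult_by_base_change_law[OF H.law.formal_group_law_axioms HK.formal_group_law_axioms, abs_def] .
  have charK: "add_pow K p \<one>\<^bsub>K\<^esub> = \<zero>\<^bsub>K\<^esub>" by (rule ring_hom_char[OF O.is_cring K.is_cring emb ga(1)])
  have s0: "s 0 = \<zero>\<^bsub>K\<^esub>"
    using GK.expansion_zero[OF s] law_iso_zero[OF GK.formal_group_law_axioms HK.formal_group_law_axioms f
        self_alg_in_algs[OF K.is_cring]] by simp
  have a0: "a 0 = \<zero>\<^bsub>\<O>\<^esub>" by (rule G.law.mult_by_linear_coeff(1)[OF a])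
  define q where "q = p ^ h"
  have "p ^ 1 \<le> q" unfolding q_def using h prime_gt_0_nat[OF p] by (intro power_increasing) auto
  hence q2: "2 \<le> q" using prime_ge_2_nat[OF p] by simp
  show ?thesis
  proof (induction n rule: less_induct)
    case (less n)
    show ?case
    proof (cases "n = 0")
      case True
      thus ?thesis using s0 emb.hom_zero O.zero_closed by (metis imageI)
    next
      case False
      \<comment> \<open>The order \<open>q n + 1\<close> depends on \<open>n\<close>, so the
        truncated ring is chosen inside the induction.\<close>
      obtain P c Z where t: "is_trunc K (q * n + 1) P c Z" using ex_trunc[OF inf K.is_cring] by blast
      note S = trunc_alg[OF t]
      let ?N = "q * n + 1"
      define u where "u = aeval (P, c) ?N (\<lambda>i. \<iota> (a i)) Z"
      define v where "v = aeval (P, c) ?N s Z"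
      have u: "u \<in> nil_le ?N (P, c)" unfolding u_def
        by (rule aeval_nil_le[OF K.is_cring S(1) representsD(1)[OF aK] _ S(2)]) (simp add: a0)
      have v: "v \<in> nil_le ?N (P, c)" unfolding v_def
        by (rule aeval_nil_le[OF K.is_cring S(1) representsD(1)[OF s] s0 S(2)])
      have "f (P, c) (GK.mult_by p (P, c) Z) = HK.mult_by p (P, c) (f (P, c) Z)"
        by (rule law_iso_mult_by[OF GK.formal_group_law_axioms HK.formal_group_law_axioms f S(1) nil_le_Spf[OF S(2)]])
      hence "f (P, c) u = HK.mult_by p (P, c) v"
        using representsD(2)[OF aK S] representsD(2)[OF s S] by (simp only: u_def v_def)
      hence "aeval (P, c) ?N s u = aeval (P, c) ?N (\<lambda>i. \<iota> (b i)) v"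
        using representsD(2)[OF s S(1) u] representsD(2)[OF bK S(1) v] by simp
      hence eq: "peval P ?N (\<lambda>i. c (s i)) (peval P ?N (\<lambda>i. c (\<iota> (a i))) Z)
          = peval P ?N (\<lambda>i. c (\<iota> (b i))) (peval P ?N (\<lambda>i. c (s i)) Z)"
        by (simp add: u_def v_def)
      have "s n \<otimes>\<^bsub>K\<^esub> \<iota> (a q) [^]\<^bsub>K\<^esub> n \<ominus>\<^bsub>K\<^esub> \<iota> (b q) \<otimes>\<^bsub>K\<^esub> s n [^]\<^bsub>K\<^esub> q \<in> \<iota> ` carrier \<O>"
        by (rule coefficient_relation[OF p charK q_def _ representsD(1)[OF a] ga(2)[folded q_def] a0
              representsD(1)[OF b] gb(2)[folded q_def] representsD(1)[OF s] s0 less t eq]) (use False in simp)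
      moreover have aq: "a q \<in> carrier \<O>" and sn: "s n \<in> carrier K"
        using representsD(1)[OF a] representsD(1)[OF s] by auto
      \<comment> \<open>In \<open>root_integral\<close> the coefficient of \<open>x\<close> is the
        \<open>n\<close>-th power of \<open>a q\<close>, and that of \<open>x^q\<close> is
        \<open>b q\<close>, a unit by the height of \<open>H\<close>.\<close>
      ultimately show ?thesis
        using root_integral[OF sn O.nat_pow_closed[OF aq, of n] gb(3)[folded q_def] q2] by simp
    qed
  qed
qed

text \<open>Any pair of nilpotent points is a specialisation of the universal pair in
  \<open>\<O>[X]/(X^M)[Y]/(Y^N)\<close>, and this ring embeds in its analogue over \<open>K\<close>.
  An identity in two points therefore need only be checked over \<open>K\<close>.\<close>

lemma generic_points:
  assumes R: "R \<in> algs \<O>" and x: "x \<in> Spf_power_series R" and y: "y \<in> Spf_power_series R"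
  shows "\<exists>S\<in>algs \<O>. \<exists>T\<in>algs K. \<exists>\<psi>\<in>alg_hom \<O> S (restrict_scalars \<O> \<iota> T). inj_on \<psi> (alg_carrier S) \<and>
    (\<exists>g\<in>alg_hom \<O> S R. \<exists>x'\<in>Spf_power_series S. \<exists>y'\<in>Spf_power_series S. g x' = x \<and> g y' = y)"
proof -
  obtain M where M: "x \<in> nil_le M R" using x by (rule SpfE)
  obtain N where N: "y \<in> nil_le N R" using y by (rule SpfE)
  obtain P c X' where t: "is_trunc \<O> M P c X'" using ex_trunc[OF inf O.is_cring] by blast
  note P = trunc_alg[OF t] and T = is_truncD[OF t]
  obtain P2 d Y where t2: "is_trunc P N P2 d Y" using ex_trunc[OF inf T(2)] by blast
  note P2 = trunc_alg[OF t2] and T2 = is_truncD[OF t2]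
  obtain Q c' X'' where u: "is_trunc K M Q c' X''" using ex_trunc[OF inf K.is_cring] by blast
  note Q = trunc_alg[OF u] and U = is_truncD[OF u]
  obtain Q2 d' Y' where u2: "is_trunc Q N Q2 d' Y'" using ex_trunc[OF inf U(2)] by blast
  note Q2 = trunc_alg[OF u2] and U2 = is_truncD[OF u2]
  obtain \<phi> where \<phi>: "\<phi> \<in> ring_hom P Q" "\<And>r. r \<in> carrier \<O> \<Longrightarrow> \<phi> (c r) = c' (\<iota> r)" "inj_on \<phi> (carrier P)"
    using trunc_map[OF t u emb] emb_inj by metis
  obtain \<psi> where \<psi>: "\<psi> \<in> ring_hom P2 Q2" "\<psi> \<in> extensional (carrier P2)"
    "\<And>r. r \<in> carrier P \<Longrightarrow> \<psi> (d r) = d' (\<phi> r)" "inj_on \<psi> (carrier P2)"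
    using trunc_map[OF t2 u2 \<phi>(1)] \<phi>(3) by metis
  define S where "S = restrict_scalars \<O> c (P2, d)"
  define T' where "T' = restrict_scalars K c' (Q2, d')"
  have S: "S \<in> algs \<O>" unfolding S_def by (rule restrict_scalars_in_algs[OF O.is_cring P2(1) T(3)])
  have T': "T' \<in> algs K" unfolding T'_def by (rule restrict_scalars_in_algs[OF K.is_cring Q2(1) U(3)])
  have "\<psi> \<in> alg_hom \<O> S (restrict_scalars \<O> \<iota> T')"
    by (rule alg_homI) (use \<psi> \<phi>(2) ring_hom_closed[OF T(3)] in \<open>auto simp: S_def T'_def\<close>)
  moreover have "inj_on \<psi> (alg_carrier S)" using \<psi>(4) by (simp add: S_def)
  moreover obtain g1 where g1: "g1 \<in> alg_hom \<O> (P, c) R" "g1 X' = x" using trunc_alg_lift[OF t R M] .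
  have R1: "(fst R, g1) \<in> algs P" "restrict_scalars \<O> c (fst R, g1) = R"
    using restrict_scalars_over[OF P(1) R g1(1)] by simp_all
  have "y \<in> nil_le N (fst R, g1)" using N by (simp add: nil_le_def)
  then obtain g2 where g2: "g2 \<in> alg_hom P (P2, d) (fst R, g1)" "g2 Y = y" using trunc_alg_lift[OF t2 R1(1)] by blast
  have "g2 \<in> alg_hom \<O> S R"
    using restrict_scalars_alg_hom[OF g2(1) T(3)] R1(2) by (simp add: S_def)
  moreover have "d X' \<in> Spf_power_series S"
  proof -
    have "d \<in> alg_hom \<O> (P, c) S"
      using structure_restrict_scalars[OF P(1), of P2 d] P2(1) by (simp add: S_def)
    from Spf_hom[OF P(1) S this nil_le_Spf[OF P(2)]] show ?thesis .
  qed
  moreover have "Y \<in> Spf_power_series S" using nil_le_Spf[OF P2(2)] by (simp add: S_def)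
  moreover have "g2 (d X') = x" using alg_homD(3)[OF g2(1), of X'] T(5) g1(2) by simp
  ultimately show ?thesis using S T' g2(2) by blast
qed

text \<open>The inverse series must be integral too: lifted to \<O> it provides the two-sided
  inverse that makes the lift of \<open>f\<close> bijective over every \<O>-algebra.\<close>

lemma descend_law_iso:
  assumes G: "formal_group_law \<O> mul" and H: "formal_group_law \<O> mul'"
    and f: "law_iso K (base_change_law \<O> \<iota> mul) (base_change_law \<O> \<iota> mul') f"
    and s: "represents K f s" "\<And>n. s n \<in> \<iota> ` carrier \<O>"
    and s': "represents K (\<lambda>R. inv_into (Spf_power_series R) (f R)) s'" "\<And>n. s' n \<in> \<iota> ` carrier \<O>"
  shows "\<exists>F. law_iso \<O> mul mul' F \<and> (\<forall>R\<in>algs K. \<forall>t\<in>Spf_power_series R. F (restrict_scalars \<O> \<iota> R) t = f R t)"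
proof -
  let ?r = "restrict_scalars \<O> \<iota>"
  let ?i = "\<lambda>R. inv_into (Spf_power_series R) (f R)"
  interpret G: formal_group_law \<O> mul by fact
  interpret H: formal_group_law \<O> mul' by fact
  note GK = G.base_change[OF K.is_cring emb] and HK = H.base_change[OF K.is_cring emb]
  note f' = law_iso_inverse[OF GK f]
  note zK = self_alg_in_algs[OF K.is_cring]
  \<comment> \<open>Used once for \<open>f\<close> and once for its inverse: integral coefficients
    are pulled back to \<O> one by one, and the resulting series has no constant term because
    \<iota> is injective.\<close>
  have lift: "\<exists>e F. represents \<O> F e \<and> e 0 = \<zero>\<^bsub>\<O>\<^esub> \<and> (\<forall>R\<in>algs K. \<forall>t\<in>Spf_power_series R. F (?r R) t = k R t)"
    if k: "represents K k w" and w: "\<And>n. w n \<in> \<iota> ` carrier \<O>" and w0: "w 0 = \<zero>\<^bsub>K\<^esub>" for k w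
  proof -
    define e where "e n = inv_into (carrier \<O>) \<iota> (w n)" for n
    have ew: "\<iota> (e n) = w n" and ec: "e n \<in> carrier \<O>" for n
      using w by (auto simp: e_def f_inv_into_f inv_into_into)
    have e: "e \<in> UNIV \<rightarrow> carrier \<O>" using ec by simp
    then obtain F where F: "represents \<O> F e" using ex_represents by blast
    have "e 0 = \<zero>\<^bsub>\<O>\<^esub>" using emb_eq_iff[OF ec[of 0] O.zero_closed] ew[of 0] w0 by simp
    moreover have "F (?r R) t = k R t" if R: "R \<in> algs K" and t: "t \<in> Spf_power_series R" for R t
    proof -
      obtain n where n: "t \<in> nil_le n R" using t by (rule SpfE)
      show ?thesis
        using representsD(2)[OF represents_restrict_scalars[OF O.is_cring emb F] R n] representsD(2)[OF k R n]
        by (simp add: ew)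
    qed
    ultimately show ?thesis using F by blast
  qed
  have s0: "s 0 = \<zero>\<^bsub>K\<^esub>"
    using formal_group_law.expansion_zero[OF GK s(1)] law_iso_zero[OF GK HK f zK] by simp
  have s0': "s' 0 = \<zero>\<^bsub>K\<^esub>"
    using formal_group_law.expansion_zero[OF GK s'(1)] law_iso_zero[OF HK GK f' zK] by simp
  obtain e F where F: "represents \<O> F e" "e 0 = \<zero>\<^bsub>\<O>\<^esub>" and FK: "\<forall>R\<in>algs K. \<forall>t\<in>Spf_power_series R. F (?r R) t = f R t"
    using lift[OF s s0] by (elim exE conjE)
  obtain e' F' where F': "represents \<O> F' e'" "e' 0 = \<zero>\<^bsub>\<O>\<^esub>" and FK': "\<forall>R\<in>algs K. \<forall>t\<in>Spf_power_series R. F' (?r R) t = ?i R t"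
    using lift[OF s' s0'] by (elim exE conjE)
  note nat = represents_natural[OF F(1)] and nat' = represents_natural[OF F'(1)]
  note cl = represents_Spf[OF O.is_cring F] and cl' = represents_Spf[OF O.is_cring F']
  have bij: "bij_betw (f T) (Spf_power_series T) (Spf_power_series T)" if "T \<in> algs K" for T
    using law_isoD(1)[OF f that] .
  \<comment> \<open>Identities between points hold over \<open>\<O>\<close> because they hold at generic points, whose rings embed in
    \<open>K\<close>-algebras.\<close>
  have hom: "F R (mul R x y) = mul' R (F R x) (F R y)"
    if R: "R \<in> algs \<O>" and x: "x \<in> Spf_power_series R" and y: "y \<in> Spf_power_series R" for R x y
  proof -
    obtain S T \<psi> g x' y' where S: "S \<in> algs \<O>" and T: "T \<in> algs K" and \<psi>: "\<psi> \<in> alg_hom \<O> S (?r T)"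
      and inj: "inj_on \<psi> (alg_carrier S)" and g: "g \<in> alg_hom \<O> S R" and x': "x' \<in> Spf_power_series S"
      and y': "y' \<in> Spf_power_series S" and gxy: "g x' = x" "g y' = y"
      using generic_points[OF R x y] by (elim bexE conjE)
    note rT = restrict_in_algs[OF T]
    have px: "\<psi> x' \<in> Spf_power_series T" "\<psi> y' \<in> Spf_power_series T"
      using Spf_hom[OF S rT \<psi> x'] Spf_hom[OF S rT \<psi> y'] by simp_all
    have mc: "mul S x' y' \<in> Spf_power_series S" by (rule G.mul_closed[OF S x' y'])
    have "\<psi> (F S (mul S x' y')) = F (?r T) (mul (?r T) (\<psi> x') (\<psi> y'))"
      using nat[OF S rT \<psi> mc] G.mul_natural[OF S rT \<psi> x' y'] by simp
    also have "\<dots> = f T (base_change_law \<O> \<iota> mul T (\<psi> x') (\<psi> y'))"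
    proof -
      have "mul (?r T) (\<psi> x') (\<psi> y') \<in> Spf_power_series T" using G.mul_closed[OF rT] px by simp
      thus ?thesis using FK T by (simp add: base_change_law_def)
    qed
    also have "\<dots> = mul' (?r T) (f T (\<psi> x')) (f T (\<psi> y'))"
      using law_isoD(2)[OF f T px] by (simp add: base_change_law_def)
    also have "\<dots> = mul' (?r T) (F (?r T) (\<psi> x')) (F (?r T) (\<psi> y'))" using FK T px by simp
    also have "\<dots> = \<psi> (mul' S (F S x') (F S y'))"
      using nat[OF S rT \<psi> x'] nat[OF S rT \<psi> y'] H.mul_natural[OF S rT \<psi> cl[OF S x'] cl[OF S y']] by simp
    finally have "F S (mul S x' y') = mul' S (F S x') (F S y')"
      by (rule inj_onD[OF inj]) (rule Spf_closed, simp add: cl H.mul_closed S x' y' mc)+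
    hence "g (F S (mul S x' y')) = g (mul' S (F S x') (F S y'))" by simp
    thus ?thesis
      using nat[OF S R g mc] nat[OF S R g x'] nat[OF S R g y'] G.mul_natural[OF S R g x' y']
        H.mul_natural[OF S R g cl[OF S x'] cl[OF S y']] gxy by simp
  qed
  have inv: "F' R (F R x) = x \<and> F R (F' R x) = x" if R: "R \<in> algs \<O>" and x: "x \<in> Spf_power_series R" for R x
  proof -
    obtain S T \<psi> g x' y' where S: "S \<in> algs \<O>" and T: "T \<in> algs K" and \<psi>: "\<psi> \<in> alg_hom \<O> S (?r T)"
      and inj: "inj_on \<psi> (alg_carrier S)" and g: "g \<in> alg_hom \<O> S R" and x': "x' \<in> Spf_power_series S"
      and "y' \<in> Spf_power_series S" and gx: "g x' = x" and "g y' = x"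
      using generic_points[OF R x x] by (elim bexE conjE)
    note rT = restrict_in_algs[OF T]
    have px: "\<psi> x' \<in> Spf_power_series T" using Spf_hom[OF S rT \<psi> x'] by simp
    have fc: "f T (\<psi> x') \<in> Spf_power_series T" "?i T (\<psi> x') \<in> Spf_power_series T"
      using law_iso_closed[OF f T px] law_iso_closed[OF f' T px] .
    have "\<psi> (F' S (F S x')) = \<psi> x'"
      using nat'[OF S rT \<psi> cl[OF S x']] nat[OF S rT \<psi> x'] FK T px FK' fc(1) bij_betw_inv_into_left[OF bij[OF T] px]
      by simp
    hence 1: "F' S (F S x') = x'"
      by (rule inj_onD[OF inj]) (rule Spf_closed, simp add: cl cl' S x')+
    have "\<psi> (F S (F' S x')) = \<psi> x'"
      using nat[OF S rT \<psi> cl'[OF S x']] nat'[OF S rT \<psi> x'] FK T px FK' fc(2) bij_betw_inv_into_right[OF bij[OF T] px]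
      by simp
    hence 2: "F S (F' S x') = x'"
      by (rule inj_onD[OF inj]) (rule Spf_closed, simp add: cl cl' S x')+
    show ?thesis
      using nat'[OF S R g cl[OF S x']] nat[OF S R g x'] nat[OF S R g cl'[OF S x']] nat'[OF S R g x'] gx 1 2 by simp
  qed
  have "law_iso \<O> mul mul' F"
  proof (rule law_isoI)
    show "bij_betw (F R) (Spf_power_series R) (Spf_power_series R)" if "R \<in> algs \<O>" for R
      by (rule bij_betw_byWitness[of _ "F' R"]) (use inv[OF that] cl[OF that] cl'[OF that] in auto)
  qed (use hom nat in auto)
  thus ?thesis using FK by blast
qed

end

section \<open>Isomorphisms of formal Lie groups in coordinates\<close>

lemma FLG_isoD:
  assumes "w \<in> FLG_iso A G H"
  shows "w \<in> extensional (algs A)"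
    "R \<in> algs A \<Longrightarrow> w R \<in> iso (sections G R) (sections H R)"
    "R \<in> algs A \<Longrightarrow> w R \<in> extensional (carrier (sections G R))"
    "R \<in> algs A \<Longrightarrow> T \<in> algs A \<Longrightarrow> f \<in> alg_hom A R T \<Longrightarrow> x \<in> carrier (sections G R) \<Longrightarrow>
       w T (transition G R T f x) = transition H R T f (w R x)"
  using assms unfolding FLG_iso_def by simp_all

lemma FLG_isoI:
  assumes "w \<in> extensional (algs A)"
    "\<And>R. R \<in> algs A \<Longrightarrow> w R \<in> iso (sections G R) (sections H R)"
    "\<And>R. R \<in> algs A \<Longrightarrow> w R \<in> extensional (carrier (sections G R))"
    "\<And>R T f x. R \<in> algs A \<Longrightarrow> T \<in> algs A \<Longrightarrow> f \<in> alg_hom A R T \<Longrightarrow> x \<in> carrier (sections G R) \<Longrightarrow>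
       w T (transition G R T f x) = transition H R T f (w R x)"
  shows "w \<in> FLG_iso A G H"
  using assms unfolding FLG_iso_def by simp

definition coord_map ::
  "('u, 'x) grp_functor \<Rightarrow> ('u alg \<Rightarrow> 'x \<Rightarrow> 'u) \<Rightarrow> ('u alg \<Rightarrow> 'x \<Rightarrow> 'u) \<Rightarrow> ('u alg \<Rightarrow> 'x \<Rightarrow> 'x) \<Rightarrow> 'u alg \<Rightarrow> 'u \<Rightarrow> 'u" where
  "coord_map G \<eta> \<theta> w R t = \<theta> R (w R (inv_into (carrier (sections G R)) (\<eta> R) t))"

lemma coord_map_coord:
  assumes "coordinate_group A G \<eta>" "R \<in> algs A" "x \<in> carrier (sections G R)"
  shows "coord_map G \<eta> \<theta> w R (\<eta> R x) = \<theta> R (w R x)"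
  using coordinate_group.pt_coord[OF assms] coordinate_group.pt_def[OF assms(1)] by (simp add: coord_map_def)

lemma FLG_iso_law_iso:
  assumes G: "coordinate_group A G \<eta>" and H: "coordinate_group A H \<theta>" and w: "w \<in> FLG_iso A G H"
  shows "law_iso A (coord_law G \<eta>) (coord_law H \<theta>) (coord_map G \<eta> \<theta> w)"
proof -
  interpret G: coordinate_group A G \<eta> by fact
  interpret H: coordinate_group A H \<theta> by fact
  note cm = coord_map_coord[OF G]
  have ex: "\<exists>x\<in>carrier (sections G R). t = \<eta> R x" if "R \<in> algs A" "t \<in> Spf_power_series R" for R t
    using G.pt_closed[OF that] G.coord_pt[OF that] by metis
  have wb: "bij_betw (w R) (carrier (sections G R)) (carrier (sections H R))" if "R \<in> algs A" for R
    using FLG_isoD(2)[OF w that] by (simp add: iso_def)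
  have wh: "w R \<in> hom (sections G R) (sections H R)" if "R \<in> algs A" for R
    using FLG_isoD(2)[OF w that] by (simp add: iso_def)
  show ?thesis
  proof (rule law_isoI)
    fix R assume R: "R \<in> algs A"
    interpret GR: comm_group "sections G R" by (rule G.group_sections[OF R])
    have "bij_betw (\<theta> R \<circ> (w R \<circ> G.pt R)) (Spf_power_series R) (Spf_power_series R)"
      unfolding G.pt_def
      by (rule bij_betw_trans[OF bij_betw_trans[OF bij_betw_inv_into[OF G.coord_bij[OF R]] wb[OF R]] H.coord_bij[OF R]])
    moreover have "\<theta> R \<circ> (w R \<circ> G.pt R) = coord_map G \<eta> \<theta> w R" by (simp add: fun_eq_iff coord_map_def G.pt_def)
    ultimately show "bij_betw (coord_map G \<eta> \<theta> w R) (Spf_power_series R) (Spf_power_series R)" by simp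
    fix s assume "s \<in> Spf_power_series R"
    then obtain x where x: "x \<in> carrier (sections G R)" "s = \<eta> R x" using ex[OF R] by blast
    have wx: "w R x \<in> carrier (sections H R)" by (rule bij_betw_apply[OF wb[OF R] x(1)])
    {
      fix t assume "t \<in> Spf_power_series R"
      then obtain y where y: "y \<in> carrier (sections G R)" "t = \<eta> R y" using ex[OF R] by blast
      have wy: "w R y \<in> carrier (sections H R)" by (rule bij_betw_apply[OF wb[OF R] y(1)])
      have "coord_map G \<eta> \<theta> w R (coord_law G \<eta> R s t) = \<theta> R (w R (x \<otimes>\<^bsub>sections G R\<^esub> y))"
        using G.coord_mult[OF R x(1) y(1)] cm[OF R, of "x \<otimes>\<^bsub>sections G R\<^esub> y"] x y by simp
      also have "w R (x \<otimes>\<^bsub>sections G R\<^esub> y) = w R x \<otimes>\<^bsub>sections H R\<^esub> w R y"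
        by (rule hom_mult[OF wh[OF R] x(1) y(1)])
      finally show "coord_map G \<eta> \<theta> w R (coord_law G \<eta> R s t)
          = coord_law H \<theta> R (coord_map G \<eta> \<theta> w R s) (coord_map G \<eta> \<theta> w R t)"
        using H.coord_mult[OF R wx wy] cm[OF R x(1)] cm[OF R y(1)] x y by simp
    }
    fix T g assume T: "T \<in> algs A" and g: "g \<in> alg_hom A R T"
    have "coord_map G \<eta> \<theta> w T (g s) = \<theta> T (w T (transition G R T g x))"
      using G.coord_natural[OF R T g x(1)] cm[OF T G.transition_closed[OF R T g x(1)]] x(2) by simp
    also have "\<dots> = g (\<theta> R (w R x))"
      using FLG_isoD(4)[OF w R T g x(1)] H.coord_natural[OF R T g wx] by simp
    finally show "coord_map G \<eta> \<theta> w T (g s) = g (coord_map G \<eta> \<theta> w R s)"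
      using cm[OF R x(1)] x(2) by simp
  qed
qed

lemma law_iso_FLG_iso:
  assumes G: "coordinate_group A G \<eta>" and H: "coordinate_group A H \<theta>"
    and F: "law_iso A (coord_law G \<eta>) (coord_law H \<theta>) F"
  obtains w where "w \<in> FLG_iso A G H"
    "\<forall>R\<in>algs A. \<forall>x\<in>carrier (sections G R). \<theta> R (w R x) = F R (\<eta> R x)"
proof -
  interpret G: coordinate_group A G \<eta> by fact
  interpret H: coordinate_group A H \<theta> by fact
  define w where "w = (\<lambda>R\<in>algs A. \<lambda>x\<in>carrier (sections G R). H.pt R (F R (\<eta> R x)))"
  have wR: "w R x = H.pt R (F R (\<eta> R x))" if "R \<in> algs A" "x \<in> carrier (sections G R)" for R x
    using that by (simp add: w_def)
  have Fc: "F R (\<eta> R x) \<in> Spf_power_series R" if "R \<in> algs A" "x \<in> carrier (sections G R)" for R x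
    by (rule law_iso_closed[OF F that(1) G.coord_closed[OF that]])
  have wc: "w R x \<in> carrier (sections H R)" if "R \<in> algs A" "x \<in> carrier (sections G R)" for R x
    using H.pt_closed[OF that(1) Fc[OF that]] wR[OF that] by simp
  have tw: "\<theta> R (w R x) = F R (\<eta> R x)" if "R \<in> algs A" "x \<in> carrier (sections G R)" for R x
    using H.coord_pt[OF that(1) Fc[OF that]] wR[OF that] by simp
  have "w \<in> FLG_iso A G H"
  proof (rule FLG_isoI)
    show "w \<in> extensional (algs A)" by (simp add: w_def)
    fix R assume R: "R \<in> algs A"
    interpret GR: comm_group "sections G R" by (rule G.group_sections[OF R])
    interpret HR: comm_group "sections H R" by (rule H.group_sections[OF R])
    show "w R \<in> extensional (carrier (sections G R))" using R by (simp add: w_def)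
    have "bij_betw (H.pt R \<circ> (F R \<circ> \<eta> R)) (carrier (sections G R)) (carrier (sections H R))"
      unfolding H.pt_def
      by (rule bij_betw_trans[OF bij_betw_trans[OF G.coord_bij[OF R] law_isoD(1)[OF F R]] bij_betw_inv_into[OF H.coord_bij[OF R]]])
    hence "bij_betw (w R) (carrier (sections G R)) (carrier (sections H R))"
      by (rule bij_betw_cong[THEN iffD1, rotated]) (simp add: wR[OF R])
    moreover have "w R (x \<otimes>\<^bsub>sections G R\<^esub> y) = w R x \<otimes>\<^bsub>sections H R\<^esub> w R y"
      if x: "x \<in> carrier (sections G R)" and y: "y \<in> carrier (sections G R)" for x y
    proof (rule H.coord_inj[OF R])
      show "\<theta> R (w R (x \<otimes>\<^bsub>sections G R\<^esub> y)) = \<theta> R (w R x \<otimes>\<^bsub>sections H R\<^esub> w R y)"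
        using tw[OF R, of "x \<otimes>\<^bsub>sections G R\<^esub> y"] tw[OF R x] tw[OF R y] G.coord_mult[OF R x y]
          H.coord_mult[OF R wc[OF R x] wc[OF R y]] law_isoD(2)[OF F R G.coord_closed[OF R x] G.coord_closed[OF R y]] x y
        by simp
    qed (use wc[OF R] x y in auto)
    ultimately show "w R \<in> iso (sections G R) (sections H R)"
      using wc[OF R] by (simp add: iso_def hom_def)
    fix T f x assume T: "T \<in> algs A" and f: "f \<in> alg_hom A R T" and x: "x \<in> carrier (sections G R)"
    note tx = G.transition_closed[OF R T f x]
    show "w T (transition G R T f x) = transition H R T f (w R x)"
    proof (rule H.coord_inj[OF T wc[OF T tx] H.transition_closed[OF R T f wc[OF R x]]])
      show "\<theta> T (w T (transition G R T f x)) = \<theta> T (transition H R T f (w R x))"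
        using tw[OF T tx] G.coord_natural[OF R T f x] law_isoD(3)[OF F R T f G.coord_closed[OF R x]]
          H.coord_natural[OF R T f wc[OF R x]] tw[OF R x] by simp
    qed
  qed
  thus thesis using that tw by blast
qed

section \<open>Base change on objects and morphisms\<close>

context valuation_embedding
begin

abbreviation "bc \<equiv> base_change \<O> \<iota>"
abbreviation "bci \<equiv> base_change_iso \<O> K \<iota>"

lemma base_change_iso_apply: "R \<in> algs K \<Longrightarrow> bci w R = w (restrict_scalars \<O> \<iota> R)"
  by (simp add: base_change_iso_def)

lemma sections_base_change: "sections (bc G) R = sections G (restrict_scalars \<O> \<iota> R)"
  "transition (bc G) R T = transition G (restrict_scalars \<O> \<iota> R) (restrict_scalars \<O> \<iota> T)"
  by (simp_all add: base_change_def)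

lemma base_change_iso_closed:
  assumes "w \<in> FLG_iso \<O> G H"
  shows "bci w \<in> FLG_iso K (bc G) (bc H)"
proof (rule FLG_isoI)
  show "bci w \<in> extensional (algs K)" by (simp add: base_change_iso_def)
  fix R assume R: "R \<in> algs K"
  show "bci w R \<in> iso (sections (bc G) R) (sections (bc H) R)"
    using FLG_isoD(2)[OF assms restrict_in_algs[OF R]] by (simp add: base_change_iso_apply[OF R] sections_base_change)
  show "bci w R \<in> extensional (carrier (sections (bc G) R))"
    using FLG_isoD(3)[OF assms restrict_in_algs[OF R]] by (simp add: base_change_iso_apply[OF R] sections_base_change)
  fix T f x assume T: "T \<in> algs K" and f: "f \<in> alg_hom K R T" and x: "x \<in> carrier (sections (bc G) R)"
  have "x \<in> carrier (sections G (restrict_scalars \<O> \<iota> R))" using x by (simp add: sections_base_change)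
  from FLG_isoD(4)[OF assms restrict_in_algs[OF R] restrict_in_algs[OF T] restrict_scalars_alg_hom[OF f emb] this]
  show "bci w T (transition (bc G) R T f x) = transition (bc H) R T f (bci w R x)"
    by (simp add: base_change_iso_apply[OF R] base_change_iso_apply[OF T] sections_base_change)
qed

lemma base_change_coordinate:
  "coordinate_group \<O> G \<eta> \<Longrightarrow> coordinate_group K (bc G) (\<lambda>R. \<eta> (restrict_scalars \<O> \<iota> R))"
  by (rule coordinate_group.base_change_coordinate_group[OF _ K.is_cring emb])

text \<open>Every \<open>K\<close>-algebra is an \<O>-algebra by restriction, so the condition on
  all nonzero algebras is tested on fewer of them.\<close>

lemma base_change_has_height:
  assumes p: "0 < p" and G: "coordinate_group \<O> G \<eta>" and ht: "has_height \<O> p h G"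
  shows "has_height K p h (bc G)"
proof -
  interpret G: coordinate_group \<O> G \<eta> by fact
  interpret GK: coordinate_group K "bc G" "\<lambda>R. \<eta> (restrict_scalars \<O> \<iota> R)"
    by (rule base_change_coordinate[OF G])
  obtain a where a: "represents \<O> (G.law.mult_by p) a" using G.law.mult_by_expansion by blast
  have "GK.law.mult_by p = (\<lambda>R. G.law.mult_by p (restrict_scalars \<O> \<iota> R))"
    using mult_by_base_change_law[OF G.formal_group_law GK.formal_group_law[unfolded coord_law_base_change], of p]
    unfolding coord_law_base_change by (simp add: fun_eq_iff)
  hence aK: "represents K (GK.law.mult_by p) (\<lambda>i. \<iota> (a i))"
    using represents_restrict_scalars[OF O.is_cring emb a] by simp
  note hO = G.has_height_iff[OF a p, of h, THEN iffD1, OF ht]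
  have "\<exists>i<p ^ (h + 1). snd R (\<iota> (a i)) \<noteq> \<zero>\<^bsub>fst R\<^esub>" if R: "R \<in> algs K" and nz: "\<one>\<^bsub>fst R\<^esub> \<noteq> \<zero>\<^bsub>fst R\<^esub>" for R
  proof -
    have "a i \<in> carrier \<O>" for i using representsD(1)[OF a] by auto
    thus ?thesis using hO[THEN conjunct2, THEN bspec, OF restrict_in_algs[OF R]] nz by simp
  qed
  thus ?thesis using GK.has_height_iff[OF aK p, of h] hO by simp
qed

text \<open>At algebras coming from \<open>K\<close> the two isomorphisms agree by hypothesis. The
  other \<O>-algebras are reached only through the coefficients, which \<iota> separates.\<close>

lemma base_change_iso_inj:
  assumes G: "coordinate_group \<O> G \<eta>" and H: "coordinate_group \<O> H \<theta>"
    and u: "u \<in> FLG_iso \<O> G H" and v: "v \<in> FLG_iso \<O> G H" and eq: "bci u = bci v"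
  shows "u = v"
proof -
  interpret G: coordinate_group \<O> G \<eta> by fact
  interpret H: coordinate_group \<O> H \<theta> by fact
  note lu = FLG_iso_law_iso[OF G H u] and lv = FLG_iso_law_iso[OF G H v]
  obtain a where a: "represents \<O> (coord_map G \<eta> \<theta> u) a" using law_iso_expansion[OF G.formal_group_law lu] .
  obtain b where b: "represents \<O> (coord_map G \<eta> \<theta> v) b" using law_iso_expansion[OF G.formal_group_law lv] .
  have "(\<lambda>i. \<iota> (a i)) = (\<lambda>i. \<iota> (b i))"
  proof (rule represents_unique[OF inf K.is_cring represents_restrict_scalars[OF O.is_cring emb a]
        represents_restrict_scalars[OF O.is_cring emb b]])
    fix R t assume R: "R \<in> algs K"
    have "u (restrict_scalars \<O> \<iota> R) = v (restrict_scalars \<O> \<iota> R)"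
      using fun_cong[OF eq, of R] by (simp add: base_change_iso_apply[OF R])
    thus "coord_map G \<eta> \<theta> u (restrict_scalars \<O> \<iota> R) t = coord_map G \<eta> \<theta> v (restrict_scalars \<O> \<iota> R) t"
      by (simp add: coord_map_def)
  qed
  moreover have "a i \<in> carrier \<O>" "b i \<in> carrier \<O>" for i
    using representsD(1)[OF a] representsD(1)[OF b] by auto
  ultimately have ab: "a = b" using emb_eq_iff by (metis ext)
  show ?thesis
  proof (rule extensionalityI[OF FLG_isoD(1)[OF u] FLG_isoD(1)[OF v]])
    fix R assume R: "R \<in> algs \<O>"
    show "u R = v R"
    proof (rule extensionalityI[OF FLG_isoD(3)[OF u R] FLG_isoD(3)[OF v R]])
      fix x assume x: "x \<in> carrier (sections G R)"
      obtain n where n: "\<eta> R x \<in> nil_le n R" using G.coord_closed[OF R x] by (rule SpfE)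
      have "u R x \<in> carrier (sections H R)" "v R x \<in> carrier (sections H R)"
        using FLG_isoD(2)[OF u R] FLG_isoD(2)[OF v R] x by (auto simp: iso_def hom_def)
      moreover have "\<theta> R (u R x) = \<theta> R (v R x)"
        using representsD(2)[OF a R n] representsD(2)[OF b R n] ab coord_map_coord[OF G R x] by metis
      ultimately show "u R x = v R x" by (rule H.coord_inj[OF R])
    qed
  qed
qed

text \<open>The integrality result is applied twice: to \<open>f\<close> and, with \<open>G\<close>
  and \<open>H\<close> exchanged, to its inverse.\<close>

lemma base_change_iso_surj:
  assumes p: "Factorial_Ring.prime p" and h: "1 \<le> h"
    and G: "coordinate_group \<O> G \<eta>" "has_height \<O> p h G"
    and H: "coordinate_group \<O> H \<theta>" "has_height \<O> p h H"
    and w: "w \<in> FLG_iso K (bc G) (bc H)"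
  shows "w \<in> bci ` FLG_iso \<O> G H"
proof -
  interpret G: coordinate_group \<O> G \<eta> by fact
  interpret H: coordinate_group \<O> H \<theta> by fact
  let ?r = "restrict_scalars \<O> \<iota>"
  note GK = base_change_coordinate[OF G(1)] and HK = base_change_coordinate[OF H(1)]
  interpret HK: coordinate_group K "bc H" "\<lambda>R. \<theta> (?r R)" by (rule HK)
  define f where "f = coord_map (bc G) (\<lambda>R. \<eta> (?r R)) (\<lambda>R. \<theta> (?r R)) w"
  have f: "law_iso K (base_change_law \<O> \<iota> (coord_law G \<eta>)) (base_change_law \<O> \<iota> (coord_law H \<theta>)) f"
    using FLG_iso_law_iso[OF GK HK w] unfolding coord_law_base_change f_def .
  note Gl = G.law.base_change[OF K.is_cring emb] and Hl = H.law.base_change[OF K.is_cring emb]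
  note f' = law_iso_inverse[OF Gl f]
  obtain s where s: "represents K f s" using law_iso_expansion[OF Gl f] .
  obtain s' where s': "represents K (\<lambda>R. inv_into (Spf_power_series R) (f R)) s'" using law_iso_expansion[OF Hl f'] .
  have "\<exists>F. law_iso \<O> (coord_law G \<eta>) (coord_law H \<theta>) F \<and>
      (\<forall>R\<in>algs K. \<forall>t\<in>Spf_power_series R. F (?r R) t = f R t)"
    by (rule descend_law_iso[OF G.formal_group_law H.formal_group_law f s expansion_integral[OF p h G H f s]
          s' expansion_integral[OF p h H G f' s']])
  then obtain F where F: "law_iso \<O> (coord_law G \<eta>) (coord_law H \<theta>) F"
    "\<forall>R\<in>algs K. \<forall>t\<in>Spf_power_series R. F (?r R) t = f R t" by blast
  obtain u where u: "u \<in> FLG_iso \<O> G H" "\<forall>R\<in>algs \<O>. \<forall>x\<in>carrier (sections G R). \<theta> R (u R x) = F R (\<eta> R x)"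
    using law_iso_FLG_iso[OF G(1) H(1) F(1)] .
  note bu = base_change_iso_closed[OF u(1)]
  have "bci u = w"
  proof (rule extensionalityI[OF FLG_isoD(1)[OF bu] FLG_isoD(1)[OF w]])
    fix R assume R: "R \<in> algs K"
    note rR = restrict_in_algs[OF R]
    show "bci u R = w R"
    proof (rule extensionalityI[OF FLG_isoD(3)[OF bu R] FLG_isoD(3)[OF w R]])
      fix x assume x: "x \<in> carrier (sections (bc G) R)"
      have x': "x \<in> carrier (sections G (?r R))" using x by (simp add: sections_base_change)
      have "bci u R x \<in> carrier (sections (bc H) R)" "w R x \<in> carrier (sections (bc H) R)"
        using FLG_isoD(2)[OF bu R] FLG_isoD(2)[OF w R] x by (auto simp: iso_def hom_def)
      moreover have "\<theta> (?r R) (bci u R x) = \<theta> (?r R) (w R x)"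
      proof -
        have "\<eta> (?r R) x \<in> Spf_power_series R" using G.coord_closed[OF rR x'] by simp
        hence "\<theta> (?r R) (bci u R x) = f R (\<eta> (?r R) x)"
          using u(2) rR x' F(2) R by (simp add: base_change_iso_apply[OF R])
        also have "\<dots> = \<theta> (?r R) (w R x)" unfolding f_def by (rule coord_map_coord[OF GK R x])
        finally show ?thesis .
      qed
      ultimately show "bci u R x = w R x" by (rule HK.coord_inj[OF R])
    qed
  qed
  thus ?thesis using u(1) by blast
qed

end

theorem theorem5p5:
  fixes p h :: nat
    and \<O> K :: "'u ring"
    and \<iota> :: "'u \<Rightarrow> 'u"
  assumes "infinite (UNIV :: 'u set)"
    and "Factorial_Ring.prime p"
    and "is_valuation_ring_of \<O> K \<iota>"
    and "1 \<le> h"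
  shows "fully_faithful_functor
           (FLG_height \<O> p h :: (('u, 'x) grp_functor, 'u alg \<Rightarrow> 'x \<Rightarrow> 'x) cat)
           (FLG_height K p h)
           (base_change \<O> \<iota>)
           (\<lambda>G H. base_change_iso \<O> K \<iota>)"
proof -
  interpret V: valuation_embedding \<O> K \<iota> by unfold_locales (fact assms(1), fact assms(3))
  have p: "0 < p" by (rule prime_gt_0_nat[OF assms(2)])
  have coord: "\<exists>\<eta>. coordinate_group \<O> G \<eta>" if fl: "formal_Lie_group \<O> G" for G :: "('u, 'x) grp_functor"
  proof -
    obtain \<eta> where "coordinate_group \<O> G \<eta>" using V.ex_coordinate[OF fl] .
    thus ?thesis by blast
  qed
  have obj: "V.bc G \<in> Obj (FLG_height K p h)" if "G \<in> Obj (FLG_height \<O> p h)" for G :: "('u, 'x) grp_functor"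
  proof -
    from that have G: "formal_Lie_group \<O> G" "has_height \<O> p h G" by (simp_all add: FLG_height_def)
    obtain \<eta> where \<eta>: "coordinate_group \<O> G \<eta>" using coord[OF G(1)] by blast
    show ?thesis
      using coordinate_group.formal_Lie_group[OF V.base_change_coordinate[OF \<eta>]] V.base_change_has_height[OF p \<eta> G(2)]
      by (simp add: FLG_height_def)
  qed
  \<comment> \<open>Identities and composites are preserved on the nose, because base change of a
    morphism only restricts the family of its components to algebras coming from
    \<open>K\<close>.\<close>
  have ident: "V.bci (\<lambda>R\<in>algs \<O>. \<lambda>x\<in>carrier (sections G R). x) = (\<lambda>R\<in>algs K. \<lambda>x\<in>carrier (sections (V.bc G) R). x)"
    for G :: "('u, 'x) grp_functor"
    unfolding base_change_iso_def by (intro restrict_ext) (simp add: V.restrict_in_algs V.sections_base_change)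
  have comp: "V.bci (\<lambda>R\<in>algs \<O>. compose (carrier (sections G R)) (v R) (u R))
      = (\<lambda>R\<in>algs K. compose (carrier (sections (V.bc G) R)) (V.bci v R) (V.bci u R))"
    for G :: "('u, 'x) grp_functor" and u v :: "'u alg \<Rightarrow> 'x \<Rightarrow> 'x"
    unfolding base_change_iso_def by (intro restrict_ext) (simp add: V.restrict_in_algs V.sections_base_change)
  have bij: "bij_betw V.bci (FLG_iso \<O> G H) (FLG_iso K (V.bc G) (V.bc H))"
    if G: "G \<in> Obj (FLG_height \<O> p h)" and H: "H \<in> Obj (FLG_height \<O> p h)" for G H :: "('u, 'x) grp_functor"
  proof -
    from G H have ht: "has_height \<O> p h G" "has_height \<O> p h H" and fg: "formal_Lie_group \<O> G" "formal_Lie_group \<O> H"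
      by (simp_all add: FLG_height_def)
    obtain \<eta> where \<eta>: "coordinate_group \<O> G \<eta>" using coord[OF fg(1)] by blast
    obtain \<theta> where \<theta>: "coordinate_group \<O> H \<theta>" using coord[OF fg(2)] by blast
    show ?thesis
      unfolding bij_betw_def
    proof (intro conjI inj_onI equalityI subsetI)
      show "u = v" if "u \<in> FLG_iso \<O> G H" "v \<in> FLG_iso \<O> G H" "V.bci u = V.bci v" for u v
        by (rule V.base_change_iso_inj[OF \<eta> \<theta> that])
      show "w \<in> FLG_iso K (V.bc G) (V.bc H)" if "w \<in> V.bci ` FLG_iso \<O> G H" for w
        using that V.base_change_iso_closed by blast
      show "w \<in> V.bci ` FLG_iso \<O> G H" if "w \<in> FLG_iso K (V.bc G) (V.bc H)" for w
        by (rule V.base_change_iso_surj[OF assms(2,4) \<eta> ht(1) \<theta> ht(2) that])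
    qed
  qed
  show ?thesis
    unfolding fully_faithful_functor_def is_functor_def
  proof (intro conjI ballI)
    fix G :: "('u, 'x) grp_functor" assume G: "G \<in> Obj (FLG_height \<O> p h)"
    show "V.bc G \<in> Obj (FLG_height K p h)" by (rule obj[OF G])
    show "V.bci (Ident (FLG_height \<O> p h) G) = Ident (FLG_height K p h) (V.bc G)"
      using ident by (simp add: FLG_height_def)
    fix H :: "('u, 'x) grp_functor" assume H: "H \<in> Obj (FLG_height \<O> p h)"
    show "bij_betw V.bci (Hom (FLG_height \<O> p h) G H) (Hom (FLG_height K p h) (V.bc G) (V.bc H))"
      using bij[OF G H] by (simp add: FLG_height_def)
    show "V.bci u \<in> Hom (FLG_height K p h) (V.bc G) (V.bc H)" if "u \<in> Hom (FLG_height \<O> p h) G H" for u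
      using that V.base_change_iso_closed by (simp add: FLG_height_def)
    fix L :: "('u, 'x) grp_functor" and u v
    show "V.bci (Comp (FLG_height \<O> p h) G H L v u) = Comp (FLG_height K p h) (V.bc G) (V.bc H) (V.bc L) (V.bci v) (V.bci u)"
      using comp by (simp add: FLG_height_def)
  qed
qed

end
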